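(* Let $A_1$ be bounded, let $l\in\{+1,-1\}$, let $\Gamma^l\subset D^l$ be an admissible contour with $\mathcal{V}_0(B,\Gamma^l)<\frac14 d^2(\Gamma^l)$, let $Z^{(l)}=A_1+X^{(l)}$, and suppose that $$\operatorname{dist}\bigl(\operatorname{spec}(Z^{(l)}),D^l\bigr)>0.$$ Set $$Y^{(l)}=\int_{\Delta_0}\mathsf{E}_0(d\mu)\,B\,(Z^{(l)}-\mu)^{-1}$$ (integral understood in the strong sense). Then $Y^{(l)}$ is a bounded operator from $\mathfrak{A}_1$ to $\mathfrak{A}_0$ and $$\|Y^{(l)}\|\le\left(\int_{\Delta_0}d\mu\,\|K_B'(\mu)\|\,\|(Z^{(l)}-\mu)^{-1}\|^2\right)^{1/2}.$$ Moreover, $Y^{(l)}$ is a strong solution of the operator Riccati equation $$A_0Y-YA_1+YB^*Y=-B.$$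
   Context: Let $A_0$, $A_1$ be self-adjoint operators in complex Hilbert spaces $\mathfrak{A}_0$, $\mathfrak{A}_1$, with spectra $\sigma_0$, $\sigma_1$, and let $B$ be a bounded operator from $\mathfrak{A}_1$ to $\mathfrak{A}_0$. $\mathcal{B}(\mathfrak{A}_1)$ denotes the bounded operators on $\mathfrak{A}_1$. Standing assumptions: the whole spectrum $\sigma_0$ is absolutely continuous and equals the closure of a single interval $\Delta_0=(\mu_0^{(1)},\mu_0^{(2)})$, $-\infty\le\mu_0^{(1)}<\mu_0^{(2)}\le\infty$, and $\sigma_1\subset\Delta_0$. Let $\mathsf{E}_0$ be the spectral measure of $A_0$, $\mathsf{E}^0(\mu)=\mathsf{E}_0((-\infty,\mu))$, and $K_B(\mu)=B^*\mathsf{E}^0(\mu)B$. It is assumed that $K_B$ is differentiable on $\Delta_0$ in operator norm and that its derivative $K_B'$ admits analytic continuation from $\Delta_0$ to a simply connected domain $D^-\subset\mathbb{C}^-$ (lower half-plane) whose boundary includes $\Delta_0$. Then $K_B'$ also continues analytically to the domain $D^+\subset\mathbb{C}^+$ symmetric to $D^-$ about the real axis, with $[K_B'(\mu)]^*=K_B'(\bar\mu)$ on $D^\pm$. If an end point $\mu_0^{(k)}$ is finite, it is assumed that $\|K_B'(\mu)\|\le C|\mu-\mu_0^{(k)}|^\gamma$ for $\mu\in D^\pm$ near $\mu_0^{(k)}$, with some $C>0$, $\gamma\in(-1,0]$. The index $l=\pm1$ in $D^l$ is identified with the sign $\pm$. A contour $\Gamma^l$ is a rectifiable Jordan curve obtained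 by a continuous deformation of $\Delta_0$, lying in $D^l$, with the (finite) end points fixed, oriented from $\mu_0^{(1)}$ to $\mu_0^{(2)}$. It is called admissible if $\mathcal{V}_0(B,\Gamma^l):=\int_{\Gamma^l}|d\mu|\,\|K_B'(\mu)\|<\infty$ ($|d\mu|$ is arc length). Put $d(\Gamma^l)=\operatorname{dist}(\sigma_1,\Gamma^l)$. For $Z=A_1+X$, $X\in\mathcal{B}(\mathfrak{A}_1)$, with spectrum not intersecting $\Gamma^l$, set $W_1(Z,\Gamma^l)=-\int_{\Gamma^l}d\mu\,K_B'(\mu)(Z-\mu)^{-1}$. If $\mathcal{V}_0(B,\Gamma^l)<\frac14d^2(\Gamma^l)$, the operator $X^{(l)}$ is the unique solution $X\in\mathcal{B}(\mathfrak{A}_1)$ of $X=W_1(A_1+X,\Gamma^l)$ with $\|X\|\le\frac{d(\Gamma^l)}2-\sqrt{\frac{d^2(\Gamma^l)}4-\mathcal{V}_0(B,\Gamma^l)}$; for fixed $l$ it does not depend on the choice of such a contour. Strong solution: a bounded operator $Y:\mathfrak{A}_1\to\mathfrak{A}_0$ is a strong solution of $A_0Y-YA_1+YB^*Y=-B$ if $Y$ maps $\operatorname{Dom}(A_1)$ into $\operatorname{Dom}(A_0)$ and $A_0Yx-YA_1x+YB^*Yx=-Bx$ for all $x\in\operatorname{Dom}(A_1)$ (here $\operatorname{Dom}(A_1)=\mathfrak{A}_1$).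
   Formalization: If an end point of Δ_0 is infinite, admissibility of Γ^l also requires that arbitrarily far out there be arcs in D^l from Δ_0 to Γ^l with arbitrarily small ∫|dμ| ‖K_B'(μ)‖; without this the claim can fail for K_B' of doubly exponential growth between Δ_0 and Γ^l. *)

theory Defs
  imports "HOL-Analysis.Analysis"
begin

section \<open>Complex Hilbert spaces\<close>

text \<open>
  The norm and the topology come from the underlying real Hilbert space, whose inner product is
  the real part of the complex one.  The complex inner product is linear in its second argument.
\<close>

class chilbert = banach + real_inner +
  fixes scaleC :: "complex \<Rightarrow> 'a \<Rightarrow> 'a"  (infixr \<open>*\<^sub>C\<close> 75)
    and cinner :: "'a \<Rightarrow> 'a \<Rightarrow> complex"
  assumes scaleC_add_right: "c *\<^sub>C (x + y) = c *\<^sub>C x + c *\<^sub>C y"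
    and scaleC_add_left: "(c + d) *\<^sub>C x = c *\<^sub>C x + d *\<^sub>C x"
    and scaleC_scaleC: "c *\<^sub>C (d *\<^sub>C x) = (c * d) *\<^sub>C x"
    and scaleC_of_real: "complex_of_real r *\<^sub>C x = r *\<^sub>R x"
    and cinner_commute: "cinner x y = cnj (cinner y x)"
    and cinner_add_right: "cinner x (y + z) = cinner x y + cinner x z"
    and cinner_scaleC_right: "cinner x (c *\<^sub>C y) = c * cinner x y"
    and inner_eq_Re_cinner: "inner x y = Re (cinner x y)"

lemma norm_scaleC: "norm (c *\<^sub>C x) = cmod c * norm (x::'a::chilbert)"
proof -
  have self: "cinner y y = complex_of_real ((norm y)\<^sup>2)" for y :: 'a
  proof (rule complex_eqI)
    show "Re (cinner y y) = Re (complex_of_real ((norm y)\<^sup>2))"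
      by (simp flip: inner_eq_Re_cinner add: power2_norm_eq_inner)
    have "Im (cinner y y) = - Im (cinner y y)"
      using arg_cong[OF cinner_commute[of y y], of Im] by simp
    then show "Im (cinner y y) = Im (complex_of_real ((norm y)\<^sup>2))" by simp
  qed
  have "cinner (c *\<^sub>C x) (c *\<^sub>C x) = c * cnj (c * cinner x x)"
    by (metis cinner_commute cinner_scaleC_right)
  also have "\<dots> = complex_of_real ((cmod c * norm x)\<^sup>2)"
    by (simp add: self power_mult_distrib mult.assoc[symmetric] complex_norm_square[symmetric]
             del: of_real_power)
  finally have "(norm (c *\<^sub>C x))\<^sup>2 = (cmod c * norm x)\<^sup>2"
    unfolding self of_real_eq_iff .
  then show ?thesis
    by (simp add: power2_eq_iff_nonneg)
qed

lemma bounded_linear_scaleC: "bounded_linear (\<lambda>x::'a::chilbert. c *\<^sub>C x)"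
proof (rule bounded_linear_intro[where K = "cmod c"])
  show "c *\<^sub>C (r *\<^sub>R x) = r *\<^sub>R (c *\<^sub>C x)" for r and x :: 'a
    by (simp add: scaleC_scaleC mult.commute flip: scaleC_of_real)
qed (simp_all add: scaleC_add_right norm_scaleC mult.commute)

section \<open>Bounded and unbounded operators\<close>

text \<open>
  Bounded operators are elements of the type of bounded real-linear maps that satisfy
  \<open>clinear_op\<close>; the norm of that type is the operator norm.  A possibly unbounded operator is given
  by its domain \<open>D\<close> and a function \<open>A\<close> that matters on \<open>D\<close> only; for a bounded operator \<open>D = UNIV\<close>.
\<close>

definition clinear_op :: "('a::chilbert \<Rightarrow>\<^sub>L 'b::chilbert) \<Rightarrow> bool" where
  "clinear_op T \<longleftrightarrow> (\<forall>c x. T (c *\<^sub>C x) = c *\<^sub>C T x)"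

lift_definition scaleC_op ::
  "complex \<Rightarrow> ('a::chilbert \<Rightarrow>\<^sub>L 'b::chilbert) \<Rightarrow> ('a \<Rightarrow>\<^sub>L 'b)"  (infixr \<open>*\<^sub>O\<close> 75)
  is "\<lambda>c T x. c *\<^sub>C T x"
  using bounded_linear_compose[OF bounded_linear_scaleC] .

definition adj :: "('a::chilbert \<Rightarrow>\<^sub>L 'b::chilbert) \<Rightarrow> ('b \<Rightarrow>\<^sub>L 'a)" where
  "adj T = (THE S. \<forall>x y. cinner (blinfun_apply T x) y = cinner x (blinfun_apply S y))"

definition selfadjoint :: "'a::chilbert set \<Rightarrow> ('a \<Rightarrow> 'a) \<Rightarrow> bool" where
  "selfadjoint D A \<longleftrightarrow>
     0 \<in> D \<and> (\<forall>x\<in>D. \<forall>y\<in>D. x + y \<in> D \<and> A (x + y) = A x + A y) \<and>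
     (\<forall>c. \<forall>x\<in>D. c *\<^sub>C x \<in> D \<and> A (c *\<^sub>C x) = c *\<^sub>C A x) \<and>
     closure D = UNIV \<and>
     (\<forall>x\<in>D. \<forall>y\<in>D. cinner y (A x) = cinner (A y) x) \<and>
     {y. \<exists>w. \<forall>x\<in>D. cinner y (A x) = cinner w x} = D"

definition is_resolvent ::
  "'a::chilbert set \<Rightarrow> ('a \<Rightarrow> 'a) \<Rightarrow> complex \<Rightarrow> ('a \<Rightarrow>\<^sub>L 'a) \<Rightarrow> bool" where
  "is_resolvent D A z R \<longleftrightarrow> clinear_op R \<and>
     (\<forall>y. R y \<in> D \<and> A (R y) - z *\<^sub>C R y = y) \<and> (\<forall>x\<in>D. R (A x - z *\<^sub>C x) = x)"

definition spec :: "'a::chilbert set \<Rightarrow> ('a \<Rightarrow> 'a) \<Rightarrow> complex set" where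
  "spec D A = {z. \<nexists>R. is_resolvent D A z R}"

definition resolvent :: "('a::chilbert \<Rightarrow>\<^sub>L 'a) \<Rightarrow> complex \<Rightarrow> ('a \<Rightarrow>\<^sub>L 'a)" where
  "resolvent Z z = (THE R. is_resolvent UNIV Z z R)"

definition op_holomorphic_on ::
  "(complex \<Rightarrow> ('a::chilbert \<Rightarrow>\<^sub>L 'b::chilbert)) \<Rightarrow> complex set \<Rightarrow> bool" where
  "op_holomorphic_on F S \<longleftrightarrow>
     (\<forall>z\<in>S. \<exists>F'. clinear_op F' \<and> (F has_derivative (\<lambda>h. h *\<^sub>O F')) (at z within S))"

section \<open>Spectral measures\<close>

definition spectral_measure :: "(real set \<Rightarrow> ('a::chilbert \<Rightarrow>\<^sub>L 'a)) \<Rightarrow> bool" where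
  "spectral_measure E \<longleftrightarrow>
     (\<forall>S\<in>sets borel. clinear_op (E S) \<and> E S o\<^sub>L E S = E S \<and>
        (\<forall>x y. cinner (E S x) y = cinner x (E S y))) \<and>
     E UNIV = id_blinfun \<and>
     (\<forall>S :: nat \<Rightarrow> real set. range S \<subseteq> sets borel \<and> disjoint_family S \<longrightarrow>
        (\<forall>x. (\<lambda>n. E (S n) x) sums E (\<Union>n. S n) x))"

text \<open>The scalar measure \<open>S \<mapsto> \<langle>x, E(S) x\<rangle>\<close>.\<close>

definition spectral_distr :: "(real set \<Rightarrow> ('a::chilbert \<Rightarrow>\<^sub>L 'a)) \<Rightarrow> 'a \<Rightarrow> real measure" where
  "spectral_distr E x = measure_of UNIV (sets borel) (\<lambda>S. ennreal ((norm (E S x))\<^sup>2))"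

text \<open>\<open>A = \<integral> t E(dt)\<close>, in quadratic form sense on the natural domain.\<close>

definition spectral_measure_of ::
  "'a::chilbert set \<Rightarrow> ('a \<Rightarrow> 'a) \<Rightarrow> (real set \<Rightarrow> ('a \<Rightarrow>\<^sub>L 'a)) \<Rightarrow> bool" where
  "spectral_measure_of D A E \<longleftrightarrow> spectral_measure E \<and>
     D = {x. (\<integral>\<^sup>+t. ennreal (t\<^sup>2) \<partial>spectral_distr E x) < \<infinity>} \<and>
     (\<forall>x\<in>D. cinner x (A x) = complex_of_real (\<integral>t. t \<partial>spectral_distr E x))"

definition abs_cont_spectrum :: "(real set \<Rightarrow> ('a::chilbert \<Rightarrow>\<^sub>L 'a)) \<Rightarrow> bool" where
  "abs_cont_spectrum E \<longleftrightarrow> (\<forall>x. absolutely_continuous lborel (spectral_distr E x))"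

text \<open>Filters of approach, from inside, to the end points of an open interval of the real line.\<close>

definition at_lower :: "ereal \<Rightarrow> real filter" where
  "at_lower a = (if a = - \<infinity> then at_bot else at_right (real_of_ereal a))"

definition at_upper :: "ereal \<Rightarrow> real filter" where
  "at_upper b = (if b = \<infinity> then at_top else at_left (real_of_ereal b))"

text \<open>
  The Stieltjes integral \<open>\<integral> E(d\<mu>) f(\<mu>)\<close> of a vector-valued function: over a compact interval it is
  the norm limit of the sums \<open>\<Sum> E([t\<^sub>j\<^sub>-\<^sub>1, t\<^sub>j)) f(\<zeta>\<^sub>j)\<close> as the mesh tends to zero, over an open
  interval the norm limit of the integrals over compact subintervals.
\<close>

definition has_stieltjes ::
  "(real set \<Rightarrow> ('a::chilbert \<Rightarrow>\<^sub>L 'a)) \<Rightarrow> (real \<Rightarrow> 'a) \<Rightarrow> real \<Rightarrow> real \<Rightarrow> 'a \<Rightarrow> bool" where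
  "has_stieltjes E f \<alpha> \<beta> v \<longleftrightarrow>
     (\<forall>e>0. \<exists>\<delta>>0. \<forall>p. p tagged_division_of {\<alpha>..\<beta>} \<and> (\<lambda>x. ball x \<delta>) fine p \<longrightarrow>
        norm ((\<Sum>(\<zeta>, k)\<in>p. E {Inf k..<Sup k} (f \<zeta>)) - v) < e)"

definition has_improper_stieltjes ::
  "(real set \<Rightarrow> ('a::chilbert \<Rightarrow>\<^sub>L 'a)) \<Rightarrow> (real \<Rightarrow> 'a) \<Rightarrow> ereal \<Rightarrow> ereal \<Rightarrow> 'a \<Rightarrow> bool" where
  "has_improper_stieltjes E f m1 m2 v \<longleftrightarrow>
     (\<exists>J. (\<forall>\<alpha>\<in>einterval m1 m2. \<forall>\<beta>\<in>einterval m1 m2. \<alpha> < \<beta> \<longrightarrow> has_stieltjes E f \<alpha> \<beta> (J (\<alpha>, \<beta>))) \<and>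
        (J \<longlongrightarrow> v) (at_lower m1 \<times>\<^sub>F at_upper m2))"

section \<open>The function \<open>K\<^sub>B\<close> and its derivative\<close>

definition K_B ::
  "(real set \<Rightarrow> ('a::chilbert \<Rightarrow>\<^sub>L 'a)) \<Rightarrow> ('b::chilbert \<Rightarrow>\<^sub>L 'a) \<Rightarrow> real \<Rightarrow> ('b \<Rightarrow>\<^sub>L 'b)" where
  "K_B E B \<mu> = adj B o\<^sub>L E {..<\<mu>} o\<^sub>L B"

text \<open>
  \<open>K'\<close> is the derivative of \<open>K\<^sub>B\<close> on \<open>(m1, m2)\<close> together with its continuation to the domain \<open>Dm\<close> in
  the lower half-plane and to the mirror image of \<open>Dm\<close>.  Continuation from the interval means:
  holomorphic in the domains and continuous up to the interval.
\<close>

definition continued_derivative ::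
  "(real set \<Rightarrow> ('a::chilbert \<Rightarrow>\<^sub>L 'a)) \<Rightarrow> ('b::chilbert \<Rightarrow>\<^sub>L 'a) \<Rightarrow> ereal \<Rightarrow> ereal \<Rightarrow> complex set \<Rightarrow>
   (complex \<Rightarrow> ('b \<Rightarrow>\<^sub>L 'b)) \<Rightarrow> bool" where
  "continued_derivative E B m1 m2 Dm K' \<longleftrightarrow>
     open Dm \<and> connected Dm \<and> simply_connected Dm \<and> Dm \<subseteq> {z. Im z < 0} \<and>
     complex_of_real ` einterval m1 m2 \<subseteq> frontier Dm \<and>
     (\<forall>\<mu>\<in>einterval m1 m2. (K_B E B has_vector_derivative K' (complex_of_real \<mu>)) (at \<mu>)) \<and>
     (\<forall>z\<in>Dm \<union> cnj ` Dm. clinear_op (K' z)) \<and>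
     op_holomorphic_on K' (Dm \<union> cnj ` Dm) \<and>
     continuous_on (Dm \<union> cnj ` Dm \<union> complex_of_real ` einterval m1 m2) K' \<and>
     (\<forall>z\<in>Dm \<union> cnj ` Dm. adj (K' z) = K' (cnj z))"

definition endpoint_bound ::
  "complex set \<Rightarrow> (complex \<Rightarrow> ('b::chilbert \<Rightarrow>\<^sub>L 'b)) \<Rightarrow> ereal \<Rightarrow> bool" where
  "endpoint_bound Dm K' m \<longleftrightarrow>
     (\<bar>m\<bar> \<noteq> \<infinity> \<longrightarrow>
       (\<exists>C>0. \<exists>\<gamma>\<in>{-1<..0}.
          \<forall>\<^sub>F z in at (complex_of_real (real_of_ereal m)) within (Dm \<union> cnj ` Dm).
            norm (K' z) \<le> C * cmod (z - complex_of_real (real_of_ereal m)) powr \<gamma>))"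

definition Dl :: "complex set \<Rightarrow> int \<Rightarrow> complex set" where
  "Dl Dm l = (if l = 1 then cnj ` Dm else Dm)"

section \<open>Contours\<close>

text \<open>
  A (locally) rectifiable curve is represented by its parametrisation by arc length, so that
  \<open>d\<mu>\<close> becomes \<open>\<gamma>'(t) dt\<close> and \<open>|d\<mu>|\<close> becomes \<open>dt\<close>.
\<close>

definition arc_length_param :: "real set \<Rightarrow> (real \<Rightarrow> complex) \<Rightarrow> bool" where
  "arc_length_param I \<gamma> \<longleftrightarrow>
     (\<forall>s\<in>I. \<forall>t\<in>I. cmod (\<gamma> s - \<gamma> t) \<le> \<bar>s - t\<bar>) \<and>
     (AE t in lborel. t \<in> I \<longrightarrow> (\<exists>v. cmod v = 1 \<and> (\<gamma> has_vector_derivative v) (at t)))"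

definition V0 :: "(complex \<Rightarrow> ('b::chilbert \<Rightarrow>\<^sub>L 'b)) \<Rightarrow> real set \<Rightarrow> (real \<Rightarrow> complex) \<Rightarrow> ennreal" where
  "V0 K' I \<gamma> = (\<integral>\<^sup>+t\<in>I. ennreal (norm (K' (\<gamma> t))) \<partial>lborel)"

definition end_filter :: "ereal \<Rightarrow> complex filter" where
  "end_filter m = (if \<bar>m\<bar> = \<infinity> then at_infinity else nhds (complex_of_real (real_of_ereal m)))"

text \<open>
  A continuous deformation \<open>h\<close>, inside the domain \<open>D\<close>, of the interval \<open>(m1, m2)\<close> at time \<open>0\<close> into
  the curve \<open>\<gamma>\<close> at time \<open>1\<close>, with the end points fixed uniformly in time.
\<close>

definition deformation ::
  "complex set \<Rightarrow> ereal \<Rightarrow> ereal \<Rightarrow> ereal \<Rightarrow> ereal \<Rightarrow> (real \<Rightarrow> complex) \<Rightarrow> (real \<times> real \<Rightarrow> complex) \<Rightarrow> bool"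
where
  "deformation D m1 m2 a b \<gamma> h \<longleftrightarrow>
     continuous_on ({0..1} \<times> einterval a b) h \<and>
     (\<exists>\<phi>. strict_mono_on (einterval a b) \<phi> \<and> \<phi> ` einterval a b = einterval m1 m2 \<and>
        (\<forall>t\<in>einterval a b. h (0, t) = complex_of_real (\<phi> t))) \<and>
     (\<forall>t\<in>einterval a b. h (1, t) = \<gamma> t) \<and>
     h ` ({0<..1} \<times> einterval a b) \<subseteq> D \<and>
     filterlim h (end_filter m1) (principal {0..1} \<times>\<^sub>F at_lower a) \<and>
     filterlim h (end_filter m2) (principal {0..1} \<times>\<^sub>F at_upper b)"

definition contour ::
  "complex set \<Rightarrow> ereal \<Rightarrow> ereal \<Rightarrow> ereal \<Rightarrow> ereal \<Rightarrow> (real \<Rightarrow> complex) \<Rightarrow> bool" where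
  "contour D m1 m2 a b \<gamma> \<longleftrightarrow>
     a < b \<and> (a = - \<infinity> \<longleftrightarrow> m1 = - \<infinity>) \<and> (b = \<infinity> \<longleftrightarrow> m2 = \<infinity>) \<and>
     arc_length_param (einterval a b) \<gamma> \<and> inj_on \<gamma> (einterval a b) \<and>
     \<gamma> ` einterval a b \<subseteq> D \<and> (\<exists>h. deformation D m1 m2 a b \<gamma> h)"

text \<open>
  An infinite end point.  Near a finite end point the bound on \<open>K'\<close> makes \<open>\<integral> |d\<mu>| \<parallel>K'(\<mu>)\<parallel>\<close> small
  over short arcs leading from the interval to the contour, which is what allows integrals to
  follow the deformation up to the end point.  Near an infinite end point nothing in the geometry
  of a deformation gives this: for functions of doubly exponential growth between the interval and
  the contour the two integrals may converge and differ.  Keeping an infinite end point fixed is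
  therefore read as the corresponding requirement that, arbitrarily far out, there are arcs in \<open>D\<close>
  from the interval to the contour with arbitrarily small \<open>\<integral> |d\<mu>| \<parallel>K'(\<mu>)\<parallel>\<close>.  For finite \<open>m1\<close>, \<open>m2\<close>
  the condition \<open>fixes_infinite_ends\<close> is void.
\<close>

definition link ::
  "complex set \<Rightarrow> (complex \<Rightarrow> ('b::chilbert \<Rightarrow>\<^sub>L 'b)) \<Rightarrow> complex \<Rightarrow> complex \<Rightarrow> real \<Rightarrow> bool" where
  "link D K' z w e \<longleftrightarrow>
     (\<exists>L>0. \<exists>c. arc_length_param {0..L} c \<and> c 0 = z \<and> c L = w \<and> c ` {0<..L} \<subseteq> D \<and>
        V0 K' {0..L} c < ennreal e)"

definition fixes_infinite_ends ::
  "complex set \<Rightarrow> (complex \<Rightarrow> ('b::chilbert \<Rightarrow>\<^sub>L 'b)) \<Rightarrow> ereal \<Rightarrow> ereal \<Rightarrow> (real \<Rightarrow> complex) \<Rightarrow> bool"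
where
  "fixes_infinite_ends D K' m1 m2 \<gamma> \<longleftrightarrow>
     (m1 = - \<infinity> \<longrightarrow> (\<forall>e>0. \<exists>\<^sub>F (x, t) in at_bot \<times>\<^sub>F at_bot. link D K' (complex_of_real x) (\<gamma> t) e)) \<and>
     (m2 = \<infinity> \<longrightarrow> (\<forall>e>0. \<exists>\<^sub>F (x, t) in at_top \<times>\<^sub>F at_top. link D K' (complex_of_real x) (\<gamma> t) e))"

definition admissible ::
  "complex set \<Rightarrow> (complex \<Rightarrow> ('b::chilbert \<Rightarrow>\<^sub>L 'b)) \<Rightarrow> ereal \<Rightarrow> ereal \<Rightarrow> ereal \<Rightarrow> ereal \<Rightarrow>
   (real \<Rightarrow> complex) \<Rightarrow> bool" where
  "admissible D K' m1 m2 a b \<gamma> \<longleftrightarrow>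
     contour D m1 m2 a b \<gamma> \<and> fixes_infinite_ends D K' m1 m2 \<gamma> \<and>
     V0 K' (einterval a b) \<gamma> < \<infinity>"

text \<open>\<open>has_W1 K' a b \<gamma> Z W\<close> says that the integral defining \<open>W\<^sub>1(Z, \<Gamma>)\<close> exists and has the value \<open>W\<close>.\<close>

definition has_W1 ::
  "(complex \<Rightarrow> ('b::chilbert \<Rightarrow>\<^sub>L 'b)) \<Rightarrow> ereal \<Rightarrow> ereal \<Rightarrow> (real \<Rightarrow> complex) \<Rightarrow>
   ('b \<Rightarrow>\<^sub>L 'b) \<Rightarrow> ('b \<Rightarrow>\<^sub>L 'b) \<Rightarrow> bool" where
  "has_W1 K' a b \<gamma> Z W \<longleftrightarrow>
     spec UNIV Z \<inter> \<gamma> ` einterval a b = {} \<and>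
     ((\<lambda>t. vector_derivative \<gamma> (at t) *\<^sub>O (K' (\<gamma> t) o\<^sub>L resolvent Z (\<gamma> t))) has_integral - W)
       (einterval a b)"

definition contour_dist :: "('b::chilbert \<Rightarrow>\<^sub>L 'b) \<Rightarrow> ereal \<Rightarrow> ereal \<Rightarrow> (real \<Rightarrow> complex) \<Rightarrow> real" where
  "contour_dist A1 a b \<gamma> = setdist (spec UNIV A1) (\<gamma> ` einterval a b)"

text \<open>\<open>X\<close> is the solution in the ball in which solutions of \<open>X = W\<^sub>1(A1 + X, \<Gamma>)\<close> are unique.\<close>

definition basic_solution ::
  "(complex \<Rightarrow> ('b::chilbert \<Rightarrow>\<^sub>L 'b)) \<Rightarrow> ereal \<Rightarrow> ereal \<Rightarrow> (real \<Rightarrow> complex) \<Rightarrow>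
   ('b \<Rightarrow>\<^sub>L 'b) \<Rightarrow> ('b \<Rightarrow>\<^sub>L 'b) \<Rightarrow> bool" where
  "basic_solution K' a b \<gamma> A1 X \<longleftrightarrow>
     clinear_op X \<and> has_W1 K' a b \<gamma> (A1 + X) X \<and>
     norm X \<le> contour_dist A1 a b \<gamma> / 2
       - sqrt ((contour_dist A1 a b \<gamma>)\<^sup>2 / 4 - enn2real (V0 K' (einterval a b) \<gamma>))"

section \<open>The Riccati equation\<close>

definition strong_solution ::
  "'a::chilbert set \<Rightarrow> ('a \<Rightarrow> 'a) \<Rightarrow> 'b::chilbert set \<Rightarrow> ('b \<Rightarrow> 'b) \<Rightarrow> ('b \<Rightarrow>\<^sub>L 'a) \<Rightarrow> ('b \<Rightarrow>\<^sub>L 'a) \<Rightarrow> bool"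
where
  "strong_solution D0 A0 D1 A1 B Y \<longleftrightarrow> clinear_op Y \<and>
     (\<forall>x\<in>D1. Y x \<in> D0 \<and> A0 (Y x) - Y (A1 x) + Y (adj B (Y x)) = - B x)"

end

theory Submission
  imports Defs "HOL-Complex_Analysis.Riemann_Mapping"
begin

text \<open>
  Put \<open>Z = A\<^sub>1 + X\<close> and \<open>R(\<mu>) = (Z - \<mu>)\<inverse>\<close>.  If \<open>Y = \<integral> E(d\<mu>) B R(\<mu>)\<close> makes sense, then
  \<open>\<mu> R(\<mu>) = R(\<mu>) Z - 1\<close> gives \<open>A\<^sub>0 Y = Y Z - B = Y A\<^sub>1 + Y X - B\<close>, and the Riccati equation follows
  from \<open>X = - B\<^sup>* Y\<close>.  Formally \<open>B\<^sup>* Y = \<integral> K'(\<mu>) R(\<mu>) d\<mu>\<close> over the interval,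
  while \<open>- X\<close> is the same integral over the contour; the two agree by Cauchy's theorem, because the
  spectrum of \<open>Z\<close> stays away from the domain between them.  This splits the proof into an operator
  part and a part on scalar holomorphic functions.

  The operator part.  Differentiability of \<open>K\<close> turns \<open>\<parallel>E [s, t) B x\<parallel>\<^sup>2 = \<langle>x, (K t - K s) x\<rangle>\<close> into the bound
  \<open>\<parallel>E [s, t) B\<parallel> \<le> M (t - s)\<^sup>1\<^sup>/\<^sup>2\<close> on compact subintervals.  The integral \<open>J s t\<close> over \<open>[s, t)\<close> is defined
  through integration by parts, where only a norm-continuous integrand is left, and on short intervals it
  equals \<open>E [s, t) B R(\<zeta>)\<close> up to an error of order \<open>(t - s)\<^sup>3\<^sup>/\<^sup>2\<close> (\<open>J_local\<close>).  As the order exceeds one,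
  such errors may be added up: Riemann--Stieltjes sums converge to \<open>J\<close> (\<open>has_stieltjes_J\<close>), and the
  local relation between \<open>A\<^sub>0\<close> and multiplication by \<open>\<mu>\<close> integrates to \<open>A\<^sub>0 J = J Z - E [s, t) B\<close>
  (\<open>A_J\<close>).  The latter identity also controls \<open>J\<close> near the ends of the interval.  Near a finite end
  point \<open>c\<close>, which lies in the resolvent set of \<open>Z\<close>, it expresses \<open>J\<close> by \<open>R(c)\<close> and a small multiple of \<open>J\<close>
  itself; near infinity \<open>A\<^sub>0\<close> dominates \<open>Z\<close>.  Since increments of \<open>J\<close> over disjoint intervals are orthogonal, uniform
  boundedness implies strong convergence to an operator \<open>Y\<close> (\<open>J_limit\<close>).  Integrating by
  parts back gives \<open>B\<^sup>* J = \<integral> K' R\<close> and \<open>\<parallel>J x\<parallel>\<^sup>2 = \<integral> \<langle>K' R x, R x\<rangle>\<close>, hence the norm estimate.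

  The scalar part.  Let \<open>g(z) = \<langle>y, K'(z) R(z) x\<rangle>\<close>, with primitive \<open>G\<close> in the simply connected domain \<open>D\<close>.
  A priori \<open>D\<close> may be wild near the interval, but the deformation of the interval into the contour sweeps
  a full half-neighbourhood of every compact subinterval (\<open>half_neighbourhood\<close>, from Brouwer's
  fixed point theorem), so that \<open>G\<close> extends continuously to the interval.  Integrals of \<open>g\<close> over the interval
  and over the contour are then differences of values of \<open>G\<close>, and it remains to compare
  these values near the ends.  They are joined by arcs in \<open>D\<close> along which \<open>\<integral> \<bar>d\<mu>\<bar> \<parallel>K'(\<mu>)\<parallel>\<close> is arbitrarily
  small: near an infinite end such arcs are part of the meaning of a fixed end point, near a finite
  one they are arcs of small circles, which are shown to lie in \<open>D\<close> by another application of Brouwer's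
  theorem (\<open>crosscut\<close>).
\<close>

section \<open>Complex Hilbert spaces\<close>

lemma cinner_scaleC_left: "cinner (c *\<^sub>C x) (y::'a::chilbert) = cnj c * cinner x y"
  by (metis cinner_commute cinner_scaleC_right complex_cnj_mult)

lemma norm_cinner_le: "cmod (cinner x y) \<le> norm x * norm (y::'a::chilbert)"
proof (cases "cinner x y = 0")
  case False
  define c where "c = cnj (sgn (cinner x y))"
  have c: "cmod c = 1" using False by (simp add: c_def norm_sgn)
  have "c * cinner x y = complex_of_real (cmod (cinner x y))"
    using False complex_norm_square[of "cinner x y"]
    by (simp add: c_def sgn_eq field_simps power2_eq_square)
  then have "cmod (cinner x y) = Re (cinner x (c *\<^sub>C y))"
    by (simp add: cinner_scaleC_right)
  also have "\<dots> = inner x (c *\<^sub>C y)" by (simp add: inner_eq_Re_cinner)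
  also have "\<dots> \<le> norm x * norm (c *\<^sub>C y)" by (rule norm_cauchy_schwarz)
  finally show ?thesis by (simp add: norm_scaleC c)
qed simp

lemma bounded_linear_cinner_right: "bounded_linear (\<lambda>y::'a::chilbert. cinner x y)"
proof (rule bounded_linear_intro[where K = "norm x"])
  show "cinner x (r *\<^sub>R y) = r *\<^sub>R cinner x y" for r y
    by (simp add: cinner_scaleC_right flip: scaleC_of_real) (simp add: scaleR_conv_of_real)
  show "norm (cinner x y) \<le> norm y * norm x" for y
    using norm_cinner_le[of x y] by (simp add: mult.commute)
qed (simp add: cinner_add_right)

lemma cinner_diff_right: "cinner x (y - z) = cinner x y - cinner x (z::'a::chilbert)"
  by (rule linear_diff[OF bounded_linear.linear[OF bounded_linear_cinner_right]])

lemma scaleC_diff_right: "c *\<^sub>C (x - y) = c *\<^sub>C x - c *\<^sub>C (y::'a::chilbert)"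
  by (rule linear_diff[OF bounded_linear.linear[OF bounded_linear_scaleC]])

lemma scaleC_diff_left: "(c - d) *\<^sub>C x = c *\<^sub>C x - d *\<^sub>C (x::'a::chilbert)"
  using scaleC_add_left[of "c - d" d x] by (simp add: algebra_simps)

lemma scaleC_op_apply [simp]: "(c *\<^sub>O T) x = c *\<^sub>C T x"
  by (simp add: scaleC_op.rep_eq)

lemma norm_scaleC_op_le: "norm (c *\<^sub>O T) \<le> cmod c * norm T"
  by (rule norm_blinfun_bound) (auto simp: norm_scaleC mult.assoc intro!: mult_left_mono norm_blinfun)

lemma bounded_linear_scaleC_op_left: "bounded_linear (\<lambda>c. c *\<^sub>O T)"
proof (rule bounded_linear_intro[where K = "norm T"])
  show "(r *\<^sub>R c) *\<^sub>O T = r *\<^sub>R (c *\<^sub>O T)" for r c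
    by (rule blinfun_eqI)
      (simp add: scaleR_conv_of_real blinfun.scaleR_left flip: scaleC_scaleC scaleC_of_real)
qed (auto simp: norm_scaleC_op_le blinfun.add_left scaleC_add_left intro!: blinfun_eqI)

lemma of_real_scaleC_op: "complex_of_real r *\<^sub>O T = r *\<^sub>R T"
  by (rule blinfun_eqI) (simp add: scaleC_of_real blinfun.scaleR_left)

subsection \<open>Adjoints\<close>

text \<open>
  The functional is represented by the minimiser of
  \<open>\<parallel>x\<parallel>\<^sup>2/2 - f x\<close>, which exists because the parallelogram law makes minimising sequences Cauchy.
\<close>

lemma Riesz_representation:
  fixes f :: "'a::{banach, real_inner} \<Rightarrow> real"
  assumes "bounded_linear f"
  shows "\<exists>a. \<forall>x. f x = inner a x"
proof -
  interpret f: bounded_linear f by fact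
  obtain K where K: "\<And>x. norm (f x) \<le> norm x * K"
    using f.bounded by blast
  define \<phi> where "\<phi> x = (norm x)\<^sup>2 / 2 - f x" for x
  have lb: "\<phi> x \<ge> - (K\<^sup>2 / 2)" for x
  proof -
    have "f x \<le> norm x * K" using K[of x] by simp
    moreover have "0 \<le> (norm x - K)\<^sup>2" by simp
    ultimately show ?thesis unfolding \<phi>_def by (simp add: power2_diff)
  qed
  define m where "m = Inf (range \<phi>)"
  have bdd: "bdd_below (range \<phi>)" using lb by (auto intro!: bdd_belowI)
  have m: "m \<le> \<phi> x" for x unfolding m_def by (rule cInf_lower) (use bdd in auto)
  have "\<exists>x. \<phi> x < m + 1 / real (Suc n)" for n
  proof -
    have "Inf (range \<phi>) < m + 1 / real (Suc n)" by (simp add: m_def)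
    then show ?thesis using cInf_less_iff[of "range \<phi>"] bdd by auto
  qed
  then obtain u where u: "\<And>n. \<phi> (u n) < m + 1 / real (Suc n)" by metis
  have par: "(norm (x - y))\<^sup>2 / 4 \<le> (\<phi> x - m) + (\<phi> y - m)" for x y
  proof -
    have "(norm (x - y))\<^sup>2 / 4 = \<phi> x + \<phi> y - 2 * \<phi> ((1/2) *\<^sub>R (x + y))"
      unfolding \<phi>_def f.scaleR f.add
      by (simp add: power2_norm_eq_inner algebra_simps inner_commute field_simps)
    then show ?thesis using m[of "(1/2) *\<^sub>R (x + y)"] by simp
  qed
  have "Cauchy u"
  proof (rule metric_CauchyI)
    fix e :: real assume e: "e > 0"
    obtain N where N: "8 / e\<^sup>2 < real (Suc N)"
      by (meson less_trans of_nat_less_iff lessI reals_Archimedean2)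
    have "dist (u i) (u j) < e" if "i \<ge> N" "j \<ge> N" for i j
    proof -
      have le: "1 / real (Suc k) \<le> 1 / real (Suc N)" if "k \<ge> N" for k
        using that by (simp add: field_simps)
      have "(norm (u i - u j))\<^sup>2 / 4 < 2 / real (Suc N)"
        using par[of "u i" "u j"] u[of i] u[of j] le[OF that(1)] le[OF that(2)] by simp
      also have "2 / real (Suc N) < e\<^sup>2 / 4" using N e by (simp add: field_simps)
      finally have "(norm (u i - u j))\<^sup>2 < e\<^sup>2" by simp
      then show ?thesis using e by (simp add: dist_norm power2_less_imp_less)
    qed
    then show "\<exists>M. \<forall>i\<ge>M. \<forall>j\<ge>M. dist (u i) (u j) < e" by blast
  qed
  then obtain a where a: "u \<longlonglongrightarrow> a" using Cauchy_convergent convergent_def by blast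
  have "(\<lambda>n. \<phi> (u n)) \<longlonglongrightarrow> \<phi> a"
    unfolding \<phi>_def by (intro tendsto_intros a f.tendsto) simp
  moreover have "(\<lambda>n. \<phi> (u n)) \<longlonglongrightarrow> m"
  proof (rule tendsto_sandwich[where f = "\<lambda>_. m" and h = "\<lambda>n. m + 1 / real (Suc n)"])
    show "(\<lambda>n. m + 1 / real (Suc n)) \<longlonglongrightarrow> m"
      using tendsto_add[OF tendsto_const LIMSEQ_inverse_real_of_nat, of m] 
      by (simp add: inverse_eq_divide)
  qed (use u m in \<open>auto intro!: always_eventually less_imp_le\<close>)
  ultimately have \<phi>a: "\<phi> a = m" by (rule LIMSEQ_unique)
  have "f x = inner a x" for x
  proof -
    define c where "c = inner a x - f x"
    have quad: "0 \<le> t * c + t\<^sup>2 * ((norm x)\<^sup>2 / 2)" for t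
    proof -
      have "(norm (a + t *\<^sub>R x))\<^sup>2 = (norm a)\<^sup>2 + 2 * t * inner a x + t\<^sup>2 * (norm x)\<^sup>2"
        unfolding power2_norm_eq_inner
        by (simp add: power2_eq_square[of t] algebra_simps inner_commute)
      then have "\<phi> (a + t *\<^sub>R x) = \<phi> a + (t * c + t\<^sup>2 * ((norm x)\<^sup>2 / 2))"
        unfolding \<phi>_def c_def f.scaleR f.add by (simp add: algebra_simps)
      then show ?thesis using m[of "a + t *\<^sub>R x"] \<phi>a by simp
    qed
    have "c = 0"
    proof (rule ccontr)
      assume "c \<noteq> 0"
      define N where "N = (norm x)\<^sup>2 / 2 + 1"
      have N: "N > 0" by (simp add: N_def add_nonneg_pos)
      have "(- c / N) * c + (- c / N)\<^sup>2 * ((norm x)\<^sup>2 / 2) = - (c\<^sup>2 / N\<^sup>2)"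
        using N by (simp add: N_def power2_eq_square divide_simps) (simp add: algebra_simps)?
      moreover have "c\<^sup>2 / N\<^sup>2 > 0" using \<open>c \<noteq> 0\<close> N by simp
      ultimately show False using quad[of "- c / N"] by simp
    qed
    then show ?thesis by (simp add: c_def)
  qed
  then show ?thesis by blast
qed

lemma adj_exists:
  fixes T :: "'a::chilbert \<Rightarrow>\<^sub>L 'b::chilbert"
  assumes T: "clinear_op T"
  shows "\<exists>S :: 'b \<Rightarrow>\<^sub>L 'a. \<forall>x y. cinner (T x) y = cinner x (S y)"
proof -
  have "\<exists>a. \<forall>x. inner (T x) y = inner a x" for y
    by (rule Riesz_representation)
      (intro bounded_linear_compose[OF bounded_linear_inner_left] blinfun.bounded_linear_right)
  then obtain g where g: "\<And>x y. inner (T x) y = inner (g y) x" by metis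
  have eqI: "v = w" if "\<And>x. inner v x = inner w x" for v w :: 'a
    using that[of "v - w"] by (metis inner_diff_left inner_eq_zero_iff right_minus_eq)
  have "bounded_linear g"
  proof (rule bounded_linear_intro[where K = "norm T"])
    show "g (x + y) = g x + g y" for x y
      by (rule eqI) (simp add: inner_add_left inner_add_right flip: g)
    show "g (r *\<^sub>R x) = r *\<^sub>R g x" for r x
      by (rule eqI) (simp flip: g)
    show "norm (g y) \<le> norm y * norm T" for y
    proof -
      have "norm (g y) * norm (g y) = inner (T (g y)) y"
        by (simp add: g power2_norm_eq_inner flip: power2_eq_square)
      also have "\<dots> \<le> norm (T (g y)) * norm y" by (rule norm_cauchy_schwarz)
      also have "\<dots> \<le> (norm T * norm (g y)) * norm y"
        by (intro mult_right_mono norm_blinfun) simp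
      finally show ?thesis
        by (cases "norm (g y) = 0") (auto simp: mult_ac)
    qed
  qed
  then obtain S where S: "\<And>y. g y = blinfun_apply S y"
    by (metis bounded_linear_Blinfun_apply)
  have re: "inner (T x) y = inner x (S y)" for x y
    by (metis S g inner_commute)
  have "cinner (T x) y = cinner x (S y)" for x y
  proof (rule complex_eqI)
    show "Re (cinner (T x) y) = Re (cinner x (S y))"
      using re by (simp add: inner_eq_Re_cinner)
    have "Re (cinner (T (\<i> *\<^sub>C x)) y) = Re (cinner (\<i> *\<^sub>C x) (S y))"
      using re by (simp add: inner_eq_Re_cinner)
    moreover have "T (\<i> *\<^sub>C x) = \<i> *\<^sub>C T x"
      using T by (simp add: clinear_op_def)
    ultimately show "Im (cinner (T x) y) = Im (cinner x (S y))"
      by (simp add: cinner_scaleC_left)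
  qed
  then show ?thesis by blast
qed

lemma cinner_adj:
  fixes T :: "'a::chilbert \<Rightarrow>\<^sub>L 'b::chilbert"
  assumes T: "clinear_op T"
  shows "cinner (T x) y = cinner x (adj T y)"
proof -
  obtain S where S: "\<forall>x y. cinner (T x) y = cinner x (blinfun_apply S y)"
    using adj_exists[OF T] by blast
  have "\<forall>x y. cinner (T x) y = cinner x (blinfun_apply (adj T) y)"
    unfolding adj_def
  proof (rule theI[of "\<lambda>S. \<forall>x y. cinner (T x) y = cinner x (blinfun_apply S y)", OF S])
    fix S' assume S': "\<forall>x y. cinner (T x) y = cinner x (blinfun_apply S' y)"
    show "S' = S"
    proof (rule blinfun_eqI)
      fix y
      have "inner x (S' y - S y) = 0" for x
        using S S' by (simp add: cinner_diff_right inner_eq_Re_cinner)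
      then show "S' y = S y" by (metis inner_eq_zero_iff right_minus_eq)
    qed
  qed
  then show ?thesis by blast
qed

lemma inner_adj:
  assumes "clinear_op T"
  shows "inner (T x) y = inner x (adj T y)"
  using cinner_adj[OF assms] by (simp add: inner_eq_Re_cinner)

lemma cinner_eq_iff: "(\<forall>y::'a::chilbert. cinner y v = cinner y w) \<longleftrightarrow> v = w"
proof
  assume *: "\<forall>y. cinner y v = cinner y w"
  have "inner (v - w) (v - w) = 0"
    using * by (simp add: cinner_diff_right inner_eq_Re_cinner)
  then show "v = w" by simp
qed simp

lemma clinear_op_compose: "clinear_op S \<Longrightarrow> clinear_op T \<Longrightarrow> clinear_op (S o\<^sub>L T)"
  by (simp add: clinear_op_def)

lemma clinear_op_diff: "clinear_op S \<Longrightarrow> clinear_op T \<Longrightarrow> clinear_op (S - T)"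
  by (simp add: clinear_op_def blinfun.diff_left scaleC_diff_right)

section \<open>The resolvent\<close>

lemma is_resolvent_unique:
  assumes "is_resolvent D A z R" "is_resolvent D A z R'"
  shows "R = R'"
proof (rule blinfun_eqI)
  fix y
  have "R' (A (R y) - z *\<^sub>C R y) = R y" and "A (R y) - z *\<^sub>C R y = y"
    using assms unfolding is_resolvent_def by blast+
  then show "R y = R' y" by metis
qed

lemma is_resolvent_resolvent:
  assumes "z \<notin> spec UNIV (blinfun_apply Z)"
  shows "is_resolvent UNIV Z z (resolvent Z z)"
proof -
  obtain R where R: "is_resolvent UNIV Z z R" using assms by (auto simp: spec_def)
  show ?thesis unfolding resolvent_def
    by (rule theI[of "is_resolvent UNIV Z z", OF R]) (use R is_resolvent_unique in blast)
qed

lemma resolvent_right: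
  assumes "z \<notin> spec UNIV (blinfun_apply Z)"
  shows "Z (resolvent Z z y) = y + z *\<^sub>C resolvent Z z y"
  using is_resolvent_resolvent[OF assms] by (auto simp: is_resolvent_def algebra_simps)

lemma clinear_resolvent:
  assumes "z \<notin> spec UNIV (blinfun_apply Z)"
  shows "clinear_op (resolvent Z z)"
  using is_resolvent_resolvent[OF assms] by (auto simp: is_resolvent_def)

lemma resolvent_left:
  assumes z: "z \<notin> spec UNIV (blinfun_apply Z)"
  shows "resolvent Z z (Z y) = y + z *\<^sub>C resolvent Z z y"
proof -
  have "resolvent Z z (Z y - z *\<^sub>C y) = y"
    using is_resolvent_resolvent[OF z] by (auto simp: is_resolvent_def)
  moreover have "resolvent Z z (z *\<^sub>C y) = z *\<^sub>C resolvent Z z y"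
    using clinear_resolvent[OF z] by (auto simp: clinear_op_def)
  ultimately show ?thesis by (simp add: blinfun.diff_right algebra_simps)
qed

lemma resolvent_identity:
  assumes z: "z \<notin> spec UNIV (blinfun_apply Z)" and w: "w \<notin> spec UNIV (blinfun_apply Z)"
  shows "resolvent Z z - resolvent Z w = (z - w) *\<^sub>O (resolvent Z z o\<^sub>L resolvent Z w)"
proof (rule blinfun_eqI)
  fix y
  let ?u = "resolvent Z w y"
  have "resolvent Z z y = resolvent Z z (Z ?u) - resolvent Z z (w *\<^sub>C ?u)"
    using resolvent_right[OF w, of y] by (simp flip: blinfun.diff_right)
  also have "\<dots> = ?u + z *\<^sub>C resolvent Z z ?u - w *\<^sub>C resolvent Z z ?u"
    using clinear_resolvent[OF z] by (simp add: resolvent_left[OF z] clinear_op_def)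
  finally show "(resolvent Z z - resolvent Z w) y
      = ((z - w) *\<^sub>O (resolvent Z z o\<^sub>L resolvent Z w)) y"
    by (simp add: blinfun.diff_left scaleC_diff_left)
qed

text \<open>
  By the resolvent identity \<open>\<parallel>R(z)\<parallel> \<le> \<parallel>R(w)\<parallel> + \<bar>z - w\<bar> \<parallel>R(z)\<parallel> \<parallel>R(w)\<parallel>\<close>, so that \<open>\<parallel>R(z)\<parallel> \<le> 2 \<parallel>R(w)\<parallel>\<close> near
  \<open>w\<close>; inserting this into the identity once more gives local Lipschitz continuity.
\<close>

lemma norm_resolvent_diff_le:
  assumes z: "z \<notin> spec UNIV (blinfun_apply Z)" and w: "w \<notin> spec UNIV (blinfun_apply Z)"
    and close: "cmod (z - w) * norm (resolvent Z w) \<le> 1 / 2"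
  shows "norm (resolvent Z z - resolvent Z w) \<le> 2 * (norm (resolvent Z w))\<^sup>2 * cmod (z - w)"
proof -
  let ?Rz = "norm (resolvent Z z)" and ?Rw = "norm (resolvent Z w)"
  have *: "norm (resolvent Z z - resolvent Z w) \<le> cmod (z - w) * (?Rz * ?Rw)"
    unfolding resolvent_identity[OF z w]
    by (rule order_trans[OF norm_scaleC_op_le]) (intro mult_left_mono norm_blinfun_compose, simp)
  have "?Rz \<le> ?Rw + norm (resolvent Z z - resolvent Z w)"
    by (metis add.commute diff_add_cancel norm_triangle_ineq)
  also have "\<dots> \<le> ?Rw + ?Rz * (cmod (z - w) * ?Rw)" using * by (simp add: mult_ac)
  also have "\<dots> \<le> ?Rw + ?Rz * (1 / 2)" by (intro add_left_mono mult_left_mono close) simp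
  finally have "?Rz \<le> 2 * ?Rw" by simp
  then have "cmod (z - w) * (?Rz * ?Rw) \<le> cmod (z - w) * ((2 * ?Rw) * ?Rw)"
    by (intro mult_left_mono mult_right_mono) auto
  with * show ?thesis by (simp add: power2_eq_square mult_ac)
qed

lemma continuous_on_resolvent: "continuous_on (- spec UNIV (blinfun_apply Z)) (resolvent Z)"
  unfolding continuous_on_iff
proof (intro ballI allI impI)
  fix w and e :: real assume w: "w \<in> - spec UNIV (blinfun_apply Z)" and e: "e > 0"
  define N where "N = norm (resolvent Z w) + 1"
  have N: "N \<ge> 1" "norm (resolvent Z w) \<le> N" by (auto simp: N_def)
  define d where "d = min (1 / (2 * N)) (e / (4 * N\<^sup>2))"
  have d: "d > 0" using e N by (simp add: d_def)
  moreover have "dist (resolvent Z z) (resolvent Z w) < e"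
    if z: "z \<in> - spec UNIV (blinfun_apply Z)" and zw: "dist z w < d" for z
  proof -
    have "cmod (z - w) * norm (resolvent Z w) \<le> (1 / (2 * N)) * N"
      using zw N by (intro mult_mono) (auto simp: dist_norm d_def)
    then have "cmod (z - w) * norm (resolvent Z w) \<le> 1 / 2" using N by simp
    then have "norm (resolvent Z z - resolvent Z w) \<le> 2 * (norm (resolvent Z w))\<^sup>2 * cmod (z - w)"
      using z w by (intro norm_resolvent_diff_le) auto
    also have "\<dots> \<le> 2 * N\<^sup>2 * (e / (4 * N\<^sup>2))"
      using zw N by (intro mult_mono power_mono) (auto simp: dist_norm d_def)
    also have "\<dots> < e" using N e by simp
    finally show ?thesis by (simp add: dist_norm)
  qed
  ultimately show "\<exists>d>0. \<forall>z\<in>- spec UNIV (blinfun_apply Z). dist z w < d \<longrightarrow>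
      dist (resolvent Z z) (resolvent Z w) < e" by blast
qed

lemma has_derivative_resolvent:
  assumes w: "w \<notin> spec UNIV (blinfun_apply Z)"
  shows "(resolvent Z has_derivative (\<lambda>h. h *\<^sub>O (resolvent Z w o\<^sub>L resolvent Z w)))
           (at w within - spec UNIV (blinfun_apply Z))"
proof (rule has_derivativeI_sandwich[where e = 1])
  let ?R = "resolvent Z"
  show "bounded_linear (\<lambda>h. h *\<^sub>O (?R w o\<^sub>L ?R w))" by (rule bounded_linear_scaleC_op_left)
  show "norm (?R z - ?R w - (z - w) *\<^sub>O (?R w o\<^sub>L ?R w)) / norm (z - w) \<le> norm (?R z - ?R w) * norm (?R w)"
    if z: "z \<in> - spec UNIV (blinfun_apply Z)" and "z \<noteq> w" for z
  proof -
    have "?R z - ?R w - (z - w) *\<^sub>O (?R w o\<^sub>L ?R w) = (z - w) *\<^sub>O ((?R z - ?R w) o\<^sub>L ?R w)"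
      by (subst resolvent_identity) (use z w in \<open>auto intro!: blinfun_eqI
          simp: blinfun.diff_left scaleC_diff_right\<close>)
    then have "norm (?R z - ?R w - (z - w) *\<^sub>O (?R w o\<^sub>L ?R w)) \<le> norm (z - w) * norm ((?R z - ?R w) o\<^sub>L ?R w)"
      by (simp add: norm_scaleC_op_le)
    also have "\<dots> \<le> norm (z - w) * (norm (?R z - ?R w) * norm (?R w))"
      by (intro mult_left_mono norm_blinfun_compose) simp
    finally show ?thesis using \<open>z \<noteq> w\<close> by (simp add: divide_simps mult_ac)
  qed
  have "(?R \<longlongrightarrow> ?R w) (at w within - spec UNIV (blinfun_apply Z))"
    using continuous_on_resolvent w by (auto simp: continuous_on_def)
  then show "((\<lambda>z. norm (?R z - ?R w) * norm (?R w)) \<longlongrightarrow> 0) (at w within - spec UNIV (blinfun_apply Z))"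
    by (auto intro!: tendsto_eq_intros)
qed simp

text \<open>
  On a bounded part of the set compactness is enough.  Far out, \<open>z R(z) y = Z R(z) y - y\<close> gives
  \<open>(\<bar>z\<bar> - \<parallel>Z\<parallel>) \<parallel>R(z) y\<parallel> \<le> \<parallel>y\<parallel>\<close>.
\<close>

lemma bounded_resolvent:
  fixes Z :: "'a::chilbert \<Rightarrow>\<^sub>L 'a"
  assumes S: "closed S" "S \<inter> spec UNIV (blinfun_apply Z) = {}"
  obtains C where "C > 0" "\<And>z. z \<in> S \<Longrightarrow> norm (resolvent Z z) \<le> C"
proof -
  define r where "r = norm Z + 1"
  have "compact (resolvent Z ` (S \<inter> cball 0 r))"
    using S by (intro compact_continuous_image continuous_on_subset[OF continuous_on_resolvent])
      (auto intro: closed_Int_compact)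
  then obtain C where C: "\<And>z. z \<in> S \<Longrightarrow> cmod z \<le> r \<Longrightarrow> norm (resolvent Z z) \<le> C"
    unfolding bounded_iff[THEN iffD1, OF compact_imp_bounded]
    by (force dest!: compact_imp_bounded simp: bounded_iff)
  have far: "norm (resolvent Z z) \<le> 1" if "z \<in> S" "cmod z > r" for z
  proof (rule norm_blinfun_bound)
    fix y
    have z: "z \<notin> spec UNIV (blinfun_apply Z)" using that S by auto
    let ?u = "resolvent Z z y"
    have "cmod z * norm ?u = norm (Z ?u - y)"
      using resolvent_right[OF z, of y] by (simp add: norm_scaleC)
    also have "\<dots> \<le> norm Z * norm ?u + norm y"
      by (rule order_trans[OF norm_triangle_ineq4]) (simp add: norm_blinfun)
    finally have "(cmod z - norm Z) * norm ?u \<le> norm y" by (simp add: algebra_simps)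
    moreover have "1 * norm ?u \<le> (cmod z - norm Z) * norm ?u"
      using that by (intro mult_right_mono) (auto simp: r_def)
    ultimately show "norm ?u \<le> 1 * norm y" by simp
  qed simp
  show ?thesis
  proof
    show "max C 1 > 0" by simp
    show "norm (resolvent Z z) \<le> max C 1" if "z \<in> S" for z
      using C[OF that] far[OF that] by (cases "cmod z \<le> r") (auto simp: max_def)
  qed
qed

section \<open>Spectral measures\<close>

locale spectral =
  fixes E :: "real set \<Rightarrow> ('a::chilbert \<Rightarrow>\<^sub>L 'a)"
  assumes spectral: "spectral_measure E"
begin

lemma clinear: "S \<in> sets borel \<Longrightarrow> clinear_op (E S)"
  using spectral by (simp add: spectral_measure_def)

lemma idem: "S \<in> sets borel \<Longrightarrow> E S (E S x) = E S x"
proof -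
  assume "S \<in> sets borel"
  then have "E S o\<^sub>L E S = E S" using spectral by (simp add: spectral_measure_def)
  then show ?thesis by (simp flip: blinfun_apply_blinfun_compose)
qed

lemma inner_E: "S \<in> sets borel \<Longrightarrow> inner (E S x) y = inner x (E S y)"
  using spectral by (simp add: spectral_measure_def inner_eq_Re_cinner)

lemma E_UNIV [simp]: "E UNIV x = x"
  using spectral by (simp add: spectral_measure_def)

lemma E_sums:
  "range S \<subseteq> sets borel \<Longrightarrow> disjoint_family S \<Longrightarrow> (\<lambda>n::nat. E (S n) x) sums E (\<Union>n. S n) x"
  using spectral by (simp add: spectral_measure_def)

lemma E_empty [simp]: "E {} x = 0"
proof -
  have "(\<lambda>n::nat. E {} x) sums E (\<Union>n::nat. {}) x"
    by (rule E_sums) (auto simp: disjoint_family_on_def)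
  then have "(\<lambda>n::nat. E {} x) \<longlonglongrightarrow> 0"
    by (intro summable_LIMSEQ_zero) (rule sums_summable)
  then show ?thesis by (simp add: LIMSEQ_const_iff)
qed

lemma E_Un:
  assumes "S \<in> sets borel" "T \<in> sets borel" "S \<inter> T = {}"
  shows "E (S \<union> T) x = E S x + E T x"
proof -
  have "(\<lambda>n. E (binaryset S T n) x) sums E (\<Union>n. binaryset S T n) x"
    using assms by (intro E_sums) (auto simp: range_binaryset_eq disjoint_family_on_def binaryset_def)
  moreover have "(\<lambda>n. E (binaryset S T n) x) sums (E S x + E T x)"
    by (rule binaryset_sums) simp
  ultimately show ?thesis using sums_unique2 UN_binaryset_eq by metis
qed

lemma E_Compl:
  assumes "S \<in> sets borel"
  shows "E (- S) x = x - E S x"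
  using E_Un[of S "- S" x] assms by (simp add: borel_comp eq_diff_eq add.commute)

text \<open>
  The sum \<open>E S + E T\<close> is idempotent like its terms, so that \<open>E S\<close> and \<open>E T\<close> anticommute; multiplying by
  \<open>E S\<close> shows that they also commute.
\<close>

lemma E_disjoint:
  assumes S: "S \<in> sets borel" and T: "T \<in> sets borel" and "S \<inter> T = {}"
  shows "E S (E T x) = 0"
proof -
  have ST: "S \<union> T \<in> sets borel" using S T by auto
  have anti: "E S (E T y) = - E T (E S y)" for y
    using idem[OF ST, of y] idem[OF S, of y] idem[OF T, of y]
    by (simp add: E_Un[OF assms] blinfun.add_right eq_neg_iff_add_eq_0 add.commute)
  have "E S (E T x) = E S (E S (E T x))" using idem[OF S] by simp
  also have "\<dots> = - E S (E T (E S x))" by (simp only: anti[of x] blinfun.minus_right)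
  also have "\<dots> = E T (E S (E S x))" by (simp only: anti[of "E S x"] minus_minus)
  also have "\<dots> = E T (E S x)" using idem[OF S] by simp
  finally have "E S (E T x) = - E S (E T x)" using anti[of x] by simp
  then have "2 *\<^sub>R E S (E T x) = 0" unfolding scaleR_2 by (metis add.right_inverse)
  then show ?thesis by simp
qed

lemma E_E:
  assumes S: "S \<in> sets borel" and T: "T \<in> sets borel"
  shows "E S (E T x) = E (S \<inter> T) x"
proof -
  have m: "S \<inter> T \<in> sets borel" "T - S \<in> sets borel" "S - T \<in> sets borel" using S T by auto
  have 1: "E T x = E (S \<inter> T) x + E (T - S) x"
  proof -
    have "S \<inter> T \<union> (T - S) = T" "(S \<inter> T) \<inter> (T - S) = {}" by auto
    then show ?thesis using E_Un[OF m(1,2), of x] by simp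
  qed
  have 2: "E S y = E (S \<inter> T) y + E (S - T) y" for y
  proof -
    have "S \<inter> T \<union> (S - T) = S" "(S \<inter> T) \<inter> (S - T) = {}" by auto
    then show ?thesis using E_Un[OF m(1,3), of y] by simp
  qed
  have "E S (E (T - S) x) = 0" "E (S - T) (E (S \<inter> T) x) = 0"
    using S T m by (auto intro!: E_disjoint)
  then have "E S (E T x) = E S (E (S \<inter> T) x)"
    and "E S (E (S \<inter> T) x) = E (S \<inter> T) (E (S \<inter> T) x)"
    using arg_cong[OF 1, of "blinfun_apply (E S)"] 2[of "E (S \<inter> T) x"]
    by (simp_all add: blinfun.add_right)
  then show ?thesis by (simp only: idem[OF m(1)])
qed

lemma norm_E_sq: "S \<in> sets borel \<Longrightarrow> (norm (E S x))\<^sup>2 = inner x (E S x)"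
  unfolding power2_norm_eq_inner by (subst inner_E) (simp_all add: idem)

lemma norm_E_le: "S \<in> sets borel \<Longrightarrow> norm (E S x) \<le> norm x"
proof -
  assume S: "S \<in> sets borel"
  have "norm (E S x) * norm (E S x) \<le> norm x * norm (E S x)"
    using norm_E_sq[OF S, of x] norm_cauchy_schwarz[of x "E S x"] by (simp add: power2_eq_square)
  then show ?thesis by (cases "norm (E S x) = 0") auto
qed

lemma norm_E_mono:
  assumes "S \<in> sets borel" "T \<in> sets borel" "S \<subseteq> T"
  shows "norm (E S x) \<le> norm (E T x)"
  using norm_E_le[OF assms(1), of "E T x"] assms by (simp add: E_E Int_absorb2)

lemma pythagoras:
  assumes "S \<in> sets borel"
  shows "(norm x)\<^sup>2 = (norm (E S x))\<^sup>2 + (norm (x - E S x))\<^sup>2"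
  using norm_E_sq[OF assms, of x]
  by (simp add: power2_norm_eq_inner inner_diff_left inner_diff_right inner_commute)

lemma sets_distr [simp]: "sets (spectral_distr E x) = sets borel"
  and space_distr [simp]: "space (spectral_distr E x) = UNIV"
  by (simp_all add: spectral_distr_def sets_measure_of_conv space_measure_of_conv
      sigma_algebra.sigma_sets_eq[OF sets.sigma_algebra_axioms[of borel], simplified])

lemma measurable_distr [simp]: "measurable (spectral_distr E x) M = measurable borel M"
  by (rule measurable_cong_sets) simp_all

lemma emeasure_distr:
  assumes S: "S \<in> sets borel"
  shows "emeasure (spectral_distr E x) S = ennreal ((norm (E S x))\<^sup>2)"
proof (rule emeasure_measure_of[OF spectral_distr_def])
  show "countably_additive (sets (spectral_distr E x)) (\<lambda>S. ennreal ((norm (E S x))\<^sup>2))"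
    unfolding countably_additive_def
  proof (intro allI impI)
    fix T :: "nat \<Rightarrow> real set"
    assume T: "range T \<subseteq> sets (spectral_distr E x)" "disjoint_family T"
    then have T': "range T \<subseteq> sets borel" by simp
    have "(\<lambda>n. inner x (E (T n) x)) sums inner x (E (\<Union>n. T n) x)"
      by (rule bounded_linear.sums[OF bounded_linear_inner_right E_sums[OF T' T(2)]])
    moreover have "T n \<in> sets borel" "(\<Union>n. T n) \<in> sets borel" for n using T' by auto
    ultimately have "(\<lambda>n. (norm (E (T n) x))\<^sup>2) sums (norm (E (\<Union>n. T n) x))\<^sup>2"
      by (simp add: norm_E_sq)
    then show "(\<Sum>n. ennreal ((norm (E (T n) x))\<^sup>2)) = ennreal ((norm (E (\<Union>n. T n) x))\<^sup>2)"
      by (intro suminf_ennreal_eq) auto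
  qed
qed (use S in \<open>auto simp: positive_def\<close>)

lemma finite_measure_distr: "finite_measure (spectral_distr E x)"
  by (rule finite_measureI) (simp add: emeasure_distr)

lemma measure_distr: "S \<in> sets borel \<Longrightarrow> measure (spectral_distr E x) S = (norm (E S x))\<^sup>2"
  by (simp add: measure_def emeasure_distr)

lemma distr_E:
  assumes I: "I \<in> sets borel"
  shows "spectral_distr E (E I x) = density (spectral_distr E x) (indicator I)"
proof (rule measure_eqI)
  fix S assume S: "S \<in> sets (spectral_distr E (E I x))"
  then show "emeasure (spectral_distr E (E I x)) S
      = emeasure (density (spectral_distr E x) (indicator I)) S"
    using I by (simp add: emeasure_restricted emeasure_distr E_E Int_commute)
qed simp

lemma E_split:
  assumes "r \<le> s" "s \<le> t"
  shows "E {r..<t} x = E {r..<s} x + E {s..<t} x"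
  using E_Un[of "{r..<s}" "{s..<t}" x] assms by (simp add: ivl_disj_un)

lemma E_lessThan_diff:
  assumes "s \<le> t"
  shows "E {s..<t} x = E {..<t} x - E {..<s} x"
proof -
  have eq: "{..<s} \<union> {s..<t} = {..<t}" using assms by auto
  have "E ({..<s} \<union> {s..<t}) x = E {..<s} x + E {s..<t} x" by (rule E_Un) auto
  then show ?thesis unfolding eq by simp
qed

text \<open>
  The numbers \<open>\<parallel>x - E [l\<^sub>n, u\<^sub>n) x\<parallel>\<^sup>2\<close> are the masses of the complements of \<open>[l\<^sub>n, u\<^sub>n)\<close> under a finite
  measure, and these sets decrease to the complement of the open interval, of mass zero.
\<close>

lemma E_exhaust:
  fixes l u :: "nat \<Rightarrow> real"
  assumes full: "E (einterval m1 m2) x = x"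
    and l: "(\<lambda>n. ereal (l n)) \<longlonglongrightarrow> m1" and u: "(\<lambda>n. ereal (u n)) \<longlonglongrightarrow> m2" and mono: "decseq l" "incseq u"
    and bnd: "\<And>i. m1 < ereal (l i)" "\<And>i. ereal (u i) < m2"
  shows "(\<lambda>n. E {l n..<u n} x) \<longlonglongrightarrow> x"
proof -
  interpret finite_measure "spectral_distr E x" by (rule finite_measure_distr)
  have "(\<Inter>n. - {l n..<u n}) = - einterval m1 m2"
  proof (intro set_eqI iffI)
    fix z assume z: "z \<in> (\<Inter>n. - {l n..<u n})"
    have "z \<notin> einterval m1 m2"
    proof
      assume "z \<in> einterval m1 m2"
      then have zz: "m1 < ereal z" "ereal z < m2" by (auto simp: einterval_def)
      have "\<forall>\<^sub>F n in sequentially. ereal (l n) < ereal z \<and> ereal z < ereal (u n)"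
        using order_tendstoD(2)[OF l zz(1)] order_tendstoD(1)[OF u zz(2)] by eventually_elim simp
      then obtain n where "l n < z" "z < u n" 
        by (auto simp: eventually_sequentially)
      with z show False by force
    qed
    then show "z \<in> - einterval m1 m2" by simp
  next
    fix z assume "z \<in> - einterval m1 m2"
    then have "\<not> (m1 < ereal z \<and> ereal z < m2)" by (auto simp: einterval_def)
    moreover have "m1 < ereal z \<and> ereal z < m2" if "l n \<le> z" "z < u n" for n
      using that bnd(1)[of n] bnd(2)[of n]
        order.strict_trans2[of m1 "ereal (l n)" "ereal z"] order.strict_trans[of "ereal z" "ereal (u n)" m2]
      by simp
    ultimately show "z \<in> (\<Inter>n. - {l n..<u n})" by auto
  qed
  moreover have "(\<lambda>n. measure (spectral_distr E x) (- {l n..<u n}))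
      \<longlonglongrightarrow> measure (spectral_distr E x) (\<Inter>n. - {l n..<u n})"
  proof (rule finite_Lim_measure_decseq)
    show "range (\<lambda>n. - {l n..<u n}) \<subseteq> sets (spectral_distr E x)" by auto
    show "decseq (\<lambda>n. - {l n..<u n})"
      using mono by (force simp: decseq_def incseq_def intro: order_trans order.strict_trans2)
  qed
  ultimately have "(\<lambda>n. (norm (x - E {l n..<u n} x))\<^sup>2) \<longlonglongrightarrow> 0"
    by (simp add: measure_distr borel_comp E_Compl full)
  then have "(\<lambda>n. sqrt ((norm (x - E {l n..<u n} x))\<^sup>2)) \<longlonglongrightarrow> sqrt 0" by (rule tendsto_real_sqrt)
  then have "(\<lambda>n. norm (x - E {l n..<u n} x)) \<longlonglongrightarrow> 0" by simp
  then have "(\<lambda>n. x - E {l n..<u n} x) \<longlonglongrightarrow> 0" by (rule tendsto_norm_zero_cancel)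
  from tendsto_diff[OF tendsto_const[of x] this] show ?thesis by simp
qed

end

section \<open>Self-adjoint operators and their spectral measures\<close>

locale spectral_operator =
  fixes D :: "'a::chilbert set" and A :: "'a \<Rightarrow> 'a" and E :: "real set \<Rightarrow> ('a \<Rightarrow>\<^sub>L 'a)"
  assumes selfadj: "selfadjoint D A" and spectral_of: "spectral_measure_of D A E"
begin

sublocale spectral E
  using spectral_of by unfold_locales (simp add: spectral_measure_of_def)

lemma D_add: "x \<in> D \<Longrightarrow> y \<in> D \<Longrightarrow> x + y \<in> D"
  and A_add: "x \<in> D \<Longrightarrow> y \<in> D \<Longrightarrow> A (x + y) = A x + A y"
  and D_scaleC: "x \<in> D \<Longrightarrow> c *\<^sub>C x \<in> D"
  and A_scaleC: "x \<in> D \<Longrightarrow> A (c *\<^sub>C x) = c *\<^sub>C A x"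
  and dense: "closure D = UNIV"
  and cinner_A: "x \<in> D \<Longrightarrow> y \<in> D \<Longrightarrow> cinner y (A x) = cinner (A y) x"
  and D_maximal: "{y. \<exists>w. \<forall>x\<in>D. cinner y (A x) = cinner w x} = D"
  using selfadj by (auto simp: selfadjoint_def)

lemma D_scaleR: "x \<in> D \<Longrightarrow> r *\<^sub>R x \<in> D" and A_scaleR: "x \<in> D \<Longrightarrow> A (r *\<^sub>R x) = r *\<^sub>R A x"
  using D_scaleC[of x "complex_of_real r"] A_scaleC[of x "complex_of_real r"]
  by (simp_all add: scaleC_of_real)

lemma D_diff: "x \<in> D \<Longrightarrow> y \<in> D \<Longrightarrow> x - y \<in> D"
  using D_add[of x "(- 1) *\<^sub>R y"] D_scaleR[of y "- 1"] by simp

lemma A_diff: "x \<in> D \<Longrightarrow> y \<in> D \<Longrightarrow> A (x - y) = A x - A y"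
  using A_add[of x "(- 1) *\<^sub>R y"] D_scaleR[of y "- 1"] A_scaleR[of y "- 1"] by simp

lemma inner_A: "x \<in> D \<Longrightarrow> y \<in> D \<Longrightarrow> inner y (A x) = inner (A y) x"
  by (simp add: inner_eq_Re_cinner cinner_A)

lemma inner_dense_eqI:
  assumes "\<And>y. y \<in> D \<Longrightarrow> inner y v = inner y w"
  shows "v = w"
proof -
  have "closed {y. inner y (v - w) = 0}"
    by (intro closed_Collect_eq continuous_intros)
  moreover have "D \<subseteq> {y. inner y (v - w) = 0}" using assms by (auto simp: inner_diff_right)
  ultimately have "closure D \<subseteq> {y. inner y (v - w) = 0}" by (rule closure_minimal[rotated])
  then have "inner (v - w) (v - w) = 0" using dense by blast
  then show ?thesis by simp
qed

lemma A_closed: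
  assumes "\<And>n. u n \<in> D" and u: "u \<longlonglongrightarrow> y" and Au: "(\<lambda>n. A (u n)) \<longlonglongrightarrow> w"
  shows "y \<in> D" "A y = w"
proof -
  have lim: "cinner y (A x) = cinner w x" if x: "x \<in> D" for x
  proof -
    have "(\<lambda>n. cinner (A x) (u n)) \<longlonglongrightarrow> cinner (A x) y"
      by (rule bounded_linear.tendsto[OF bounded_linear_cinner_right u])
    moreover have "(\<lambda>n. cinner x (A (u n))) \<longlonglongrightarrow> cinner x w"
      by (rule bounded_linear.tendsto[OF bounded_linear_cinner_right Au])
    moreover have "cinner (A x) (u n) = cinner x (A (u n))" for n
      using cinner_A[OF assms(1) x] by simp
    ultimately have "cinner (A x) y = cinner x w" using LIMSEQ_unique by simp
    then show ?thesis by (metis cinner_commute)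
  qed
  then show y: "y \<in> D" using D_maximal by blast
  show "A y = w"
  proof (rule inner_dense_eqI)
    fix x assume "x \<in> D"
    then have "cinner x (A y) = cinner x w"
      using lim cinner_A[of y x] y by (metis cinner_commute)
    then show "inner x (A y) = inner x w" by (simp add: inner_eq_Re_cinner)
  qed
qed

lemma D_iff: "x \<in> D \<longleftrightarrow> (\<integral>\<^sup>+t. ennreal (t\<^sup>2) \<partial>spectral_distr E x) < \<infinity>"
  using spectral_of by (simp add: spectral_measure_of_def set_eq_iff)

lemma inner_A_eq: "x \<in> D \<Longrightarrow> inner x (A x) = (\<integral>t. t \<partial>spectral_distr E x)"
  using spectral_of by (auto simp: spectral_measure_of_def inner_eq_Re_cinner)

lemma integrable_distr:
  assumes "x \<in> D"
  shows "integrable (spectral_distr E x) (\<lambda>t. t)"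
proof -
  interpret finite_measure "spectral_distr E x" by (rule finite_measure_distr)
  have "integrable (spectral_distr E x) (\<lambda>t. t\<^sup>2)"
    using assms by (intro integrableI_nonneg) (auto simp: D_iff)
  then have "integrable (spectral_distr E x) (\<lambda>t. 1 + t\<^sup>2)" by simp
  then show ?thesis
  proof (rule Bochner_Integration.integrable_bound)
    have "\<bar>t\<bar> \<le> 1 + t\<^sup>2" for t :: real
    proof -
      have "0 \<le> (\<bar>t\<bar> - 1)\<^sup>2" by simp
      then show ?thesis by (simp add: power2_diff)
    qed
    then show "AE t in spectral_distr E x. norm t \<le> norm (1 + t\<^sup>2)"
      by (intro always_eventually allI) (simp add: add_nonneg_nonneg order_trans[OF _ abs_ge_self])
  qed simp
qed

lemma E_in_D:
  assumes "x \<in> D" "I \<in> sets borel"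
  shows "E I x \<in> D"
proof -
  have "(\<integral>\<^sup>+t. ennreal (t\<^sup>2) \<partial>spectral_distr E (E I x))
      = (\<integral>\<^sup>+t. indicator I t * ennreal (t\<^sup>2) \<partial>spectral_distr E x)"
    using assms by (simp add: distr_E nn_integral_density)
  also have "\<dots> \<le> (\<integral>\<^sup>+t. ennreal (t\<^sup>2) \<partial>spectral_distr E x)"
    by (intro nn_integral_mono) (auto split: split_indicator)
  finally show ?thesis using assms D_iff by (metis order.strict_trans1)
qed

lemma integral_distr_E:
  assumes "I \<in> sets borel"
  shows "(\<integral>t. t \<partial>spectral_distr E (E I x)) = (\<integral>t. indicator I t * t \<partial>spectral_distr E x)"
proof -
  have "spectral_distr E (E I x) = density (spectral_distr E x) (\<lambda>t. ennreal (indicator I t))"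
    using assms by (simp add: distr_E ennreal_indicator)
  then show ?thesis using assms by (simp add: integral_density)
qed

lemma form_split:
  assumes x: "x \<in> D" and I: "I \<in> sets borel"
  shows "inner x (A x) = inner (E I x) (A (E I x)) + inner (x - E I x) (A (x - E I x))"
proof -
  have mI: "- I \<in> sets borel" using I by (rule borel_comp)
  have int: "integrable (spectral_distr E x) (\<lambda>t. indicator J t * t)" if "J \<in> sets borel" for J
    using integrable_mult_indicator[OF _ integrable_distr[OF x], of J] that by simp
  have "inner x (A x) = (\<integral>t. indicator I t * t + indicator (- I) t * t \<partial>spectral_distr E x)"
    unfolding inner_A_eq[OF x] by (intro Bochner_Integration.integral_cong) (auto split: split_indicator)
  also have "\<dots> = inner (E I x) (A (E I x)) + inner (E (- I) x) (A (E (- I) x))"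
    using int[OF I] int[OF mI] by (simp add: inner_A_eq E_in_D x I mI integral_distr_E)
  finally show ?thesis by (simp add: E_Compl I)
qed

text \<open>
  The operator is reduced by the ranges of its spectral measure.  Only the quadratic form is given
  as an integral; as it splits along every Borel set, polarisation makes the off-diagonal part vanish.
\<close>

lemma A_off_diagonal:
  assumes x: "x \<in> D" and y: "y \<in> D" and I: "I \<in> sets borel"
  shows "inner (y - E I y) (A (E I x)) = 0"
proof -
  let ?x = "E I x" and ?y = "y - E I y"
  have D: "?x \<in> D" "?y \<in> D" using x y I by (auto intro: E_in_D D_diff)
  have "E I (?x + ?y) = ?x" using I by (simp add: blinfun.add_right blinfun.diff_right idem)
  then have "inner (?x + ?y) (A (?x + ?y)) = inner ?x (A ?x) + inner ?y (A ?y)"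
    using form_split[OF D_add[OF D] I] by simp
  then have "inner ?x (A ?y) + inner ?y (A ?x) = 0"
    by (simp add: A_add[OF D] inner_add_left inner_add_right)
  moreover have "inner ?x (A ?y) = inner ?y (A ?x)"
    using inner_A[OF D(2,1)] by (simp add: inner_commute)
  ultimately show ?thesis by simp
qed

lemma A_E:
  assumes x: "x \<in> D" and I: "I \<in> sets borel"
  shows "A (E I x) = E I (A x)"
proof (rule inner_dense_eqI)
  fix y assume y: "y \<in> D"
  have Ex: "E I x \<in> D" and Ey: "E I y \<in> D" using x y I by (auto intro: E_in_D)
  have "inner (x - E I x) (A (E I y)) = 0" by (rule A_off_diagonal[OF y x I])
  then have "inner (E I y) (A (x - E I x)) = 0"
    using inner_A[OF D_diff[OF x Ex] Ey] by (simp add: inner_commute)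
  then have "inner (E I y) (A x) = inner (E I y) (A (E I x))"
    by (simp add: A_diff[OF x Ex] inner_diff_right)
  moreover have "inner y (A (E I x)) = inner (E I y) (A (E I x))"
    using A_off_diagonal[OF x y I] by (simp add: inner_diff_left)
  ultimately show "inner y (A (E I x)) = inner y (E I (A x))"
    by (simp add: inner_E[OF I])
qed

lemma bounded_in_D: "E {s..<t} x \<in> D"
proof -
  have "(\<integral>\<^sup>+r. ennreal (r\<^sup>2) \<partial>spectral_distr E (E {s..<t} x))
      = (\<integral>\<^sup>+r. indicator {s..<t} r * ennreal (r\<^sup>2) \<partial>spectral_distr E x)"
    by (simp add: distr_E nn_integral_density)
  also have "\<dots> \<le> (\<integral>\<^sup>+r. ennreal (s\<^sup>2 + t\<^sup>2) \<partial>spectral_distr E x)"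
  proof (intro nn_integral_mono)
    fix r
    have "r\<^sup>2 \<le> s\<^sup>2 + t\<^sup>2" if "s \<le> r" "r < t"
    proof (cases "r \<ge> 0")
      case True
      then have "r\<^sup>2 \<le> t\<^sup>2" using that by (intro power_mono) auto
      then show ?thesis by (simp add: add_increasing)
    next
      case False
      then have "(- r)\<^sup>2 \<le> (- s)\<^sup>2" using that by (intro power_mono) auto
      then show ?thesis by (simp add: add_increasing2)
    qed
    then show "indicator {s..<t} r * ennreal (r\<^sup>2) \<le> ennreal (s\<^sup>2 + t\<^sup>2)"
      by (auto split: split_indicator intro!: ennreal_leI simp del: ennreal_plus)
  qed
  also have "\<dots> < \<infinity>" by (simp add: emeasure_distr ennreal_mult_less_top)
  finally show ?thesis by (simp add: D_iff)
qed

lemma form_bounds: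
  assumes w: "E {s..<t} w = w"
  shows "s * (norm w)\<^sup>2 \<le> inner w (A w)" "inner w (A w) \<le> t * (norm w)\<^sup>2"
proof -
  interpret finite_measure "spectral_distr E w" by (rule finite_measure_distr)
  have D: "w \<in> D" using bounded_in_D[of s t w] w by simp
  have eq: "inner w (A w) = (\<integral>r. indicator {s..<t} r * r \<partial>spectral_distr E w)"
    using inner_A_eq[OF D] integral_distr_E[of "{s..<t}" w] w by simp
  have m: "measure (spectral_distr E w) {s..<t} = (norm w)\<^sup>2" by (simp add: measure_distr w)
  have ints: "integrable (spectral_distr E w) (\<lambda>r. indicator {s..<t} r * c)" for c :: real
    by (intro integrable_mult_left integrable_real_indicator) (auto simp: emeasure_distr)
  have intr: "integrable (spectral_distr E w) (\<lambda>r. indicator {s..<t} r * r)"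
    using integrable_mult_indicator[OF _ integrable_distr[OF D], of "{s..<t}"] by simp
  have "(\<integral>r. indicator {s..<t} r * s \<partial>spectral_distr E w) \<le> inner w (A w)"
    unfolding eq by (intro integral_mono ints intr) (auto split: split_indicator)
  then show "s * (norm w)\<^sup>2 \<le> inner w (A w)" by (simp add: m mult.commute)
  have "inner w (A w) \<le> (\<integral>r. indicator {s..<t} r * t \<partial>spectral_distr E w)"
    unfolding eq by (intro integral_mono ints intr) (auto split: split_indicator)
  then show "inner w (A w) \<le> t * (norm w)\<^sup>2" by (simp add: m mult.commute)
qed

text \<open>
  The quadratic form of \<open>A - c\<close> is bounded by \<open>r\<close> on the range of \<open>E [s, t)\<close>, which \<open>A\<close> leaves invariant;
  polarisation turns this into a bound for the operator.
\<close>

lemma A_near_scalar: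
  assumes w: "E {s..<t} w = w" and c: "c - r \<le> s" "t \<le> c + r" and r: "r \<ge> 0"
  shows "norm (A w - c *\<^sub>R w) \<le> r * norm w"
proof -
  let ?P = "E {s..<t}"
  have D: "x \<in> D" if "?P x = x" for x using bounded_in_D[of s t x] that by simp
  define b where "b x y = inner x (A y - c *\<^sub>R y)" for x y
  have form: "\<bar>b x x\<bar> \<le> r * (norm x)\<^sup>2" if x: "?P x = x" for x
  proof -
    have "(c - r) * (norm x)\<^sup>2 \<le> s * (norm x)\<^sup>2" "t * (norm x)\<^sup>2 \<le> (c + r) * (norm x)\<^sup>2"
      using c by (auto intro: mult_right_mono)
    with form_bounds[OF x] show ?thesis
      by (simp add: b_def inner_diff_right abs_le_iff algebra_simps power2_norm_eq_inner)
  qed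
  have unit: "b y x \<le> r" if x: "?P x = x" "norm x = 1" and y: "?P y = y" "norm y = 1" for x y
  proof -
    have xy: "?P (x + y) = x + y" "?P (x - y) = x - y"
      using x y by (simp_all add: blinfun.add_right blinfun.diff_right)
    have "4 * b y x = b (x + y) (x + y) - b (x - y) (x - y)"
      using inner_A[OF D[OF x(1)] D[OF y(1)]]
      by (simp add: b_def A_add A_diff D x y inner_simps inner_commute algebra_simps)
    also have "\<dots> \<le> r * ((norm (x + y))\<^sup>2 + (norm (x - y))\<^sup>2)"
      using form[OF xy(1)] form[OF xy(2)] by (simp add: algebra_simps)
    also have "(norm (x + y))\<^sup>2 + (norm (x - y))\<^sup>2 = 2 * (norm x)\<^sup>2 + 2 * (norm y)\<^sup>2"
      by (simp add: power2_norm_eq_inner inner_simps inner_commute)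
    finally show ?thesis using x y by simp
  qed
  have gen: "b y w \<le> r * norm w * norm y" if y: "?P y = y" for y
  proof (cases "w = 0 \<or> y = 0")
    case True
    then show ?thesis using A_scaleR[OF D[OF w], of 0] by (auto simp: b_def)
  next
    case False
    let ?w = "(1 / norm w) *\<^sub>R w" and ?y = "(1 / norm y) *\<^sub>R y"
    have "b ?y ?w \<le> r"
      using False w y by (intro unit) (auto simp: blinfun.scaleR_right)
    then show ?thesis
      using False by (simp add: b_def A_scaleR[OF D[OF w]] field_simps
          flip: scaleR_diff_right) (simp add: scaleR_left_commute[of c] inner_simps field_simps)
  qed
  let ?v = "A w - c *\<^sub>R w"
  have "?P ?v = ?v"
    using A_E[OF D[OF w], of "{s..<t}"] w by (simp add: blinfun.diff_right blinfun.scaleR_right)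
  from gen[OF this] have "norm ?v * norm ?v \<le> (r * norm w) * norm ?v"
    by (simp add: b_def power2_eq_square flip: power2_norm_eq_inner)
  then show ?thesis using r by (cases "norm ?v = 0") auto
qed

text \<open>
  If \<open>R\<close> is the resolvent at \<open>p\<close>, then \<open>\<parallel>w\<parallel> = \<parallel>R (A - p) w\<parallel> \<le> \<parallel>R\<parallel> \<epsilon> \<parallel>w\<parallel>\<close> on the range of
  \<open>E [p - \<epsilon>, p + \<epsilon>)\<close>, which is therefore trivial as soon as \<open>\<parallel>R\<parallel> \<epsilon> < 1\<close>.
\<close>

lemma E_null_near_resolvent_point:
  assumes "complex_of_real p \<notin> spec D A"
  shows "\<exists>\<epsilon>>0. \<forall>x. E {p - \<epsilon>..<p + \<epsilon>} x = 0"
proof -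
  obtain R where R: "is_resolvent D A (complex_of_real p) R"
    using assms by (auto simp: spec_def)
  define \<epsilon> where "\<epsilon> = 1 / (norm R + 1)"
  have \<epsilon>: "\<epsilon> > 0" "norm R * \<epsilon> < 1" 
    by (auto simp: \<epsilon>_def add_nonneg_pos)
  have "E {p - \<epsilon>..<p + \<epsilon>} x = 0" for x
  proof -
    define w where "w = E {p - \<epsilon>..<p + \<epsilon>} x"
    have "w \<in> D" unfolding w_def by (rule bounded_in_D)
    then have "w = R (A w - p *\<^sub>R w)" using R by (simp add: is_resolvent_def scaleC_of_real)
    then have "norm w \<le> norm R * norm (A w - p *\<^sub>R w)" by (metis norm_blinfun)
    also have "\<dots> \<le> norm R * (\<epsilon> * norm w)"
      by (intro mult_left_mono A_near_scalar) (use \<epsilon> in \<open>auto simp: w_def idem\<close>)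
    finally have "(1 - norm R * \<epsilon>) * norm w \<le> 0" by (simp add: algebra_simps)
    then show ?thesis using \<epsilon> unfolding w_def[symmetric] by (simp add: mult_le_0_iff)
  qed
  then show ?thesis using \<epsilon> by blast
qed

lemma E_null_off_spectrum:
  assumes U: "open U" "complex_of_real ` U \<inter> spec D A = {}"
  shows "E U x = 0"
proof -
  have "\<forall>p\<in>U. \<exists>\<epsilon>>0. \<forall>x. E {p - \<epsilon>..<p + \<epsilon>} x = 0"
    using U E_null_near_resolvent_point by blast
  then obtain \<epsilon> where \<epsilon>: "\<And>p. p \<in> U \<Longrightarrow> \<epsilon> p > 0" "\<And>p x. p \<in> U \<Longrightarrow> E {p - \<epsilon> p..<p + \<epsilon> p} x = 0"
    by metis
  define F where "F = (\<lambda>p. {p - \<epsilon> p<..<p + \<epsilon> p}) ` U"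
  have "open T" if "T \<in> F" for T using that by (auto simp: F_def)
  then obtain F' where F': "F' \<subseteq> F" "countable F'" "\<Union>F' = \<Union>F"
    using Lindelof[of F] by metis
  have null: "T \<in> null_sets (spectral_distr E x)" if T: "T \<in> F'" for T
  proof -
    obtain p where p: "p \<in> U" "T = {p - \<epsilon> p<..<p + \<epsilon> p}" using T F'(1) unfolding F_def by blast
    have "norm (E T x) \<le> norm (E {p - \<epsilon> p..<p + \<epsilon> p} x)" using p by (intro norm_E_mono) auto
    then show ?thesis using p \<epsilon>(2) by (auto simp: null_sets_def emeasure_distr)
  qed
  have "(\<Union>T\<in>F'. T) \<in> null_sets (spectral_distr E x)"
    by (rule null_sets_UN'[OF F'(2) null])
  then have N: "\<Union>F' \<in> null_sets (spectral_distr E x)" by simp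
  have "U \<subseteq> \<Union>F'"
  proof
    fix p assume p: "p \<in> U"
    then have "p \<in> {p - \<epsilon> p<..<p + \<epsilon> p}" using \<epsilon>(1)[OF p] by simp
    then show "p \<in> \<Union>F'" unfolding F'(3) F_def using p by blast
  qed
  moreover have "U \<in> sets (spectral_distr E x)" using U(1) by simp
  ultimately have "U \<in> null_sets (spectral_distr E x)"
    using null_sets_subset[OF N] by blast
  then show ?thesis using U(1) by (simp add: null_sets_def emeasure_distr)
qed

text \<open>Absolute continuity removes the end points, since the boundary of a convex set is a null set.\<close>

lemma E_full_interval:
  assumes ac: "abs_cont_spectrum E" and sp: "spec D A = complex_of_real ` closure (einterval m1 m2)"
  shows "E (einterval m1 m2) x = x"
proof -
  let ?I = "einterval m1 m2"
  have conv: "convex ?I"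
    unfolding is_interval_convex_1[symmetric] is_interval_1
  proof (intro ballI allI impI)
    fix p q r assume "p \<in> ?I" "q \<in> ?I" "p \<le> r \<and> r \<le> q"
    then show "r \<in> ?I"
      using less_le_trans[of m1 "ereal p" "ereal r"] le_less_trans[of "ereal r" "ereal q" m2]
      by (simp add: einterval_def)
  qed
  have "frontier ?I \<in> null_sets lborel"
    using negligible_convex_frontier[OF conv]
    by (simp add: negligible_iff_null_sets null_sets_completion_iff)
  then have "frontier ?I \<in> null_sets (spectral_distr E x)"
    using ac by (auto simp: abs_cont_spectrum_def absolutely_continuous_def)
  then have fr: "E (frontier ?I) x = 0" by (simp add: null_sets_def emeasure_distr)
  have "E (- closure ?I) x = 0" by (rule E_null_off_spectrum) (auto simp: sp)
  then have "E (closure ?I) x = x" by (simp add: E_Compl)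
  moreover have "closure ?I = ?I \<union> frontier ?I" "?I \<inter> frontier ?I = {}"
    using closure_Un_frontier[of ?I] frontier_disjoint_eq[of ?I] by (simp_all add: open_einterval Int_commute)
  ultimately show ?thesis using E_Un[of ?I "frontier ?I" x] fr by simp
qed

end

section \<open>The operator Stieltjes integral over compact intervals\<close>

lemma clinear_op_integral:
  assumes f: "f integrable_on S" and lin: "\<And>t. t \<in> S \<Longrightarrow> clinear_op (f t)"
  shows "clinear_op (integral S f)"
  unfolding clinear_op_def
proof (intro allI)
  fix c x
  have app: "((\<lambda>t. f t y) has_integral (integral S f) y) S" for y
    using has_integral_linear[OF integrable_integral[OF f] bounded_linear_apply_blinfun[of y]]
    by (simp add: o_def)
  have "((\<lambda>t. c *\<^sub>C f t x) has_integral c *\<^sub>C (integral S f) x) S"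
    using has_integral_linear[OF app[of x] bounded_linear_scaleC[of c]] by (simp add: o_def)
  moreover have "c *\<^sub>C f t x = f t (c *\<^sub>C x)" if "t \<in> S" for t
    using lin[OF that] by (simp add: clinear_op_def)
  ultimately have "((\<lambda>t. f t (c *\<^sub>C x)) has_integral c *\<^sub>C (integral S f) x) S"
    by (rule has_integral_eq[rotated]) 
  then show "(integral S f) (c *\<^sub>C x) = c *\<^sub>C (integral S f) x"
    using app has_integral_unique by blast
qed

text \<open>
  Here \<open>k\<close> is the derivative of \<open>K\<close>; the resolvent enters only as a function with \<open>R' = R\<^sup>2\<close>.
\<close>

locale stieltjes = spectral E for E :: "real set \<Rightarrow> ('a::chilbert \<Rightarrow>\<^sub>L 'a)" +
  fixes B :: "'b::chilbert \<Rightarrow>\<^sub>L 'a" and I :: "real set"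
    and k R :: "real \<Rightarrow> ('b \<Rightarrow>\<^sub>L 'b)"
  assumes clinear_B: "clinear_op B"
    and interval: "\<And>s t. s \<in> I \<Longrightarrow> t \<in> I \<Longrightarrow> {s..t} \<subseteq> I"
    and K_deriv: "\<And>\<mu>. \<mu> \<in> I \<Longrightarrow> (K_B E B has_vector_derivative k \<mu>) (at \<mu>)"
    and k_cont: "continuous_on I k"
    and R_deriv: "\<And>\<mu>. \<mu> \<in> I \<Longrightarrow> (R has_vector_derivative (R \<mu> o\<^sub>L R \<mu>)) (at \<mu>)"
    and R_clinear: "\<And>\<mu>. \<mu> \<in> I \<Longrightarrow> clinear_op (R \<mu>)"
begin

abbreviation P :: "real \<Rightarrow> real \<Rightarrow> ('a \<Rightarrow>\<^sub>L 'a)" where "P s t \<equiv> E {s..<t}"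

text \<open>
  \<open>J s t\<close> is \<open>\<integral> E(d\<mu>) B R(\<mu>)\<close> over \<open>[s, t)\<close>, integrated by parts (\<open>R' = R\<^sup>2\<close>): the integrand that
  remains is continuous in operator norm, because \<open>\<mu> \<mapsto> E [s, \<mu>) B\<close> is Hoelder continuous.
\<close>

definition J :: "real \<Rightarrow> real \<Rightarrow> ('b \<Rightarrow>\<^sub>L 'a)" where
  "J s t = (P s t o\<^sub>L B o\<^sub>L R t) - integral {s..t} (\<lambda>\<mu>. P s \<mu> o\<^sub>L B o\<^sub>L (R \<mu> o\<^sub>L R \<mu>))"

lemma R_cont: "continuous_on I R"
  using R_deriv by (intro continuous_at_imp_continuous_on ballI)
    (rule has_vector_derivative_continuous)

lemma K_diff: "s \<le> t \<Longrightarrow> K_B E B t - K_B E B s = adj B o\<^sub>L P s t o\<^sub>L B"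
  by (rule blinfun_eqI) (simp add: K_B_def blinfun.diff_left blinfun.diff_right E_lessThan_diff)

lemma inner_PB:
  "inner (P s t (B x)) (P s t (B y)) = inner x (adj B (P s t (B y)))"
  by (simp add: inner_E idem inner_adj[OF clinear_B])

text \<open>Since \<open>\<parallel>E [s, t) B x\<parallel>\<^sup>2 = \<langle>x, (K t - K s) x\<rangle>\<close>, differentiability of \<open>K\<close> gives exponent \<open>1/2\<close>.\<close>

lemma PB_bound:
  assumes "\<alpha> \<in> I" "\<beta> \<in> I"
  obtains M where "M \<ge> 0"
    "\<And>s t. \<alpha> \<le> s \<Longrightarrow> s \<le> t \<Longrightarrow> t \<le> \<beta> \<Longrightarrow> norm (P s t o\<^sub>L B) \<le> M * sqrt (t - s)"
proof -
  have sub: "{\<alpha>..\<beta>} \<subseteq> I" using interval assms by blast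
  have "compact (k ` {\<alpha>..\<beta>})"
    by (intro compact_continuous_image continuous_on_subset[OF k_cont sub]) simp
  then obtain M where M: "M > 0" "\<And>\<mu>. \<mu> \<in> {\<alpha>..\<beta>} \<Longrightarrow> norm (k \<mu>) \<le> M"
    using compact_imp_bounded bounded_pos by (metis imageI)
  have "norm (P s t o\<^sub>L B) \<le> sqrt M * sqrt (t - s)" if st: "\<alpha> \<le> s" "s \<le> t" "t \<le> \<beta>" for s t
  proof (rule norm_blinfun_bound)
    fix x
    have "norm (K_B E B t - K_B E B s) \<le> M * norm (t - s)"
    proof (rule differentiable_bound[where S = "{s..t}"])
      show "(K_B E B has_derivative (\<lambda>h. h *\<^sub>R k \<mu>)) (at \<mu> within {s..t})" if "\<mu> \<in> {s..t}" for \<mu>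
        using K_deriv[OF subsetD[OF sub], of \<mu>] st that
        by (auto simp: has_vector_derivative_def intro: has_derivative_at_withinI)
      show "onorm (\<lambda>h. h *\<^sub>R k \<mu>) \<le> M" if "\<mu> \<in> {s..t}" for \<mu>
        using M(2)[of \<mu>] st that by (intro onorm_le) (auto simp: mult.commute[of M] intro: mult_left_mono)
    qed (use st in auto)
    then have Kd: "norm (adj B o\<^sub>L P s t o\<^sub>L B) \<le> M * (t - s)"
      using st K_diff by simp
    have "(norm (P s t (B x)))\<^sup>2 = inner x ((adj B o\<^sub>L P s t o\<^sub>L B) x)"
      by (simp add: power2_norm_eq_inner inner_PB)
    also have "\<dots> \<le> norm x * norm ((adj B o\<^sub>L P s t o\<^sub>L B) x)" by (rule norm_cauchy_schwarz)
    also have "\<dots> \<le> norm x * (norm (adj B o\<^sub>L P s t o\<^sub>L B) * norm x)"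
      by (intro mult_left_mono norm_blinfun) simp
    also have "\<dots> \<le> norm x * ((M * (t - s)) * norm x)"
      by (intro mult_left_mono mult_right_mono Kd) auto
    also have "\<dots> = (sqrt M * sqrt (t - s) * norm x)\<^sup>2"
      using st M(1) by (simp add: power_mult_distrib power2_eq_square[of "norm x"])
    finally show "norm ((P s t o\<^sub>L B) x) \<le> sqrt M * sqrt (t - s) * norm x"
      using st M(1) by (auto intro: power2_le_imp_le)
  qed (use st M(1) in auto)
  then show ?thesis using that[of "sqrt M"] M(1) by simp
qed

lemma R_bound:
  assumes "\<alpha> \<in> I" "\<beta> \<in> I"
  obtains L where "L \<ge> 0" "\<And>\<mu>. \<mu> \<in> {\<alpha>..\<beta>} \<Longrightarrow> norm (R \<mu>) \<le> L"
    "\<And>\<mu>. \<mu> \<in> {\<alpha>..\<beta>} \<Longrightarrow> norm (R \<mu> o\<^sub>L R \<mu>) \<le> L\<^sup>2"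
    "\<And>\<mu> \<nu>. \<mu> \<in> {\<alpha>..\<beta>} \<Longrightarrow> \<nu> \<in> {\<alpha>..\<beta>} \<Longrightarrow> norm (R \<mu> - R \<nu>) \<le> L\<^sup>2 * \<bar>\<mu> - \<nu>\<bar>"
proof -
  have sub: "{\<alpha>..\<beta>} \<subseteq> I" using interval assms by blast
  have "compact (R ` {\<alpha>..\<beta>})"
    by (intro compact_continuous_image continuous_on_subset[OF R_cont sub]) simp
  then obtain L where L: "L > 0" "\<And>\<mu>. \<mu> \<in> {\<alpha>..\<beta>} \<Longrightarrow> norm (R \<mu>) \<le> L"
    using compact_imp_bounded bounded_pos by (metis imageI)
  have RR: "norm (R \<mu> o\<^sub>L R \<mu>) \<le> L\<^sup>2" if "\<mu> \<in> {\<alpha>..\<beta>}" for \<mu>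
    unfolding power2_eq_square
    by (rule order_trans[OF norm_blinfun_compose mult_mono]) (use L that in auto)
  have lip: "norm (R \<mu> - R \<nu>) \<le> L\<^sup>2 * \<bar>\<mu> - \<nu>\<bar>" if \<mu>\<nu>: "\<mu> \<in> {\<alpha>..\<beta>}" "\<nu> \<in> {\<alpha>..\<beta>}" for \<mu> \<nu>
  proof -
    have "norm (R \<mu> - R \<nu>) \<le> L\<^sup>2 * norm (\<mu> - \<nu>)"
    proof (rule differentiable_bound[where S = "{\<alpha>..\<beta>}"])
      show "(R has_derivative (\<lambda>h. h *\<^sub>R (R x o\<^sub>L R x))) (at x within {\<alpha>..\<beta>})"
        if "x \<in> {\<alpha>..\<beta>}" for x
        using R_deriv[OF subsetD[OF sub that]]
        by (auto simp: has_vector_derivative_def intro: has_derivative_at_withinI)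
      show "onorm (\<lambda>h. h *\<^sub>R (R x o\<^sub>L R x)) \<le> L\<^sup>2" if "x \<in> {\<alpha>..\<beta>}" for x
        using RR[OF that] by (intro onorm_le) (auto simp: mult.commute[of "L\<^sup>2"] intro: mult_left_mono)
    qed (use \<mu>\<nu> in auto)
    then show ?thesis by simp
  qed
  show ?thesis using that[of L] L RR lip by auto
qed

lemma PB_cont:
  assumes "\<alpha> \<in> I" "\<beta> \<in> I"
  shows "continuous_on {\<alpha>..\<beta>} (\<lambda>\<mu>. P \<alpha> \<mu> o\<^sub>L B)"
proof -
  obtain M where M: "M \<ge> 0"
    "\<And>s t. \<alpha> \<le> s \<Longrightarrow> s \<le> t \<Longrightarrow> t \<le> \<beta> \<Longrightarrow> norm (P s t o\<^sub>L B) \<le> M * sqrt (t - s)"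
    using PB_bound[OF assms] by blast
  have diff: "dist (P \<alpha> \<nu> o\<^sub>L B) (P \<alpha> \<mu> o\<^sub>L B) \<le> M * sqrt \<bar>\<nu> - \<mu>\<bar>"
    if "\<mu> \<in> {\<alpha>..\<beta>}" "\<nu> \<in> {\<alpha>..\<beta>}" for \<mu> \<nu>
  proof -
    have le: "dist (P \<alpha> t o\<^sub>L B) (P \<alpha> s o\<^sub>L B) \<le> M * sqrt \<bar>t - s\<bar>"
      if "\<alpha> \<le> s" "s \<le> t" "t \<le> \<beta>" for s t
    proof -
      have "(P \<alpha> t o\<^sub>L B) - (P \<alpha> s o\<^sub>L B) = P s t o\<^sub>L B"
        by (rule blinfun_eqI) (use that in \<open>simp add: blinfun.diff_left E_split[of \<alpha> s t]\<close>)
      then show ?thesis using M(2)[OF that] that by (simp add: dist_norm)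
    qed
    show ?thesis
    proof (cases "\<mu> \<le> \<nu>")
      case True
      then show ?thesis using le[of \<mu> \<nu>] that by simp
    next
      case False
      then show ?thesis using le[of \<nu> \<mu>] that by (simp add: dist_commute abs_minus_commute)
    qed
  qed
  show ?thesis
    unfolding continuous_on_def
  proof
    fix \<mu> assume \<mu>: "\<mu> \<in> {\<alpha>..\<beta>}"
    have "((\<lambda>\<nu>. M * sqrt \<bar>\<nu> - \<mu>\<bar>) \<longlongrightarrow> M * sqrt \<bar>\<mu> - \<mu>\<bar>) (at \<mu> within {\<alpha>..\<beta>})"
      by (intro tendsto_intros)
    then have lim: "((\<lambda>\<nu>. M * sqrt \<bar>\<nu> - \<mu>\<bar>) \<longlongrightarrow> 0) (at \<mu> within {\<alpha>..\<beta>})" by simp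
    have "\<forall>\<^sub>F \<nu> in at \<mu> within {\<alpha>..\<beta>}. norm (dist (P \<alpha> \<nu> o\<^sub>L B) (P \<alpha> \<mu> o\<^sub>L B)) \<le> M * sqrt \<bar>\<nu> - \<mu>\<bar>"
      unfolding eventually_at_filter by (rule always_eventually) (use diff[OF \<mu>] in simp)
    from Lim_null_comparison[OF this lim]
    have "((\<lambda>\<nu>. dist (P \<alpha> \<nu> o\<^sub>L B) (P \<alpha> \<mu> o\<^sub>L B)) \<longlongrightarrow> 0) (at \<mu> within {\<alpha>..\<beta>})" .
    then show "((\<lambda>\<nu>. P \<alpha> \<nu> o\<^sub>L B) \<longlongrightarrow> P \<alpha> \<mu> o\<^sub>L B) (at \<mu> within {\<alpha>..\<beta>})"
      by (rule tendsto_dist_iff[THEN iffD2])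
  qed
qed

lemma integrand_cont:
  assumes "\<alpha> \<in> I" "\<beta> \<in> I"
  shows "continuous_on {\<alpha>..\<beta>} (\<lambda>\<mu>. P \<alpha> \<mu> o\<^sub>L B o\<^sub>L (R \<mu> o\<^sub>L R \<mu>))"
  using interval[OF assms]
  by (intro bounded_bilinear.continuous_on[OF bounded_bilinear_blinfun_compose] PB_cont[OF assms]
      continuous_on_subset[OF R_cont])

lemma integrand_integrable:
  assumes "\<alpha> \<in> I" "\<beta> \<in> I"
  shows "(\<lambda>\<mu>. P \<alpha> \<mu> o\<^sub>L B o\<^sub>L (R \<mu> o\<^sub>L R \<mu>)) integrable_on {\<alpha>..\<beta>}"
  by (rule integrable_continuous_real[OF integrand_cont[OF assms]])

lemma clinear_J:
  assumes "s \<in> I" "t \<in> I"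
  shows "clinear_op (J s t)"
  unfolding J_def
  by (intro clinear_op_diff clinear_op_compose clinear_op_integral integrand_integrable assms
      clinear clinear_B R_clinear) (use interval[OF assms] in auto)

lemma R_increment:
  assumes "s \<in> I" "t \<in> I" "s \<le> t"
  shows "((\<lambda>\<mu>. R \<mu> o\<^sub>L R \<mu>) has_integral R t - R s) {s..t}"
  by (rule fundamental_theorem_of_calculus[OF assms(3)])
    (rule has_vector_derivative_at_within[OF R_deriv[OF subsetD[OF interval[OF assms(1,2)]]]])

lemma P_J:
  assumes I: "\<alpha> \<in> I" "\<beta> \<in> I" and st: "\<alpha> \<le> s" "s \<le> t" "t \<le> \<beta>"
  shows "P s t o\<^sub>L J \<alpha> \<beta> = J s t"
proof -
  have sI: "s \<in> I" and tI: "t \<in> I" using interval[OF I] st by auto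
  let ?f = "\<lambda>\<mu>. P s t o\<^sub>L (P \<alpha> \<mu> o\<^sub>L B o\<^sub>L (R \<mu> o\<^sub>L R \<mu>))"
  have PP: "P s t (P \<alpha> \<mu> x) = (if \<mu> \<le> s then 0 else if \<mu> \<le> t then P s \<mu> x else P s t x)" for \<mu> x
  proof -
    have "{s..<t} \<inter> {\<alpha>..<\<mu>} = (if \<mu> \<le> s then {} else if \<mu> \<le> t then {s..<\<mu>} else {s..<t})"
      using st by auto
    then show ?thesis by (simp add: E_E)
  qed
  have 1: "(?f has_integral 0) {\<alpha>..s}"
    by (rule has_integral_is_0) (auto intro!: blinfun_eqI simp: PP)
  have 2: "(?f has_integral integral {s..t} (\<lambda>\<mu>. P s \<mu> o\<^sub>L B o\<^sub>L (R \<mu> o\<^sub>L R \<mu>))) {s..t}"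
    by (rule has_integral_eq[OF _ integrable_integral[OF integrand_integrable[OF sI tI]]])
      (auto intro!: blinfun_eqI simp: PP)
  have "((\<lambda>\<mu>. (P s t o\<^sub>L B) o\<^sub>L (R \<mu> o\<^sub>L R \<mu>)) has_integral (P s t o\<^sub>L B) o\<^sub>L (R \<beta> - R t)) {t..\<beta>}"
    using has_integral_linear[OF R_increment[OF tI I(2) st(3)]
        bounded_bilinear.bounded_linear_right[OF bounded_bilinear_blinfun_compose], of "P s t o\<^sub>L B"] by (simp add: o_def)
  then have 3: "(?f has_integral (P s t o\<^sub>L B) o\<^sub>L (R \<beta> - R t)) {t..\<beta>}"
    by (rule has_integral_eq[rotated]) (use st in \<open>auto intro!: blinfun_eqI simp: PP\<close>)
  have "\<alpha> \<le> t" using st by simp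
  from has_integral_combine[OF this st(3) has_integral_combine[OF st(1,2) 1 2] 3]
  have whole: "(?f has_integral 0 + integral {s..t} (\<lambda>\<mu>. P s \<mu> o\<^sub>L B o\<^sub>L (R \<mu> o\<^sub>L R \<mu>))
      + ((P s t o\<^sub>L B) o\<^sub>L (R \<beta> - R t))) {\<alpha>..\<beta>}"
    .
  have "(?f has_integral P s t o\<^sub>L integral {\<alpha>..\<beta>} (\<lambda>\<mu>. P \<alpha> \<mu> o\<^sub>L B o\<^sub>L (R \<mu> o\<^sub>L R \<mu>))) {\<alpha>..\<beta>}"
    using has_integral_linear[OF integrable_integral[OF integrand_integrable[OF I]]
        bounded_bilinear.bounded_linear_right[OF bounded_bilinear_blinfun_compose], of "P s t"] by (simp add: o_def)
  from has_integral_unique[OF this whole] have "P s t o\<^sub>L integral {\<alpha>..\<beta>} (\<lambda>\<mu>. P \<alpha> \<mu> o\<^sub>L B o\<^sub>L (R \<mu> o\<^sub>L R \<mu>))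
      = integral {s..t} (\<lambda>\<mu>. P s \<mu> o\<^sub>L B o\<^sub>L (R \<mu> o\<^sub>L R \<mu>)) + ((P s t o\<^sub>L B) o\<^sub>L (R \<beta> - R t))"
    by simp
  from arg_cong[OF this, of "\<lambda>T. blinfun_apply T _"] show ?thesis
    by (intro blinfun_eqI)
      (use st in \<open>simp add: J_def blinfun.diff_left blinfun.diff_right blinfun.add_left PP\<close>)
qed

lemma P_J_apply:
  "\<alpha> \<in> I \<Longrightarrow> \<beta> \<in> I \<Longrightarrow> \<alpha> \<le> s \<Longrightarrow> s \<le> t \<Longrightarrow> t \<le> \<beta> \<Longrightarrow> P s t (J \<alpha> \<beta> x) = J s t x"
  by (metis P_J blinfun_apply_blinfun_compose)

text \<open>
  On a short interval \<open>J\<close> is \<open>E [s, t) B R(\<zeta>)\<close> up to an error of order \<open>3/2 > 1\<close> in the length.  Errors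
  of this size may be summed over a partition with the triangle inequality alone.
\<close>

lemma J_local:
  assumes "\<alpha> \<in> I" "\<beta> \<in> I"
  obtains C where "C \<ge> 0"
    "\<And>s t \<zeta>. \<alpha> \<le> s \<Longrightarrow> s \<le> \<zeta> \<Longrightarrow> \<zeta> \<le> t \<Longrightarrow> t \<le> \<beta> \<Longrightarrow>
       norm (J s t - (P s t o\<^sub>L B o\<^sub>L R \<zeta>)) \<le> C * ((t - s) * sqrt (t - s))"
proof -
  have sub: "{\<alpha>..\<beta>} \<subseteq> I" using interval assms by blast
  obtain M where M: "M \<ge> 0"
    "\<And>s t. \<alpha> \<le> s \<Longrightarrow> s \<le> t \<Longrightarrow> t \<le> \<beta> \<Longrightarrow> norm (P s t o\<^sub>L B) \<le> M * sqrt (t - s)"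
    using PB_bound[OF assms] by blast
  obtain L where L: "L \<ge> 0" "\<And>\<mu>. \<mu> \<in> {\<alpha>..\<beta>} \<Longrightarrow> norm (R \<mu> o\<^sub>L R \<mu>) \<le> L\<^sup>2"
    "\<And>\<mu> \<nu>. \<mu> \<in> {\<alpha>..\<beta>} \<Longrightarrow> \<nu> \<in> {\<alpha>..\<beta>} \<Longrightarrow> norm (R \<mu> - R \<nu>) \<le> L\<^sup>2 * \<bar>\<mu> - \<nu>\<bar>"
    using R_bound[OF assms] by metis
  have "norm (J s t - (P s t o\<^sub>L B o\<^sub>L R \<zeta>)) \<le> (2 * (M * L\<^sup>2)) * ((t - s) * sqrt (t - s))"
    if st: "\<alpha> \<le> s" "s \<le> \<zeta>" "\<zeta> \<le> t" "t \<le> \<beta>" for s t \<zeta>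
  proof -
    have sI: "s \<in> I" "t \<in> I" using sub st by auto
    let ?i = "integral {s..t} (\<lambda>\<mu>. P s \<mu> o\<^sub>L B o\<^sub>L (R \<mu> o\<^sub>L R \<mu>))"
    have eq: "J s t - (P s t o\<^sub>L B o\<^sub>L R \<zeta>) = ((P s t o\<^sub>L B) o\<^sub>L (R t - R \<zeta>)) - ?i"
      by (rule blinfun_eqI) (simp add: J_def blinfun.diff_left blinfun.diff_right)
    have "norm ((P s t o\<^sub>L B) o\<^sub>L (R t - R \<zeta>)) \<le> (M * sqrt (t - s)) * (L\<^sup>2 * (t - s))"
    proof (rule order_trans[OF norm_blinfun_compose mult_mono])
      have "norm (R t - R \<zeta>) \<le> L\<^sup>2 * \<bar>t - \<zeta>\<bar>" using st by (intro L(3)) auto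
      also have "\<dots> \<le> L\<^sup>2 * (t - s)" using st by (intro mult_left_mono) auto
      finally show "norm (R t - R \<zeta>) \<le> L\<^sup>2 * (t - s)" .
    qed (use M st in auto)
    moreover have "norm ?i \<le> ((M * sqrt (t - s)) * L\<^sup>2) * (t - s)"
    proof (rule integral_bound[OF _ integrand_cont[OF sI]])
      fix \<mu> assume \<mu>: "\<mu> \<in> {s..t}"
      have "norm (P s \<mu> o\<^sub>L B) \<le> M * sqrt (\<mu> - s)" using M(2)[of s \<mu>] \<mu> st by simp
      also have "\<dots> \<le> M * sqrt (t - s)" using M(1) \<mu> by (intro mult_left_mono) auto
      finally show "norm (P s \<mu> o\<^sub>L B o\<^sub>L (R \<mu> o\<^sub>L R \<mu>)) \<le> (M * sqrt (t - s)) * L\<^sup>2"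
        using M(1) st \<mu> L(2)[of \<mu>] by (rule_tac order_trans[OF norm_blinfun_compose mult_mono]) auto
    qed (use st in auto)
    ultimately show ?thesis
      unfolding eq by (intro order_trans[OF norm_triangle_ineq4]) (simp add: algebra_simps)
  qed
  then show ?thesis using that[of "2 * (M * L\<^sup>2)"] M(1) by simp
qed

lemma J_bound:
  assumes "\<alpha> \<in> I" "\<beta> \<in> I"
  obtains C where "C \<ge> 0"
    "\<And>s t. \<alpha> \<le> s \<Longrightarrow> s \<le> t \<Longrightarrow> t \<le> \<beta> \<Longrightarrow> norm (J s t) \<le> C * sqrt (t - s)"
proof -
  obtain C where C: "C \<ge> 0"
    "\<And>s t \<zeta>. \<alpha> \<le> s \<Longrightarrow> s \<le> \<zeta> \<Longrightarrow> \<zeta> \<le> t \<Longrightarrow> t \<le> \<beta> \<Longrightarrow>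
       norm (J s t - (P s t o\<^sub>L B o\<^sub>L R \<zeta>)) \<le> C * ((t - s) * sqrt (t - s))"
    using J_local[OF assms] by blast
  obtain M where M: "M \<ge> 0"
    "\<And>s t. \<alpha> \<le> s \<Longrightarrow> s \<le> t \<Longrightarrow> t \<le> \<beta> \<Longrightarrow> norm (P s t o\<^sub>L B) \<le> M * sqrt (t - s)"
    using PB_bound[OF assms] by blast
  obtain L where L: "L \<ge> 0" "\<And>\<mu>. \<mu> \<in> {\<alpha>..\<beta>} \<Longrightarrow> norm (R \<mu>) \<le> L"
    using R_bound[OF assms] by metis
  define C' where "C' = C * \<bar>\<beta> - \<alpha>\<bar> + M * L"
  have "norm (J s t) \<le> C' * sqrt (t - s)" if st: "\<alpha> \<le> s" "s \<le> t" "t \<le> \<beta>" for s t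
  proof -
    have "norm (J s t) \<le> norm (J s t - (P s t o\<^sub>L B o\<^sub>L R s)) + norm (P s t o\<^sub>L B o\<^sub>L R s)"
      by (metis add.commute diff_add_cancel norm_triangle_ineq)
    moreover have "norm (J s t - (P s t o\<^sub>L B o\<^sub>L R s)) \<le> C * (\<bar>\<beta> - \<alpha>\<bar> * sqrt (t - s))"
      using C(1) st by (intro order_trans[OF C(2)] mult_left_mono mult_right_mono) auto
    moreover have "norm (P s t o\<^sub>L B o\<^sub>L R s) \<le> (M * sqrt (t - s)) * L"
      using M st L(2)[of s] by (rule_tac order_trans[OF norm_blinfun_compose mult_mono]) auto
    ultimately show ?thesis by (simp add: C'_def algebra_simps)
  qed
  then show ?thesis using that[of C'] C(1) M(1) L(1) by (simp add: C'_def)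
qed

lemma has_stieltjes_J:
  assumes I: "\<alpha> \<in> I" "\<beta> \<in> I" and le: "\<alpha> \<le> \<beta>"
  shows "has_stieltjes E (\<lambda>\<mu>. B (R \<mu> x)) \<alpha> \<beta> (J \<alpha> \<beta> x)"
  unfolding has_stieltjes_def
proof (intro allI impI)
  fix e :: real assume e: "e > 0"
  obtain C where C: "C \<ge> 0"
    "\<And>s t \<zeta>. \<alpha> \<le> s \<Longrightarrow> s \<le> \<zeta> \<Longrightarrow> \<zeta> \<le> t \<Longrightarrow> t \<le> \<beta> \<Longrightarrow>
       norm (J s t - (P s t o\<^sub>L B o\<^sub>L R \<zeta>)) \<le> C * ((t - s) * sqrt (t - s))"
    using J_local[OF I] by blast
  define C' where "C' = C * norm x * (\<beta> - \<alpha>) + 1"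
  have C': "C' > 0" using C(1) le by (simp add: C'_def add_nonneg_pos)
  define \<delta> where "\<delta> = (e / C')\<^sup>2 / 2"
  have \<delta>: "\<delta> > 0" using e C' by (simp add: \<delta>_def)
  show "\<exists>\<delta>>0. \<forall>p. p tagged_division_of {\<alpha>..\<beta>} \<and> (\<lambda>x. ball x \<delta>) fine p \<longrightarrow>
        norm ((\<Sum>(\<zeta>, c)\<in>p. E {Inf c..<Sup c} (B (R \<zeta> x))) - J \<alpha> \<beta> x) < e"
  proof (intro exI[of _ \<delta>] conjI \<delta> allI impI)
    fix p assume p: "p tagged_division_of {\<alpha>..\<beta>} \<and> (\<lambda>x. ball x \<delta>) fine p"
    then have tag: "p tagged_division_of {\<alpha>..\<beta>}" by simp
    have split: "(\<Sum>(\<zeta>, c)\<in>p. P (Inf c) (Sup c) v) = P \<alpha> \<beta> v" for v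
    proof -
      have "(\<Sum>(\<zeta>, c)\<in>p. E {..<Sup c} v - E {..<Inf c} v) = E {..<\<beta>} v - E {..<\<alpha>} v"
        by (rule additive_tagged_division_1[OF le tag])
      moreover have "(\<Sum>(\<zeta>, c)\<in>p. P (Inf c) (Sup c) v)
          = (\<Sum>(\<zeta>, c)\<in>p. E {..<Sup c} v - E {..<Inf c} v)"
      proof (rule sum.cong[OF refl], clarify)
        fix \<zeta> c assume "(\<zeta>, c) \<in> p"
        then obtain s t where "c = cbox s t" "c \<noteq> {}" using tagged_division_ofD[OF tag] by blast
        then show "P (Inf c) (Sup c) v = E {..<Sup c} v - E {..<Inf c} v"
          by (intro E_lessThan_diff) auto
      qed
      ultimately show ?thesis using E_lessThan_diff[OF le] by simp
    qed
    let ?v = "J \<alpha> \<beta> x"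
    have "P \<alpha> \<beta> ?v = ?v" using P_J_apply[OF I] le by simp
    then have "(\<Sum>(\<zeta>, c)\<in>p. P (Inf c) (Sup c) (B (R \<zeta> x))) - ?v
        = (\<Sum>(\<zeta>, c)\<in>p. P (Inf c) (Sup c) (B (R \<zeta> x)) - P (Inf c) (Sup c) ?v)"
      using split[of ?v] by (simp add: sum_subtractf case_prod_unfold)
    also have "norm \<dots> \<le> (\<Sum>(\<zeta>, c)\<in>p. C * norm x * (e / C') * (Sup c - Inf c))"
    proof (rule sum_norm_le, clarify)
      fix \<zeta> c assume pc: "(\<zeta>, c) \<in> p"
      obtain s t where st: "c = cbox s t" "\<zeta> \<in> c" "c \<subseteq> {\<alpha>..\<beta>}"
        using tagged_division_ofD(2,3,4)[OF tag pc] by blast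
      then have st': "s \<le> \<zeta>" "\<zeta> \<le> t" "\<alpha> \<le> s" "t \<le> \<beta>" by auto
      then have IS: "Inf c = s" "Sup c = t" using st by auto
      have "c \<subseteq> ball \<zeta> \<delta>" using p pc by (auto simp: fine_def)
      moreover have "s \<in> c" "t \<in> c" using st(1) st' by auto
      ultimately have "s \<in> ball \<zeta> \<delta>" "t \<in> ball \<zeta> \<delta>" by blast+
      then have "t - s \<le> (e / C')\<^sup>2" unfolding mem_ball dist_real_def \<delta>_def abs_less_iff by linarith
      then have sq: "sqrt (t - s) \<le> e / C'" using e C' by (intro real_le_lsqrt) auto
      have "norm (P s t (B (R \<zeta> x)) - P s t ?v) = norm ((J s t - (P s t o\<^sub>L B o\<^sub>L R \<zeta>)) x)"
        using P_J_apply[OF I, of s t x] st' by (simp add: blinfun.diff_left norm_minus_commute)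
      also have "\<dots> \<le> (C * ((t - s) * sqrt (t - s))) * norm x"
        using C(2)[of s \<zeta> t] st' by (intro order_trans[OF norm_blinfun] mult_right_mono) auto
      also have "\<dots> \<le> (C * ((t - s) * (e / C'))) * norm x"
        using C(1) st' by (intro mult_right_mono mult_left_mono sq) auto
      finally show "norm (P (Inf c) (Sup c) (B (R \<zeta> x)) - P (Inf c) (Sup c) ?v)
          \<le> C * norm x * (e / C') * (Sup c - Inf c)"
        unfolding IS by (simp add: algebra_simps)
    qed
    also have "\<dots> = C * norm x * (e / C') * (\<beta> - \<alpha>)"
      using additive_tagged_division_1[OF le tag, of "\<lambda>t. t"]
      by (simp only: case_prod_unfold sum_distrib_left[symmetric])
    also have "\<dots> = (C' - 1) / C' * e" by (simp add: C'_def)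
    also have "\<dots> < e" using C' e by (simp add: field_simps)
    finally show "norm ((\<Sum>(\<zeta>, c)\<in>p. E {Inf c..<Sup c} (B (R \<zeta> x))) - J \<alpha> \<beta> x) < e" .
  qed
qed

text \<open>Undoing the integration by parts after applying \<open>B\<^sup>*\<close>, where \<open>B\<^sup>* E [s, \<mu>) B = K \<mu> - K s\<close>.\<close>

lemma adj_J:
  assumes I: "s \<in> I" "t \<in> I" and le: "s \<le> t"
  shows "((\<lambda>\<mu>. k \<mu> o\<^sub>L R \<mu>) has_integral adj B o\<^sub>L J s t) {s..t}"
proof -
  let ?K = "K_B E B"
  have sub: "{s..t} \<subseteq> I" by (rule interval[OF I])
  have total: "((\<lambda>\<mu>. ((?K \<mu> - ?K s) o\<^sub>L (R \<mu> o\<^sub>L R \<mu>)) + (k \<mu> o\<^sub>L R \<mu>)) has_integral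
      ((?K t - ?K s) o\<^sub>L R t) - ((?K s - ?K s) o\<^sub>L R s)) {s..t}"
  proof (rule fundamental_theorem_of_calculus[OF le])
    fix \<mu> assume "\<mu> \<in> {s..t}"
    then have \<mu>: "\<mu> \<in> I" using sub by auto
    have "((\<lambda>\<mu>. ?K \<mu> - ?K s) has_vector_derivative k \<mu>) (at \<mu>)"
      using has_vector_derivative_diff[OF K_deriv[OF \<mu>] has_vector_derivative_const] by simp
    from bounded_bilinear.has_vector_derivative[OF bounded_bilinear_blinfun_compose this R_deriv[OF \<mu>]]
    show "((\<lambda>\<mu>. (?K \<mu> - ?K s) o\<^sub>L R \<mu>) has_vector_derivative
        ((?K \<mu> - ?K s) o\<^sub>L (R \<mu> o\<^sub>L R \<mu>)) + (k \<mu> o\<^sub>L R \<mu>)) (at \<mu> within {s..t})"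
      by (rule has_vector_derivative_at_within)
  qed
  have part: "((\<lambda>\<mu>. (?K \<mu> - ?K s) o\<^sub>L (R \<mu> o\<^sub>L R \<mu>)) has_integral
      adj B o\<^sub>L integral {s..t} (\<lambda>\<mu>. P s \<mu> o\<^sub>L B o\<^sub>L (R \<mu> o\<^sub>L R \<mu>))) {s..t}"
  proof (rule has_integral_eq)
    show "((\<lambda>\<mu>. adj B o\<^sub>L (P s \<mu> o\<^sub>L B o\<^sub>L (R \<mu> o\<^sub>L R \<mu>))) has_integral
      adj B o\<^sub>L integral {s..t} (\<lambda>\<mu>. P s \<mu> o\<^sub>L B o\<^sub>L (R \<mu> o\<^sub>L R \<mu>))) {s..t}"
      using has_integral_linear[OF integrable_integral[OF integrand_integrable[OF I]]
          bounded_bilinear.bounded_linear_right[OF bounded_bilinear_blinfun_compose], of "adj B"] by (simp add: o_def)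
  qed (simp add: K_diff, intro blinfun_eqI, simp)
  from has_integral_diff[OF total part] have "((\<lambda>\<mu>. k \<mu> o\<^sub>L R \<mu>) has_integral ((?K t - ?K s) o\<^sub>L R t) - ((?K s - ?K s) o\<^sub>L R s)
      - (adj B o\<^sub>L integral {s..t} (\<lambda>\<mu>. P s \<mu> o\<^sub>L B o\<^sub>L (R \<mu> o\<^sub>L R \<mu>)))) {s..t}"
    by simp
  moreover have "((?K t - ?K s) o\<^sub>L R t) - ((?K s - ?K s) o\<^sub>L R s)
      - (adj B o\<^sub>L integral {s..t} (\<lambda>\<mu>. P s \<mu> o\<^sub>L B o\<^sub>L (R \<mu> o\<^sub>L R \<mu>))) = adj B o\<^sub>L J s t"
    unfolding K_diff[OF le]
    by (rule blinfun_eqI) (simp add: J_def blinfun.diff_left blinfun.diff_right)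
  ultimately show ?thesis by simp
qed

text \<open>
  Insert the definition of \<open>J\<close> into the second factor of \<open>\<langle>J x, J x\<rangle>\<close>.  Because \<open>E [s, \<mu>) J s t = J s \<mu>\<close>, the
  integrand becomes \<open>\<langle>W \<mu>, R(\<mu>)\<^sup>2 x\<rangle>\<close> with \<open>W \<mu> = B\<^sup>* J s \<mu> x\<close>, whose derivative \<open>k R x\<close> is known from the
  preceding lemma, and integration by parts applies once more.
\<close>

lemma norm_J_sq:
  assumes I: "s \<in> I" "t \<in> I" and le: "s \<le> t"
  shows "((\<lambda>\<mu>. inner (k \<mu> (R \<mu> x)) (R \<mu> x)) has_integral (norm (J s t x))\<^sup>2) {s..t}"
proof -
  have sub: "{s..t} \<subseteq> I" by (rule interval[OF I])
  define W where "W \<mu> = adj B (J s \<mu> x)" for \<mu>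
  have kR: "continuous_on {s..t} (\<lambda>\<mu>. k \<mu> o\<^sub>L R \<mu>)"
    by (intro bounded_bilinear.continuous_on[OF bounded_bilinear_blinfun_compose]
        continuous_on_subset[OF k_cont sub] continuous_on_subset[OF R_cont sub])
  have kRx: "continuous_on {s..t} (\<lambda>\<mu>. k \<mu> (R \<mu> x))"
    using bounded_linear.continuous_on[OF bounded_linear_apply_blinfun[of x] kR] by simp
  have W: "W \<mu> = integral {s..\<mu>} (\<lambda>\<nu>. k \<nu> (R \<nu> x))" if "\<mu> \<in> {s..t}" for \<mu>
  proof -
    have "((\<lambda>\<nu>. k \<nu> o\<^sub>L R \<nu>) has_integral adj B o\<^sub>L J s \<mu>) {s..\<mu>}"
      using adj_J[OF I(1), of \<mu>] sub that by auto
    from has_integral_linear[OF this bounded_linear_apply_blinfun[of x]] show ?thesis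
      by (simp add: W_def o_def integral_unique)
  qed
  have total: "((\<lambda>\<mu>. inner (W \<mu>) ((R \<mu> o\<^sub>L R \<mu>) x) + inner (k \<mu> (R \<mu> x)) (R \<mu> x)) has_integral
      inner (W t) (R t x) - inner (W s) (R s x)) {s..t}"
  proof (rule fundamental_theorem_of_calculus[OF le])
    fix \<mu> assume \<mu>: "\<mu> \<in> {s..t}"
    have "((\<lambda>\<mu>. integral {s..\<mu>} (\<lambda>\<nu>. k \<nu> (R \<nu> x))) has_vector_derivative k \<mu> (R \<mu> x))
        (at \<mu> within {s..t})"
      by (rule integral_has_vector_derivative[OF kRx \<mu>])
    then have dW: "(W has_vector_derivative k \<mu> (R \<mu> x)) (at \<mu> within {s..t})"
      by (rule has_vector_derivative_transform[OF \<mu> _, rotated]) (use W in auto)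
    have "((\<lambda>\<mu>. R \<mu> x) has_vector_derivative (R \<mu> o\<^sub>L R \<mu>) x) (at \<mu> within {s..t})"
      using bounded_linear.has_vector_derivative[OF bounded_linear_apply_blinfun[of x]
          has_vector_derivative_at_within[OF R_deriv[of \<mu>]]] sub \<mu> by auto
    from bounded_bilinear.has_vector_derivative[OF bounded_bilinear_inner dW this]
    show "((\<lambda>\<mu>. inner (W \<mu>) (R \<mu> x)) has_vector_derivative
        inner (W \<mu>) ((R \<mu> o\<^sub>L R \<mu>) x) + inner (k \<mu> (R \<mu> x)) (R \<mu> x)) (at \<mu> within {s..t})" .
  qed
  have W0: "W s = 0" using W[of s] le by simp
  have part: "((\<lambda>\<mu>. inner (W \<mu>) ((R \<mu> o\<^sub>L R \<mu>) x)) has_integral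
      inner (J s t x) (integral {s..t} (\<lambda>\<mu>. P s \<mu> o\<^sub>L B o\<^sub>L (R \<mu> o\<^sub>L R \<mu>)) x)) {s..t}"
  proof (rule has_integral_eq)
    show "((\<lambda>\<mu>. inner (J s t x) ((P s \<mu> o\<^sub>L B o\<^sub>L (R \<mu> o\<^sub>L R \<mu>)) x)) has_integral
        inner (J s t x) (integral {s..t} (\<lambda>\<mu>. P s \<mu> o\<^sub>L B o\<^sub>L (R \<mu> o\<^sub>L R \<mu>)) x)) {s..t}"
      using has_integral_linear[OF integrable_integral[OF integrand_integrable[OF I]]
          bounded_linear_compose[OF bounded_linear_inner_right[of "J s t x"]
          bounded_linear_apply_blinfun[of x]]] by (simp add: o_def)
  next
    fix \<mu> assume \<mu>: "\<mu> \<in> {s..t}"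
    have "inner (J s t x) (P s \<mu> (B v)) = inner (W \<mu>) v" for v
    proof -
      have "inner (J s t x) (P s \<mu> (B v)) = inner (J s \<mu> x) (B v)"
        using P_J_apply[OF I, of s \<mu> x] \<mu> by (simp flip: inner_E)
      then show ?thesis using inner_adj[OF clinear_B, of v "J s \<mu> x"] by (simp add: W_def inner_commute)
    qed
    then show "inner (J s t x) ((P s \<mu> o\<^sub>L B o\<^sub>L (R \<mu> o\<^sub>L R \<mu>)) x) = inner (W \<mu>) ((R \<mu> o\<^sub>L R \<mu>) x)"
      by simp
  qed
  from has_integral_diff[OF total part] have "((\<lambda>\<mu>. inner (k \<mu> (R \<mu> x)) (R \<mu> x)) has_integral
      inner (W t) (R t x) - inner (J s t x) (integral {s..t} (\<lambda>\<mu>. P s \<mu> o\<^sub>L B o\<^sub>L (R \<mu> o\<^sub>L R \<mu>)) x)) {s..t}"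
    by (simp add: W0)
  moreover have "inner (W t) (R t x) = inner (J s t x) (P s t (B (R t x)))"
  proof -
    have "inner (J s t x) (P s t (B (R t x))) = inner (J s t x) (B (R t x))"
      using P_J_apply[OF I, of s t x] le by (simp flip: inner_E)
    then show ?thesis
      using inner_adj[OF clinear_B, of "R t x" "J s t x"] by (simp add: W_def inner_commute)
  qed
  moreover have "(norm (J s t x))\<^sup>2 = inner (J s t x) (P s t (B (R t x)))
      - inner (J s t x) (integral {s..t} (\<lambda>\<mu>. P s \<mu> o\<^sub>L B o\<^sub>L (R \<mu> o\<^sub>L R \<mu>)) x)"
  proof -
    have "J s t x = P s t (B (R t x)) - integral {s..t} (\<lambda>\<mu>. P s \<mu> o\<^sub>L B o\<^sub>L (R \<mu> o\<^sub>L R \<mu>)) x"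
      by (simp add: J_def blinfun.diff_left)
    from arg_cong[OF this, of "inner (J s t x)"] show ?thesis
      unfolding power2_norm_eq_inner inner_diff_right .
  qed
  ultimately show ?thesis by simp
qed

end

section \<open>The improper integral and the Riccati equation\<close>

lemma einterval_subinterval:
  assumes "s \<in> einterval a b" "t \<in> einterval a b"
  shows "{s..t} \<subseteq> einterval a b"
proof
  fix u assume "u \<in> {s..t}"
  then have "ereal s \<le> ereal u" "ereal u \<le> ereal t" by auto
  then show "u \<in> einterval a b"
    using assms less_le_trans[of a "ereal s" "ereal u"] le_less_trans[of "ereal u" "ereal t" b]
    by (simp add: einterval_def)
qed

lemma eventually_at_lower: "m < ereal c \<Longrightarrow> \<forall>\<^sub>F x in at_lower m. m < ereal x \<and> x < c"
proof (cases m)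
  case (real r)
  assume "m < ereal c"
  then have "\<forall>\<^sub>F x in at_right r. x \<in> {r<..<c}" by (intro eventually_at_right_real) (simp add: real)
  then show ?thesis by (simp add: at_lower_def real)
qed (auto simp: at_lower_def eventually_at_bot_dense)

lemma eventually_at_upper: "ereal c < m \<Longrightarrow> \<forall>\<^sub>F x in at_upper m. c < x \<and> ereal x < m"
proof (cases m)
  case (real r)
  assume "ereal c < m"
  then have "\<forall>\<^sub>F x in at_left r. x \<in> {c<..<r}" by (intro eventually_at_left_real) (simp add: real)
  then show ?thesis by (simp add: at_upper_def real)
qed (auto simp: at_upper_def eventually_at_top_dense)

lemma at_lower_nontrivial: "at_lower m \<noteq> bot"
  by (simp add: at_lower_def)

lemma at_upper_nontrivial: "at_upper m \<noteq> bot"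
  by (simp add: at_upper_def)

text \<open>The intervals \<open>(m1, b)\<close> with \<open>b > m1\<close> form a basis of the filter, whether \<open>m1\<close> is finite or not.\<close>

lemma filterlim_at_lower:
  assumes m: "m1 < m2" and x: "\<And>n. x n \<in> einterval m1 m2"
    and below: "\<And>c. c \<in> einterval m1 m2 \<Longrightarrow> \<forall>\<^sub>F n in sequentially. x n < c"
  shows "filterlim x (at_lower m1) sequentially"
  unfolding filterlim_iff
proof (intro allI impI)
  fix Q assume Q: "eventually Q (at_lower m1)"
  have "\<exists>b. m1 < ereal b \<and> (\<forall>y. m1 < ereal y \<longrightarrow> y < b \<longrightarrow> Q y)"
  proof (cases "m1 = - \<infinity>")
    case True
    then obtain N where "\<And>y. y < N \<Longrightarrow> Q y"
      using Q by (auto simp: at_lower_def eventually_at_bot_dense)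
    then show ?thesis using True by (intro exI[of _ N]) simp
  next
    case False
    then obtain r where r: "m1 = ereal r" using m by (cases m1) auto
    obtain b where "b > r" "\<And>y. r < y \<Longrightarrow> y < b \<Longrightarrow> Q y"
      using Q by (auto simp: r at_lower_def eventually_at_right_field)
    then show ?thesis by (intro exI[of _ b]) (simp add: r)
  qed
  then obtain b where b: "m1 < ereal b" "\<And>y. m1 < ereal y \<Longrightarrow> y < b \<Longrightarrow> Q y" by blast
  obtain c where c: "m1 < ereal c" "ereal c < min m2 (ereal b)"
    using ereal_dense2[of m1 "min m2 (ereal b)"] m b(1) by auto
  then have "c \<in> einterval m1 m2" by (simp add: einterval_def)
  from below[OF this] show "\<forall>\<^sub>F n in sequentially. Q (x n)"
  proof eventually_elim
    case (elim n)
    then show ?case using x[of n] c by (intro b(2)) (auto simp: einterval_def)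
  qed
qed

lemma filterlim_at_upper:
  assumes m: "m1 < m2" and x: "\<And>n. x n \<in> einterval m1 m2"
    and above: "\<And>c. c \<in> einterval m1 m2 \<Longrightarrow> \<forall>\<^sub>F n in sequentially. c < x n"
  shows "filterlim x (at_upper m2) sequentially"
  unfolding filterlim_iff
proof (intro allI impI)
  fix Q assume Q: "eventually Q (at_upper m2)"
  have "\<exists>b. ereal b < m2 \<and> (\<forall>y. ereal y < m2 \<longrightarrow> b < y \<longrightarrow> Q y)"
  proof (cases "m2 = \<infinity>")
    case True
    then obtain N where "\<And>y. N < y \<Longrightarrow> Q y"
      using Q by (auto simp: at_upper_def eventually_at_top_dense)
    then show ?thesis using True by (intro exI[of _ N]) simp
  next
    case False
    then obtain r where r: "m2 = ereal r" using m by (cases m2) auto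
    obtain b where "b < r" "\<And>y. b < y \<Longrightarrow> y < r \<Longrightarrow> Q y"
      using Q by (auto simp: r at_upper_def eventually_at_left_field)
    then show ?thesis by (intro exI[of _ b]) (simp add: r)
  qed
  then obtain b where b: "ereal b < m2" "\<And>y. ereal y < m2 \<Longrightarrow> b < y \<Longrightarrow> Q y" by blast
  obtain c where c: "max m1 (ereal b) < ereal c" "ereal c < m2"
    using ereal_dense2[of "max m1 (ereal b)" m2] m b(1) by auto
  then have "c \<in> einterval m1 m2" by (simp add: einterval_def)
  from above[OF this] show "\<forall>\<^sub>F n in sequentially. Q (x n)"
  proof eventually_elim
    case (elim n)
    then show ?case using x[of n] c by (intro b(2)) (auto simp: einterval_def)
  qed
qed

text \<open>The difference quotients are bounded by \<open>C \<bar>q - p\<bar>\<^sup>1\<^sup>/\<^sup>2\<close>, so the derivative is zero.\<close>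

lemma constant_if_increment_superlinear:
  fixes f :: "real \<Rightarrow> 'a::real_normed_vector"
  assumes inc: "\<And>p q. s \<le> p \<Longrightarrow> p \<le> q \<Longrightarrow> q \<le> t \<Longrightarrow> norm (f q - f p) \<le> C * ((q - p) * sqrt (q - p))"
    and "s \<le> t"
  shows "f t = f s"
proof -
  have "(f has_vector_derivative 0) (at p within {s..t})" if p: "p \<in> {s..t}" for p
    unfolding has_vector_derivative_def
  proof (rule has_derivativeI_sandwich[where e = 1])
    show "norm (f q - f p - (q - p) *\<^sub>R 0) / norm (q - p) \<le> C * sqrt \<bar>q - p\<bar>"
      if q: "q \<in> {s..t}" and "q \<noteq> p" for q
    proof -
      have "norm (f q - f p) \<le> C * (\<bar>q - p\<bar> * sqrt \<bar>q - p\<bar>)"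
        using inc[of p q] inc[of q p] p q by (cases "p \<le> q") (auto simp: norm_minus_commute abs_if)
      then show ?thesis using \<open>q \<noteq> p\<close> by (simp add: divide_le_eq mult_ac)
    qed
    have "((\<lambda>q. C * sqrt \<bar>q - p\<bar>) \<longlongrightarrow> C * sqrt \<bar>p - p\<bar>) (at p within {s..t})"
      by (intro tendsto_intros)
    then show "((\<lambda>q. C * sqrt \<bar>q - p\<bar>) \<longlongrightarrow> 0) (at p within {s..t})" by simp
  qed auto
  then obtain c where c: "\<And>p. p \<in> {s..t} \<Longrightarrow> f p = c"
    using has_vector_derivative_zero_constant[of "{s..t}" f] by (auto simp del: atLeastAtMost_iff)
  show ?thesis using c[of s] c[of t] \<open>s \<le> t\<close> by simp
qed

locale riccati = spectral_operator D A E
  for D :: "'a::chilbert set" and A :: "'a \<Rightarrow> 'a" and E :: "real set \<Rightarrow> ('a \<Rightarrow>\<^sub>L 'a)" +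
  fixes B :: "'b::chilbert \<Rightarrow>\<^sub>L 'a" and Z :: "'b \<Rightarrow>\<^sub>L 'b" and m1 m2 :: ereal
    and k :: "real \<Rightarrow> ('b \<Rightarrow>\<^sub>L 'b)"
  assumes lin_B: "clinear_op B"
    and m1_less_m2: "m1 < m2"
    and full: "\<And>x. E (einterval m1 m2) x = x"
    and deriv_K: "\<And>\<mu>. \<mu> \<in> einterval m1 m2 \<Longrightarrow> (K_B E B has_vector_derivative k \<mu>) (at \<mu>)"
    and cont_k: "continuous_on (einterval m1 m2) k"
    and resolvent_set: "\<And>\<mu>. m1 \<le> ereal \<mu> \<Longrightarrow> ereal \<mu> \<le> m2 \<Longrightarrow>
        complex_of_real \<mu> \<notin> spec UNIV (blinfun_apply Z)"
begin

abbreviation R :: "real \<Rightarrow> ('b \<Rightarrow>\<^sub>L 'b)" where "R \<mu> \<equiv> resolvent Z (complex_of_real \<mu>)"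

lemma not_spec: "\<mu> \<in> einterval m1 m2 \<Longrightarrow> complex_of_real \<mu> \<notin> spec UNIV (blinfun_apply Z)"
  by (rule resolvent_set) (auto simp: einterval_def)

lemma deriv_R:
  assumes "\<mu> \<in> einterval m1 m2"
  shows "(R has_vector_derivative (R \<mu> o\<^sub>L R \<mu>)) (at \<mu>)"
proof -
  let ?I = "einterval m1 m2"
  have "(resolvent Z has_derivative (\<lambda>h. h *\<^sub>O (R \<mu> o\<^sub>L R \<mu>))) (at (complex_of_real \<mu>) within complex_of_real ` ?I)"
    by (rule has_derivative_subset[OF has_derivative_resolvent[OF not_spec[OF assms]]])
      (use not_spec in blast)
  from has_derivative_in_compose[OF has_derivative_of_real[OF has_derivative_ident] this]
  have "(R has_derivative (\<lambda>h. h *\<^sub>R (R \<mu> o\<^sub>L R \<mu>))) (at \<mu> within ?I)"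
    by (simp add: of_real_scaleC_op)
  then show ?thesis
    using at_within_open[OF assms open_einterval] by (simp add: has_vector_derivative_def)
qed

sublocale stieltjes E B "einterval m1 m2" k R
  by unfold_locales
    (use lin_B einterval_subinterval deriv_K cont_k deriv_R clinear_resolvent[OF not_spec] in auto)

abbreviation I :: "real set" where "I \<equiv> einterval m1 m2"

text \<open>
  On a short interval starting at \<open>p\<close> the operator \<open>A\<close> acts as the scalar \<open>p\<close>, and \<open>p R(p) = R(p) Z - 1\<close>.
  The errors have order \<open>3/2\<close>: if \<open>v\<close> is the difference of the two sides, then \<open>q \<mapsto> E [s, q) v\<close> has
  derivative zero.
\<close>

lemma A_J:
  assumes I: "s \<in> I" "t \<in> I" and le: "s \<le> t"
  shows "J s t x \<in> D" "A (J s t x) = J s t (Z x) - P s t (B x)"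
proof -
  have w: "P s t (J s t x) = J s t x" for x using P_J_apply[OF I] le by simp
  show D: "J s t x \<in> D" using bounded_in_D[of s t "J s t x"] by (simp add: w)
  define v where "v = A (J s t x) - (J s t (Z x) - P s t (B x))"
  obtain C where C: "C \<ge> 0"
    "\<And>p q \<zeta>. s \<le> p \<Longrightarrow> p \<le> \<zeta> \<Longrightarrow> \<zeta> \<le> q \<Longrightarrow> q \<le> t \<Longrightarrow>
       norm (J p q - (P p q o\<^sub>L B o\<^sub>L R \<zeta>)) \<le> C * ((q - p) * sqrt (q - p))"
    using J_local[OF I] by blast
  obtain C' where C': "C' \<ge> 0"
    "\<And>p q. s \<le> p \<Longrightarrow> p \<le> q \<Longrightarrow> q \<le> t \<Longrightarrow> norm (J p q) \<le> C' * sqrt (q - p)"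
    using J_bound[OF I] by blast
  define N where "N = C' * norm x + C * norm (Z x) + (\<bar>s\<bar> + \<bar>t\<bar>) * (C * norm x)"
  have Pv: "norm (P p q v) \<le> N * ((q - p) * sqrt (q - p))"
    if pq: "s \<le> p" "p \<le> q" "q \<le> t" for p q
  proof -
    have pI: "p \<in> I" using interval[OF I] pq by auto
    define d where "d = J p q - (P p q o\<^sub>L B o\<^sub>L R p)"
    have d: "norm (d y) \<le> (C * ((q - p) * sqrt (q - p))) * norm y" for y
      unfolding d_def using C(2)[of p p q] pq
      by (intro order_trans[OF norm_blinfun mult_right_mono]) auto
    have "{p..<q} \<inter> {s..<t} = {p..<q}" using pq by auto
    then have PP: "P p q (P s t y) = P p q y" for y by (simp add: E_E)
    have "P p q (A (J s t x)) = A (J p q x)"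
      using A_E[OF D, of "{p..<q}"] P_J_apply[OF I pq] by simp
    then have "P p q v = A (J p q x) - (J p q (Z x) - P p q (B x))"
      using P_J_apply[OF I pq] by (simp add: v_def blinfun.diff_right PP)
    also have "J p q (Z x) = d (Z x) + P p q (B (x + p *\<^sub>R R p x))"
      by (simp add: d_def blinfun.diff_left resolvent_left[OF not_spec[OF pI]] scaleC_of_real)
    also have "P p q (B (x + p *\<^sub>R R p x)) = P p q (B x) + p *\<^sub>R (J p q x - d x)"
      by (simp add: d_def blinfun.diff_left blinfun.add_right blinfun.scaleR_right)
    finally have eq: "P p q v = (A (J p q x) - p *\<^sub>R J p q x) - d (Z x) + p *\<^sub>R d x"
      by (simp add: algebra_simps)
    have "norm (A (J p q x) - p *\<^sub>R J p q x) \<le> (q - p) * norm (J p q x)"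
      using P_J_apply[OF I pq(1,2,3)] pq idem[of "{p..<q}" "J s t x"]
      by (intro A_near_scalar[of p q]) auto
    also have "\<dots> \<le> (q - p) * ((C' * sqrt (q - p)) * norm x)"
      using pq C'(2)[OF pq] by (intro mult_left_mono order_trans[OF norm_blinfun mult_right_mono]) auto
    finally have 1: "norm (A (J p q x) - p *\<^sub>R J p q x) \<le> (C' * norm x) * ((q - p) * sqrt (q - p))"
      by (simp add: mult_ac)
    have "norm (p *\<^sub>R d x) \<le> (\<bar>s\<bar> + \<bar>t\<bar>) * ((C * ((q - p) * sqrt (q - p))) * norm x)"
      unfolding norm_scaleR using pq d[of x] by (intro mult_mono) auto
    then have 2: "norm (p *\<^sub>R d x) \<le> ((\<bar>s\<bar> + \<bar>t\<bar>) * (C * norm x)) * ((q - p) * sqrt (q - p))"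
      by (simp add: mult_ac)
    have 3: "norm (d (Z x)) \<le> (C * norm (Z x)) * ((q - p) * sqrt (q - p))"
      using d[of "Z x"] by (simp add: mult_ac)
    have "norm (P p q v) \<le> norm (A (J p q x) - p *\<^sub>R J p q x) + norm (d (Z x)) + norm (p *\<^sub>R d x)"
      unfolding eq by (rule order_trans[OF norm_triangle_ineq add_right_mono[OF norm_triangle_ineq4]])
    then show ?thesis using 1 2 3 by (simp add: N_def distrib_right)
  qed
  have "P s t v = P s s v"
  proof (rule constant_if_increment_superlinear[OF _ le])
    show "norm (P s q v - P s p v) \<le> N * ((q - p) * sqrt (q - p))"
      if pq: "s \<le> p" "p \<le> q" "q \<le> t" for p q
      using Pv[OF pq] E_split[OF pq(1,2), of v] by simp
  qed
  then have "P s t v = 0" by simp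
  moreover have "P s t v = v"
    using A_E[OF D, of "{s..<t}"] w by (simp add: v_def blinfun.diff_right idem)
  ultimately show "A (J s t x) = J s t (Z x) - P s t (B x)" by (simp add: v_def)
qed

subsection \<open>Boundedness up to the end points\<close>

lemma J_combine:
  assumes "s \<in> I" "t \<in> I" "s \<le> u" "u \<le> t"
  shows "J s t = J s u + J u t"
proof (rule blinfun_eqI)
  fix x
  have "J s t x = P s t (J s t x)" using P_J_apply[OF assms(1,2)] assms(3,4) by simp
  also have "\<dots> = J s u x + J u t x"
    unfolding E_split[OF assms(3,4)] using P_J_apply[OF assms(1,2)] assms(3,4) by simp
  finally show "J s t x = (J s u + J u t) x" by (simp add: blinfun.add_left)
qed

text \<open>
  Near a point \<open>c\<close> of the resolvent set the identity for \<open>A J\<close> reads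
  \<open>J = (A - c) J R(c) + E [s, t) B R(c)\<close>, where \<open>A - c\<close> is small on the range of \<open>J\<close>.  The bound is
  the same for all \<open>[s, t)\<close> close to \<open>c\<close>, also if \<open>c\<close> is an end point of the interval.
\<close>

lemma J_bound_near_resolvent_point:
  assumes c: "complex_of_real c \<notin> spec UNIV (blinfun_apply Z)"
    and r: "r * norm (R c) \<le> 1 / 2" "r \<ge> 0"
    and I: "s \<in> I" "t \<in> I" "s \<le> t" and st: "c - r \<le> s" "t \<le> c + r"
  shows "norm (J s t) \<le> 2 * (norm B * norm (R c))"
proof -
  have "norm (J s t) \<le> norm (J s t) * (1 / 2) + norm B * norm (R c)"
  proof (rule norm_blinfun_bound)
    fix x
    let ?y = "R c x"
    have "J s t x = (A (J s t ?y) - c *\<^sub>R J s t ?y) + P s t (B ?y)"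
      using A_J(2)[OF I, of ?y] 
      by (simp add: resolvent_right[OF c] scaleC_of_real blinfun.add_right blinfun.scaleR_right)
    also have "norm \<dots> \<le> norm (A (J s t ?y) - c *\<^sub>R J s t ?y) + norm (P s t (B ?y))"
      by (rule norm_triangle_ineq)
    also have "norm (A (J s t ?y) - c *\<^sub>R J s t ?y) \<le> r * norm (J s t ?y)"
      using P_J_apply[OF I(1,2)] I(3) st r by (intro A_near_scalar[of s t]) auto
    also have "\<dots> \<le> r * (norm (J s t) * (norm (R c) * norm x))"
      using r(2) by (intro mult_left_mono order_trans[OF norm_blinfun mult_left_mono[OF norm_blinfun]]) auto
    also have "\<dots> = (r * norm (R c)) * (norm (J s t) * norm x)" by (simp add: mult_ac)
    also have "\<dots> \<le> (1 / 2) * (norm (J s t) * norm x)" by (intro mult_right_mono r) simp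
    also have "norm (P s t (B ?y)) \<le> norm B * (norm (R c) * norm x)"
      by (rule order_trans[OF norm_E_le order_trans[OF norm_blinfun mult_left_mono[OF norm_blinfun]]]) auto
    finally show "norm (J s t x) \<le> (norm (J s t) * (1 / 2) + norm B * norm (R c)) * norm x"
      by (simp add: algebra_simps)
  qed simp
  then show ?thesis by simp
qed

text \<open>
  Far out, the quadratic form of \<open>A\<close> gives \<open>(\<parallel>Z\<parallel> + 1) \<parallel>J x\<parallel> \<le> \<parallel>A J x\<parallel>\<close>, while \<open>A J = J Z - E [s, t) B\<close>
  bounds the right-hand side by \<open>\<parallel>J\<parallel> \<parallel>Z\<parallel> \<parallel>x\<parallel> + \<parallel>B\<parallel> \<parallel>x\<parallel>\<close>.
\<close>

lemma J_bound_near_infinity: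
  assumes I: "s \<in> I" "t \<in> I" "s \<le> t" and far: "s \<ge> norm Z + 1 \<or> t \<le> - (norm Z + 1)"
  shows "norm (J s t) \<le> norm B"
proof -
  have lower: "(norm Z + 1) * norm (J s t x) \<le> norm (A (J s t x))" for x
  proof -
    let ?w = "J s t x"
    have w: "P s t ?w = ?w" using P_J_apply[OF I(1,2)] I(3) by simp
    have "(norm Z + 1) * (norm ?w)\<^sup>2 \<le> \<bar>inner ?w (A ?w)\<bar>"
    proof (cases "s \<ge> norm Z + 1")
      case True
      then have "(norm Z + 1) * (norm ?w)\<^sup>2 \<le> s * (norm ?w)\<^sup>2" by (intro mult_right_mono) auto
      with form_bounds(1)[OF w] show ?thesis by linarith
    next
      case False
      with far have "t * (norm ?w)\<^sup>2 \<le> - (norm Z + 1) * (norm ?w)\<^sup>2" by (intro mult_right_mono) auto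
      with form_bounds(2)[OF w] show ?thesis by linarith
    qed
    also have "\<dots> \<le> norm ?w * norm (A ?w)" by (rule Cauchy_Schwarz_ineq2)
    finally have "norm ?w * ((norm Z + 1) * norm ?w) \<le> norm ?w * norm (A ?w)"
      by (simp add: power2_eq_square mult_ac)
    then show ?thesis by (cases "norm ?w = 0") auto
  qed
  have pos: "norm Z + 1 > 0" by (simp add: add_nonneg_pos)
  have "norm (J s t) \<le> (norm (J s t) * norm Z + norm B) / (norm Z + 1)"
  proof (rule norm_blinfun_bound)
    fix x
    have "(norm Z + 1) * norm (J s t x) \<le> norm (J s t (Z x) - P s t (B x))"
      using lower[of x] A_J(2)[OF I, of x] by simp
    also have "\<dots> \<le> norm (J s t) * (norm Z * norm x) + norm B * norm x"
      by (intro order_trans[OF norm_triangle_ineq4 add_mono] order_trans[OF norm_E_le]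
          order_trans[OF norm_blinfun mult_left_mono[OF norm_blinfun]] norm_blinfun) auto
    finally have "norm (J s t x) * (norm Z + 1) \<le> (norm (J s t) * norm Z + norm B) * norm x"
      by (simp add: algebra_simps)
    then show "norm (J s t x) \<le> (norm (J s t) * norm Z + norm B) / (norm Z + 1) * norm x"
      by (simp only: times_divide_eq_left pos_le_divide_eq[OF pos])
  qed (simp add: add_nonneg_nonneg)
  then have "norm (J s t) * (norm Z + 1) \<le> norm (J s t) * norm Z + norm B"
    by (simp only: pos_le_divide_eq[OF pos])
  then show ?thesis by (simp add: algebra_simps)
qed

lemma lower_end_bound:
  obtains \<alpha> C where "\<alpha> \<in> I" "\<And>s t. s \<in> I \<Longrightarrow> t \<in> I \<Longrightarrow> s \<le> t \<Longrightarrow> t \<le> \<alpha> \<Longrightarrow> norm (J s t) \<le> C"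
proof (cases "m1 = - \<infinity>")
  case True
  obtain p where p: "m1 < ereal p" "ereal p < m2" using ereal_dense2[OF m1_less_m2] by auto
  define \<alpha> where "\<alpha> = min p (- (norm Z + 1))"
  have "ereal \<alpha> \<le> ereal p" by (simp add: \<alpha>_def)
  then have "ereal \<alpha> < m2" using p(2) by (rule le_less_trans)
  then have "\<alpha> \<in> I" using True by (simp add: einterval_def)
  moreover have "norm (J s t) \<le> norm B" if "s \<in> I" "t \<in> I" "s \<le> t" "t \<le> \<alpha>" for s t
    using that by (intro J_bound_near_infinity) (auto simp: \<alpha>_def)
  ultimately show ?thesis using that by blast
next
  case False
  then obtain c where c: "m1 = ereal c" using m1_less_m2 by (cases m1) auto
  define r where "r = 1 / (2 * (norm (R c) + 1))"
  have r: "r > 0" "r * norm (R c) \<le> 1 / 2"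
    by (auto simp: r_def add_nonneg_pos divide_simps)
  have "m1 < min m2 (ereal (c + r))" using m1_less_m2 r c by simp
  then obtain \<alpha> where \<alpha>: "m1 < ereal \<alpha>" "ereal \<alpha> < min m2 (ereal (c + r))"
    using ereal_dense2 by blast
  have nc: "complex_of_real c \<notin> spec UNIV (blinfun_apply Z)"
    using c m1_less_m2 by (intro resolvent_set) auto
  have "norm (J s t) \<le> 2 * (norm B * norm (R c))" if "s \<in> I" "t \<in> I" "s \<le> t" "t \<le> \<alpha>" for s t
    using that \<alpha> r c by (intro J_bound_near_resolvent_point[OF nc r(2)]) (auto simp: einterval_def)
  moreover have "\<alpha> \<in> I" using \<alpha> by (auto simp: einterval_def)
  ultimately show ?thesis using that by blast
qed

lemma upper_end_bound:
  obtains \<beta> C where "\<beta> \<in> I" "\<And>s t. s \<in> I \<Longrightarrow> t \<in> I \<Longrightarrow> s \<le> t \<Longrightarrow> \<beta> \<le> s \<Longrightarrow> norm (J s t) \<le> C"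
proof (cases "m2 = \<infinity>")
  case True
  obtain p where p: "m1 < ereal p" "ereal p < m2" using ereal_dense2[OF m1_less_m2] by auto
  define \<beta> where "\<beta> = max p (norm Z + 1)"
  have "ereal p \<le> ereal \<beta>" by (simp add: \<beta>_def)
  with p(1) have "m1 < ereal \<beta>" by (rule less_le_trans)
  then have "\<beta> \<in> I" using True by (simp add: einterval_def)
  moreover have "norm (J s t) \<le> norm B" if "s \<in> I" "t \<in> I" "s \<le> t" "\<beta> \<le> s" for s t
    using that by (intro J_bound_near_infinity) (auto simp: \<beta>_def)
  ultimately show ?thesis using that by blast
next
  case False
  then obtain c where c: "m2 = ereal c" using m1_less_m2 by (cases m2) auto
  define r where "r = 1 / (2 * (norm (R c) + 1))"
  have r: "r > 0" "r * norm (R c) \<le> 1 / 2"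
    by (auto simp: r_def add_nonneg_pos divide_simps)
  have "max m1 (ereal (c - r)) < m2" using m1_less_m2 r c by simp
  then obtain \<beta> where \<beta>: "max m1 (ereal (c - r)) < ereal \<beta>" "ereal \<beta> < m2"
    using ereal_dense2 by blast
  have nc: "complex_of_real c \<notin> spec UNIV (blinfun_apply Z)"
    using c m1_less_m2 by (intro resolvent_set) auto
  have "norm (J s t) \<le> 2 * (norm B * norm (R c))" if "s \<in> I" "t \<in> I" "s \<le> t" "\<beta> \<le> s" for s t
    using that \<beta> r c by (intro J_bound_near_resolvent_point[OF nc r(2)]) (auto simp: einterval_def)
  moreover have "\<beta> \<in> I" using \<beta> by (auto simp: einterval_def)
  ultimately show ?thesis using that by blast
qed

lemma J_uniform_bound:
  obtains C where "C \<ge> 0" "\<And>s t. s \<in> I \<Longrightarrow> t \<in> I \<Longrightarrow> s \<le> t \<Longrightarrow> norm (J s t) \<le> C"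
proof -
  obtain \<alpha> C1 where \<alpha>: "\<alpha> \<in> I"
    "\<And>s t. s \<in> I \<Longrightarrow> t \<in> I \<Longrightarrow> s \<le> t \<Longrightarrow> t \<le> \<alpha> \<Longrightarrow> norm (J s t) \<le> C1" using lower_end_bound by blast
  obtain \<beta> C2 where \<beta>: "\<beta> \<in> I"
    "\<And>s t. s \<in> I \<Longrightarrow> t \<in> I \<Longrightarrow> s \<le> t \<Longrightarrow> \<beta> \<le> s \<Longrightarrow> norm (J s t) \<le> C2" using upper_end_bound by blast
  obtain C3 where C3: "C3 \<ge> 0"
    "\<And>s t. \<alpha> \<le> s \<Longrightarrow> s \<le> t \<Longrightarrow> t \<le> \<beta> \<Longrightarrow> norm (J s t) \<le> C3 * sqrt (t - s)"
    using J_bound[OF \<alpha>(1) \<beta>(1)] by blast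
  define M where "M = C3 * sqrt \<bar>\<beta> - \<alpha>\<bar>"
  have M: "norm (J s t) \<le> M" if "\<alpha> \<le> s" "s \<le> t" "t \<le> \<beta>" for s t
    using C3(1) that unfolding M_def by (intro order_trans[OF C3(2)[OF that] mult_left_mono]) auto
  have split: "norm (J s t) \<le> norm (J s u) + norm (J u t)"
    if "s \<in> I" "t \<in> I" "s \<le> u" "u \<le> t" for s t u
    unfolding J_combine[OF that] by (rule norm_triangle_ineq)
  define C where "C = \<bar>C1\<bar> + \<bar>M\<bar> + \<bar>C2\<bar>"
  have right: "norm (J s t) \<le> \<bar>M\<bar> + \<bar>C2\<bar>" if st: "s \<in> I" "t \<in> I" "s \<le> t" "\<alpha> \<le> s" for s t
  proof -
    consider "t \<le> \<beta>" | "\<beta> \<le> s" | "s \<le> \<beta>" "\<beta> \<le> t" by linarith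
    then show ?thesis
    proof cases
      case 1 then show ?thesis using M[of s t] st by simp
    next
      case 2 then show ?thesis using \<beta>(2)[of s t] st by simp
    next
      case 3 then show ?thesis
        using split[of s t \<beta>] M[of s \<beta>] \<beta>(2)[of \<beta> t] \<beta>(1) st by simp
    qed
  qed
  have "norm (J s t) \<le> C" if st: "s \<in> I" "t \<in> I" "s \<le> t" for s t
  proof -
    consider "t \<le> \<alpha>" | "\<alpha> \<le> s" | "s \<le> \<alpha>" "\<alpha> \<le> t" by linarith
    then show ?thesis
    proof cases
      case 1 then show ?thesis using \<alpha>(2)[of s t] st by (simp add: C_def)
    next
      case 2 then show ?thesis using right[of s t] st by (simp add: C_def)
    next
      case 3 then show ?thesis
        using split[of s t \<alpha>] \<alpha>(2)[of s \<alpha>] right[of \<alpha> t] \<alpha>(1) st by (simp add: C_def)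
    qed
  qed
  then show ?thesis using that[of C] by (simp add: C_def)
qed

subsection \<open>The solution\<close>

text \<open>
  The increments of \<open>J\<close> over disjoint intervals are orthogonal, so that uniform boundedness already
  implies strong convergence.
\<close>

lemma J_limit:
  obtains Y :: "'b \<Rightarrow>\<^sub>L 'a" where "clinear_op Y"
    "\<And>x. ((\<lambda>(s, t). J s t x) \<longlongrightarrow> Y x) (at_lower m1 \<times>\<^sub>F at_upper m2)"
    "\<And>x. Y x \<in> D" "\<And>x. A (Y x) = Y (Z x) - B x"
    "\<And>x. \<exists>l u. (\<forall>n. l n \<in> I \<and> u n \<in> I \<and> l n \<le> u n) \<and> (\<lambda>n::nat. J (l n) (u n) x) \<longlonglongrightarrow> Y x"
proof (rule einterval_Icc_approximation[OF m1_less_m2])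
  fix u l :: "nat \<Rightarrow> real"
  assume ul: "incseq u" "decseq l" "\<And>i. l i < u i"
    "\<And>i. m1 < ereal (l i)" "\<And>i. ereal (u i) < m2"
    "(\<lambda>n. ereal (l n)) \<longlonglongrightarrow> m1" "(\<lambda>n. ereal (u n)) \<longlonglongrightarrow> m2"
  have lu: "l n \<in> I" "u n \<in> I" "l n \<le> u n" for n
  proof -
    have a: "ereal (l n) < ereal (u n)" using ul(3) by simp
    show "l n \<in> I" "u n \<in> I"
      using less_trans[OF a ul(5)] less_trans[OF ul(4) a] ul(4,5) by (simp_all add: einterval_def)
    show "l n \<le> u n" using a by simp
  qed
  have mono: "l n \<le> l m" "u m \<le> u n" if "m \<le> n" for m n
    using decseqD[OF ul(2) that] incseqD[OF ul(1) that] .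
  obtain C where C: "C \<ge> 0" "\<And>s t. s \<in> I \<Longrightarrow> t \<in> I \<Longrightarrow> s \<le> t \<Longrightarrow> norm (J s t) \<le> C"
    using J_uniform_bound by blast
  let ?v = "\<lambda>x n. J (l n) (u n) x"
  have Pv: "P (l m) (u m) (?v x n) = ?v x m" if "m \<le> n" for m n x
    using mono[OF that] lu(3)[of m] by (intro P_J_apply lu) auto
  have bound: "norm (?v x n) \<le> C * norm x" for x n
    by (rule order_trans[OF norm_blinfun mult_right_mono]) (auto intro: C lu)
  have pyth: "(norm (?v x n))\<^sup>2 = (norm (?v x m))\<^sup>2 + (norm (?v x n - ?v x m))\<^sup>2" if "m \<le> n" for m n x
    using pythagoras[of "{l m..<u m}" "?v x n"] Pv[OF that] by simp
  have "\<exists>y. ?v x \<longlonglongrightarrow> y" for x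
  proof -
    let ?q = "\<lambda>n. (norm (?v x n))\<^sup>2"
    have "incseq ?q"
    proof (rule incseq_SucI)
      show "?q n \<le> ?q (Suc n)" for n using pyth[of n "Suc n" x] by simp
    qed
    moreover have "\<forall>n. ?q n \<le> (C * norm x)\<^sup>2" by (intro allI power_mono bound) simp
    ultimately obtain L where "?q \<longlonglongrightarrow> L" by (rule incseq_convergent)
    then have cq: "Cauchy ?q" by (rule LIMSEQ_imp_Cauchy)
    have "Cauchy (?v x)"
    proof (rule metric_CauchyI)
      fix e :: real assume e: "e > 0"
      then have "e\<^sup>2 > 0" by simp
      from metric_CauchyD[OF cq this] obtain N
        where N: "\<And>m n. m \<ge> N \<Longrightarrow> n \<ge> N \<Longrightarrow> dist (?q m) (?q n) < e\<^sup>2" by blast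
      have *: "dist (?v x n) (?v x m) < e" if "m \<ge> N" "m \<le> n" for m n
      proof -
        have "(norm (?v x n - ?v x m))\<^sup>2 < e\<^sup>2"
          using N[of m n] that pyth[of m n x] by (simp add: dist_real_def)
        then show ?thesis using e by (simp add: dist_norm power2_less_imp_less)
      qed
      then show "\<exists>N. \<forall>m\<ge>N. \<forall>n\<ge>N. dist (?v x m) (?v x n) < e"
      proof (intro exI[of _ N] allI impI)
        fix m n assume "m \<ge> N" "n \<ge> N"
        then show "dist (?v x m) (?v x n) < e"
          using *[of m n] *[of n m] by (cases "m \<le> n") (auto simp: dist_commute)
      qed
    qed
    then show ?thesis by (simp add: Cauchy_convergent_iff convergent_def)
  qed
  then obtain y where y: "\<And>x. ?v x \<longlonglongrightarrow> y x" by metis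
  have "bounded_linear y"
  proof (rule bounded_linear_intro)
    show "y (a + b) = y a + y b" for a b
      using tendsto_add[OF y[of a] y[of b]]
      by (intro LIMSEQ_unique[OF y[of "a + b"]]) (simp add: blinfun.add_right)
    show "y (r *\<^sub>R a) = r *\<^sub>R y a" for r a
      using tendsto_scaleR[OF tendsto_const[of r] y[of a]]
      by (intro LIMSEQ_unique[OF y[of "r *\<^sub>R a"]]) (simp add: blinfun.scaleR_right)
    show "norm (y x) \<le> norm x * C" for x
      using tendsto_norm[OF y[of x]] by (rule LIMSEQ_le_const2) (simp add: mult.commute[of _ C] bound)
  qed
  then obtain Y where Y: "\<And>x. blinfun_apply Y x = y x" by (metis bounded_linear_Blinfun_apply)
  have lim: "?v x \<longlonglongrightarrow> Y x" for x using y by (simp add: Y)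
  show ?thesis
  proof
    show "clinear_op Y"
      unfolding clinear_op_def
    proof (intro allI)
      fix c x
      have "(\<lambda>n. c *\<^sub>C ?v x n) \<longlonglongrightarrow> c *\<^sub>C Y x"
        by (rule bounded_linear.tendsto[OF bounded_linear_scaleC lim])
      moreover have "c *\<^sub>C ?v x n = ?v (c *\<^sub>C x) n" for n
        using clinear_J[OF lu(1,2), of n n] by (simp add: clinear_op_def)
      ultimately show "Y (c *\<^sub>C x) = c *\<^sub>C Y x" by (intro LIMSEQ_unique[OF lim[of "c *\<^sub>C x"]]) simp
    qed
    have PY: "P s t (Y x) = J s t x" if st: "s \<in> I" "t \<in> I" "s \<le> t" for s t x
    proof -
      have "\<forall>\<^sub>F n in sequentially. ereal (l n) < ereal s \<and> ereal t < ereal (u n)"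
        using order_tendstoD(2)[OF ul(6), of "ereal s"] order_tendstoD(1)[OF ul(7), of "ereal t"] st
        by (auto simp: einterval_def intro: eventually_conj)
      then have ev: "\<forall>\<^sub>F n in sequentially. P s t (?v x n) = J s t x"
        by eventually_elim (rule P_J_apply, use lu st in auto)
      have "(\<lambda>n. P s t (?v x n)) \<longlonglongrightarrow> P s t (Y x)"
        by (rule blinfun.tendsto[OF tendsto_const lim])
      then have "(\<lambda>n. J s t x) \<longlonglongrightarrow> P s t (Y x)" using tendsto_cong[OF ev] by simp
      then show ?thesis by (simp add: LIMSEQ_const_iff)
    qed
    show "((\<lambda>(s, t). J s t x) \<longlongrightarrow> Y x) (at_lower m1 \<times>\<^sub>F at_upper m2)" for x
    proof (rule tendstoI)
      fix e :: real assume "e > 0"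
      then obtain n where n: "dist (?v x n) (Y x) < e"
        using metric_LIMSEQ_D[OF lim[of x]] by blast
      have near: "dist (J s t x) (Y x) < e"
        if st: "m1 < ereal s" "s < l n" "u n < t" "ereal t < m2" for s t
      proof -
        have I: "s \<in> I" "t \<in> I" "s \<le> t"
          using st lu[of n] less_trans[of "ereal s" "ereal (l n)" m2] less_trans[of m1 "ereal (u n)" "ereal t"]
          by (auto simp: einterval_def)
        have "P s t (?v x n) = ?v x n"
          using E_E[of "{s..<t}" "{l n..<u n}" "?v x n"] Pv[of n n x] st by (simp add: Int_absorb1 subset_eq)
        then have "Y x - J s t x = E (- {s..<t}) (Y x - ?v x n)"
          using PY[OF I, of x] by (simp add: E_Compl blinfun.diff_right)
        then have "norm (Y x - J s t x) \<le> norm (Y x - ?v x n)"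
          using norm_E_le[of "- {s..<t}" "Y x - ?v x n"] by (simp add: borel_comp)
        then show ?thesis using n unfolding dist_norm norm_minus_commute[of _ "Y x"] by linarith
      qed
      have "\<forall>\<^sub>F p in at_lower m1 \<times>\<^sub>F at_upper m2. (m1 < ereal (fst p) \<and> fst p < l n) \<and> u n < snd p \<and> ereal (snd p) < m2"
        by (rule eventually_prodI[OF eventually_at_lower[OF ul(4)[of n]] eventually_at_upper[OF ul(5)[of n]]])
      then show "\<forall>\<^sub>F p in at_lower m1 \<times>\<^sub>F at_upper m2. dist (case p of (s, t) \<Rightarrow> J s t x) (Y x) < e"
        by eventually_elim (use near in \<open>auto simp: case_prod_unfold\<close>)
    qed
    have AY: "(\<lambda>n. A (?v x n)) \<longlonglongrightarrow> Y (Z x) - B x" for x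
    proof -
      have "A (?v x n) = ?v (Z x) n - P (l n) (u n) (B x)" for n by (rule A_J(2)[OF lu])
      moreover have "(\<lambda>n. P (l n) (u n) (B x)) \<longlonglongrightarrow> B x"
        by (rule E_exhaust[OF full ul(6,7,2,1,4,5)])
      ultimately show ?thesis using tendsto_diff[OF lim[of "Z x"]] by simp
    qed
    show "Y x \<in> D" "A (Y x) = Y (Z x) - B x" for x
      by (rule A_closed[OF A_J(1)[OF lu] lim AY])+
    show "\<exists>l u. (\<forall>n. l n \<in> I \<and> u n \<in> I \<and> l n \<le> u n) \<and> (\<lambda>n::nat. J (l n) (u n) x) \<longlonglongrightarrow> Y x" for x
      using lu lim by blast
  qed
qed

lemma norm_J_le:
  assumes I: "s \<in> I" "t \<in> I" and le: "s \<le> t"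
    and fin: "(\<integral>\<^sup>+\<mu>\<in>I. ennreal (norm (k \<mu>) * (norm (R \<mu>))\<^sup>2) \<partial>lborel) < \<infinity>" (is "?N < \<infinity>")
  shows "(norm (J s t x))\<^sup>2 \<le> enn2real ?N * (norm x)\<^sup>2"
proof -
  have sub: "{s..t} \<subseteq> I" by (rule interval[OF I])
  let ?g = "\<lambda>\<mu>. norm (k \<mu>) * (norm (R \<mu>))\<^sup>2"
  have "continuous_on {s..t} ?g"
    by (intro continuous_intros continuous_on_subset[OF cont_k sub] continuous_on_subset[OF R_cont sub])
  then have g: "?g integrable_on {s..t}" by (rule integrable_continuous_real)
  have "(norm (J s t x))\<^sup>2 \<le> integral {s..t} ?g * (norm x)\<^sup>2"
  proof (rule has_integral_le[OF norm_J_sq[OF I le]])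
    show "((\<lambda>\<mu>. ?g \<mu> * (norm x)\<^sup>2) has_integral integral {s..t} ?g * (norm x)\<^sup>2) {s..t}"
      by (rule has_integral_mult_left[OF integrable_integral[OF g]])
    fix \<mu>
    have "inner (k \<mu> (R \<mu> x)) (R \<mu> x) \<le> norm (k \<mu> (R \<mu> x)) * norm (R \<mu> x)"
      by (rule norm_cauchy_schwarz)
    also have "\<dots> \<le> (norm (k \<mu>) * norm (R \<mu> x)) * norm (R \<mu> x)"
      by (intro mult_right_mono norm_blinfun) simp
    also have "\<dots> = norm (k \<mu>) * (norm (R \<mu> x))\<^sup>2" by (simp add: power2_eq_square)
    also have "\<dots> \<le> norm (k \<mu>) * (norm (R \<mu>) * norm x)\<^sup>2"
      by (intro mult_left_mono power_mono norm_blinfun) auto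
    finally show "inner (k \<mu> (R \<mu> x)) (R \<mu> x) \<le> ?g \<mu> * (norm x)\<^sup>2" by (simp add: power_mult_distrib)
  qed
  also have "integral {s..t} ?g \<le> enn2real ?N"
  proof -
    have "ennreal (integral {s..t} ?g) = (\<integral>\<^sup>+\<mu>\<in>{s..t}. ennreal (?g \<mu>) \<partial>lborel)"
      by (rule nn_integral_has_integral_lebesgue'[OF _ integrable_integral[OF g], symmetric]) simp
    also have "\<dots> \<le> ?N" using sub by (intro nn_integral_mono mult_left_mono) (auto split: split_indicator)
    finally have "enn2real (ennreal (integral {s..t} ?g)) \<le> enn2real ?N"
      using fin by (intro enn2real_mono) auto
    then show ?thesis by (simp add: integral_nonneg[OF g])
  qed
  finally show ?thesis by (simp add: mult_right_mono)
qed

text \<open>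
  The last conclusion is \<open>B\<^sup>* Y x = \<integral> k(\<mu>) R(\<mu>) x d\<mu>\<close> in weak form, which can be compared with the contour
  integral that defines \<open>X\<close>.
\<close>

theorem solution:
  obtains Y :: "'b \<Rightarrow>\<^sub>L 'a" where "clinear_op Y"
    "\<And>x. has_improper_stieltjes E (\<lambda>\<mu>. B (R \<mu> x)) m1 m2 (Y x)"
    "(\<integral>\<^sup>+\<mu>\<in>I. ennreal (norm (k \<mu>) * (norm (R \<mu>))\<^sup>2) \<partial>lborel) < \<infinity> \<Longrightarrow>
      norm Y \<le> sqrt (enn2real (\<integral>\<^sup>+\<mu>\<in>I. ennreal (norm (k \<mu>) * (norm (R \<mu>))\<^sup>2) \<partial>lborel))"
    "\<And>x. Y x \<in> D" "\<And>x. A (Y x) = Y (Z x) - B x"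
    "\<And>x y. ((\<lambda>(s, t). integral {s..t} (\<lambda>\<mu>. cinner y (k \<mu> (R \<mu> x)))) \<longlongrightarrow> cinner y (adj B (Y x)))
      (at_lower m1 \<times>\<^sub>F at_upper m2)"
proof -
  obtain Y :: "'b \<Rightarrow>\<^sub>L 'a" where Y: "clinear_op Y"
    "\<And>x. ((\<lambda>(s, t). J s t x) \<longlongrightarrow> Y x) (at_lower m1 \<times>\<^sub>F at_upper m2)"
    "\<And>x. Y x \<in> D" "\<And>x. A (Y x) = Y (Z x) - B x"
    "\<And>x. \<exists>l u. (\<forall>n. l n \<in> I \<and> u n \<in> I \<and> l n \<le> u n) \<and> (\<lambda>n::nat. J (l n) (u n) x) \<longlonglongrightarrow> Y x"
    using J_limit by blast
  let ?N = "\<integral>\<^sup>+\<mu>\<in>I. ennreal (norm (k \<mu>) * (norm (R \<mu>))\<^sup>2) \<partial>lborel"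
  show ?thesis
  proof
    show "has_improper_stieltjes E (\<lambda>\<mu>. B (R \<mu> x)) m1 m2 (Y x)" for x
      unfolding has_improper_stieltjes_def
      by (rule exI[of _ "\<lambda>(s, t). J s t x"]) (use has_stieltjes_J Y(2) in auto)
    show "norm Y \<le> sqrt (enn2real ?N)" if fin: "?N < \<infinity>"
    proof (rule norm_blinfun_bound)
      fix x
      obtain l u where lu: "\<And>n. l n \<in> I \<and> u n \<in> I \<and> l n \<le> u n" "(\<lambda>n::nat. J (l n) (u n) x) \<longlonglongrightarrow> Y x"
        using Y(5) by blast
      have "norm (J (l n) (u n) x) \<le> sqrt (enn2real ?N) * norm x" for n
      proof (rule power2_le_imp_le)
        show "(norm (J (l n) (u n) x))\<^sup>2 \<le> (sqrt (enn2real ?N) * norm x)\<^sup>2"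
          using norm_J_le[OF _ _ _ fin, of "l n" "u n" x] lu(1)[of n] by (simp add: power_mult_distrib)
      qed simp
      then show "norm (Y x) \<le> sqrt (enn2real ?N) * norm x"
        by (intro LIMSEQ_le_const2[OF tendsto_norm[OF lu(2)]]) blast
    qed simp
    show "((\<lambda>(s, t). integral {s..t} (\<lambda>\<mu>. cinner y (k \<mu> (R \<mu> x)))) \<longlongrightarrow> cinner y (adj B (Y x)))
        (at_lower m1 \<times>\<^sub>F at_upper m2)" for x y
    proof -
      obtain p where p: "m1 < ereal p" "ereal p < m2" using ereal_dense2[OF m1_less_m2] by auto
      have eq: "integral {s..t} (\<lambda>\<mu>. cinner y (k \<mu> (R \<mu> x))) = cinner y (adj B (J s t x))"
        if "s \<in> I" "t \<in> I" "s \<le> t" for s t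
        using has_integral_linear[OF adj_J[OF that] bounded_linear_compose[OF
            bounded_linear_cinner_right[of y] bounded_linear_apply_blinfun[of x]]]
        by (simp add: o_def integral_unique)
      have "\<forall>\<^sub>F q in at_lower m1 \<times>\<^sub>F at_upper m2. (m1 < ereal (fst q) \<and> fst q < p) \<and> p < snd q \<and> ereal (snd q) < m2"
        by (rule eventually_prodI[OF eventually_at_lower[OF p(1)] eventually_at_upper[OF p(2)]])
      then have ev: "\<forall>\<^sub>F q in at_lower m1 \<times>\<^sub>F at_upper m2.
          cinner y (adj B (case q of (s, t) \<Rightarrow> J s t x))
            = (case q of (s, t) \<Rightarrow> integral {s..t} (\<lambda>\<mu>. cinner y (k \<mu> (R \<mu> x))))"
      proof eventually_elim
        case (elim q)
        obtain s t where q: "q = (s, t)" by fastforce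
        have "ereal s < ereal p" "ereal p < ereal t" using elim q by auto
        then have "s \<in> I" "t \<in> I" "s \<le> t"
          using elim q p less_trans[of "ereal s" "ereal p" m2] less_trans[of m1 "ereal p" "ereal t"]
          by (auto simp: einterval_def)
        then show ?case using eq q by simp
      qed
      have "((\<lambda>q. cinner y (adj B (case q of (s, t) \<Rightarrow> J s t x))) \<longlongrightarrow> cinner y (adj B (Y x)))
          (at_lower m1 \<times>\<^sub>F at_upper m2)"
        by (rule bounded_linear.tendsto[OF bounded_linear_cinner_right blinfun.tendsto[OF tendsto_const Y(2)]])
      then show ?thesis by (rule iffD1[OF tendsto_cong[OF ev]])
    qed
  qed (fact Y)+
qed

end

section \<open>Integration along curves parametrised by arc length\<close>

text \<open>
  At exceptional points the Lipschitz bound replaces the derivative; the intervals tagged there lie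
  in an open set \<open>U\<close> of small measure, and \<open>u t = \<bar>U \<inter> [a, t]\<bar>\<close> adds up their lengths.
\<close>

lemma fundamental_theorem_of_calculus_ae:
  fixes F :: "real \<Rightarrow> 'b::banach"
  assumes ab: "a \<le> b" and N: "negligible N" and L: "L \<ge> 0"
    and lip: "\<And>x. x \<in> {a..b} \<Longrightarrow>
      \<exists>d>0. \<forall>y\<in>{a..b}. \<bar>y - x\<bar> < d \<longrightarrow> norm (F y - F x) \<le> L * \<bar>y - x\<bar>"
    and der: "\<And>x. x \<in> {a..b} - N \<Longrightarrow> (F has_vector_derivative f x) (at x within {a..b})"
  shows "(f has_integral F b - F a) {a..b}"
proof (cases "a = b")
  case True
  then show ?thesis by (simp add: has_integral_refl)
next
  case False
  then have "a < b" using ab by simp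
  define f' where "f' x = (if x \<in> N then 0 else f x)" for x
  have "(f' has_integral F b - F a) {a..b}"
    unfolding has_integral_factor_content_real
  proof (intro allI impI)
    fix e :: real assume e: "e > 0"
    define \<epsilon> where "\<epsilon> = e / 2 * (b - a) / (L + 1)"
    have \<epsilon>: "\<epsilon> > 0" using e \<open>a < b\<close> L by (simp add: \<epsilon>_def)
    obtain U where U: "open U" "N \<subseteq> U" "(U - N) \<in> lmeasurable" "emeasure lebesgue (U - N) < ennreal \<epsilon>"
      using sets_lebesgue_outer_open[OF negligible_imp_sets[OF N] \<epsilon>] by blast
    have "U = (U - N) \<union> N" using U(2) by auto
    then have Um: "U \<in> lmeasurable"
      using U(3) negligible_imp_measurable[OF N] by (metis fmeasurable.Un)
    have "measure lebesgue U = measure lebesgue (U - N)"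
      by (rule measure_negligible_symdiff[symmetric, OF Um])
        (rule negligible_subset[OF N], auto)
    also have "\<dots> < \<epsilon>"
      using U(3,4) \<epsilon> by (simp add: emeasure_eq_measure2 ennreal_less_iff)
    finally have U\<epsilon>: "measure lebesgue U < \<epsilon>" .
    define u where "u t = measure lebesgue (U \<inter> {a..t})" for t
    have Ut: "U \<inter> {s..t} \<in> lmeasurable" for s t
      using Um by (intro fmeasurable_Int_fmeasurable) auto
    have u_mono: "u s \<le> u t" if "s \<le> t" for s t
      unfolding u_def using that by (intro measure_mono_fmeasurable Ut fmeasurableD) auto
    have u_jump: "u t - u s = t - s" if st: "a \<le> s" "s \<le> t" and sub: "{s..t} \<subseteq> U" for s t
    proof -
      have eq: "U \<inter> {a..t} = (U \<inter> {a..s}) \<union> {s<..t}" using st sub by force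
      have "measure lebesgue (U \<inter> {a..t}) = measure lebesgue (U \<inter> {a..s}) + measure lebesgue {s<..t}"
        unfolding eq
      proof (rule measure_Union)
        show "emeasure lebesgue (U \<inter> {a..s}) \<noteq> \<infinity>" using fmeasurableD2[OF Ut] by simp
        show "U \<inter> {a..s} \<in> sets lebesgue" using fmeasurableD[OF Ut] .
      qed (use st in auto)
      then show ?thesis using st by (simp add: u_def)
    qed
    have "\<exists>d>0. \<forall>y\<in>{a..b}. \<bar>y - x\<bar> < d \<longrightarrow>
        (x \<notin> N \<longrightarrow> norm (F y - F x - (y - x) *\<^sub>R f' x) \<le> e / 2 * \<bar>y - x\<bar>) \<and>
        (x \<in> N \<longrightarrow> norm (F y - F x - (y - x) *\<^sub>R f' x) \<le> L * \<bar>y - x\<bar> \<and> y \<in> U)"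
      if x: "x \<in> {a..b}" for x
    proof (cases "x \<in> N")
      case True
      obtain d1 where d1: "d1 > 0" "\<And>y. y \<in> {a..b} \<Longrightarrow> \<bar>y - x\<bar> < d1 \<Longrightarrow> norm (F y - F x) \<le> L * \<bar>y - x\<bar>"
        using lip[OF x] by blast
      obtain d2 where d2: "d2 > 0" "\<And>y. dist y x < d2 \<Longrightarrow> y \<in> U"
        using U(1,2) True unfolding open_dist subset_eq by metis
      show ?thesis
        by (rule exI[of _ "min d1 d2"]) (use d1 d2 True in \<open>auto simp: f'_def dist_real_def\<close>)
    next
      case False
      then have "(F has_derivative (\<lambda>h. h *\<^sub>R f' x)) (at x within {a..b})"
        using der[of x] x by (simp add: f'_def has_vector_derivative_def)
      then show ?thesis
        unfolding has_derivative_within_alt using e False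
        by (metis half_gt_zero real_norm_def)
    qed
    then obtain d where d: "\<And>x. x \<in> {a..b} \<Longrightarrow> d x > 0"
      and dN: "\<And>x y. x \<in> {a..b} \<Longrightarrow> y \<in> {a..b} \<Longrightarrow> \<bar>y - x\<bar> < d x \<Longrightarrow> x \<notin> N \<Longrightarrow>
        norm (F y - F x - (y - x) *\<^sub>R f' x) \<le> e / 2 * \<bar>y - x\<bar>"
      and dU: "\<And>x y. x \<in> {a..b} \<Longrightarrow> y \<in> {a..b} \<Longrightarrow> \<bar>y - x\<bar> < d x \<Longrightarrow> x \<in> N \<Longrightarrow>
        norm (F y - F x - (y - x) *\<^sub>R f' x) \<le> L * \<bar>y - x\<bar> \<and> y \<in> U"
      by metis
    define d' where "d' x = (if x \<in> {a..b} then d x else 1)" for x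
    show "\<exists>d. gauge d \<and> (\<forall>p. p tagged_division_of {a..b} \<and> d fine p \<longrightarrow>
        norm ((\<Sum>(x, k)\<in>p. measure lborel k *\<^sub>R f' x) - (F b - F a)) \<le> e * measure lborel {a..b})"
    proof (intro exI[of _ "\<lambda>x. ball x (d' x)"] conjI allI impI)
      show "gauge (\<lambda>x. ball x (d' x))" by (intro gauge_ball_dependent) (auto simp: d'_def d)
      fix p assume p: "p tagged_division_of {a..b} \<and> (\<lambda>x. ball x (d' x)) fine p"
      then have tag: "p tagged_division_of {a..b}" by simp
      let ?B = "\<lambda>k. e / 2 * (Sup k - Inf k) + L * (u (Sup k) - u (Inf k))"
      have "(\<Sum>(x, k)\<in>p. measure lborel k *\<^sub>R f' x) - (F b - F a)
          = (\<Sum>(x, k)\<in>p. measure lborel k *\<^sub>R f' x - (F (Sup k) - F (Inf k)))"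
        using additive_tagged_division_1[OF ab tag, of F] by (simp add: sum_subtractf case_prod_unfold)
      also have "norm \<dots> \<le> (\<Sum>(x, k)\<in>p. ?B k)"
      proof (rule sum_norm_le, clarify)
        fix x k assume pk: "(x, k) \<in> p"
        obtain s t where st: "k = cbox s t" "x \<in> k" "k \<subseteq> {a..b}"
          using tagged_division_ofD(2,3,4)[OF tag pk] by blast
        then have st': "s \<le> x" "x \<le> t" "a \<le> s" "t \<le> b" by auto
        then have IS: "Inf k = s" "Sup k = t" "measure lborel k = t - s" using st by auto
        have xab: "x \<in> {a..b}" using st' by auto
        have near: "\<bar>y - x\<bar> < d x" if "y \<in> {s..t}" for y
        proof -
          have "k \<subseteq> ball x (d' x)" using p pk by (auto simp: fine_def)
          moreover have "y \<in> k" using that st(1) by auto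
          ultimately have "y \<in> ball x (d' x)" by blast
          then show ?thesis using xab by (simp add: d'_def dist_real_def abs_minus_commute)
        qed
        have tri: "norm (measure lborel k *\<^sub>R f' x - (F (Sup k) - F (Inf k)))
            \<le> norm (F t - F x - (t - x) *\<^sub>R f' x) + norm (F s - F x - (s - x) *\<^sub>R f' x)"
        proof -
          have "measure lborel k *\<^sub>R f' x - (F (Sup k) - F (Inf k))
              = (F s - F x - (s - x) *\<^sub>R f' x) - (F t - F x - (t - x) *\<^sub>R f' x)"
            unfolding IS by (simp add: algebra_simps)
          then show ?thesis using norm_triangle_ineq4 by (metis add.commute)
        qed
        show "norm (measure lborel k *\<^sub>R f' x - (F (Sup k) - F (Inf k))) \<le> ?B k"
        proof (cases "x \<in> N")
          case True
          have "{s..t} \<subseteq> U"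
          proof
            fix y assume y: "y \<in> {s..t}"
            then have "y \<in> {a..b}" using st' by auto
            then show "y \<in> U" using dU[OF xab _ near[OF y] True] by simp
          qed
          then have "u t - u s = t - s" using st' by (intro u_jump) auto
          moreover have "norm (F t - F x - (t - x) *\<^sub>R f' x) \<le> L * \<bar>t - x\<bar>"
            and "norm (F s - F x - (s - x) *\<^sub>R f' x) \<le> L * \<bar>s - x\<bar>"
            using dU[OF xab _ near[of t] True] dU[OF xab _ near[of s] True] st' by auto
          moreover have "L * \<bar>t - x\<bar> + L * \<bar>s - x\<bar> = L * (t - s)"
            using st' by (simp add: algebra_simps)
          moreover have "0 \<le> e / 2 * (t - s)" using e st' by simp
          ultimately show ?thesis using tri unfolding IS by simp
        next
          case False
          have "norm (F t - F x - (t - x) *\<^sub>R f' x) \<le> e / 2 * \<bar>t - x\<bar>"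
            and "norm (F s - F x - (s - x) *\<^sub>R f' x) \<le> e / 2 * \<bar>s - x\<bar>"
            using dN[OF xab _ near[of t] False] dN[OF xab _ near[of s] False] st' by auto
          moreover have "e / 2 * \<bar>t - x\<bar> + e / 2 * \<bar>s - x\<bar> = e / 2 * (t - s)"
            by (subst distrib_left[symmetric]) (use st' in simp)
          moreover have "0 \<le> L * (u t - u s)" using L u_mono[of s t] st' by simp
          ultimately show ?thesis using tri unfolding IS by linarith
        qed
      qed
      also have "\<dots> = e / 2 * (b - a) + L * (u b - u a)"
        using additive_tagged_division_1[OF ab tag, of "\<lambda>t. t"] additive_tagged_division_1[OF ab tag, of u]
        by (simp only: case_prod_unfold sum.distrib sum_distrib_left[symmetric])
      also have "\<dots> \<le> e / 2 * (b - a) + L * \<epsilon>"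
      proof -
        have "u b \<le> measure lebesgue U"
          unfolding u_def by (intro measure_mono_fmeasurable Um fmeasurableD Ut) auto
        moreover have "u a \<ge> 0" by (simp add: u_def)
        ultimately have "u b - u a \<le> \<epsilon>" using U\<epsilon> by linarith
        then show ?thesis using L by (intro add_left_mono mult_left_mono) auto
      qed
      also have "L * \<epsilon> \<le> e / 2 * (b - a)"
      proof -
        have "L * \<epsilon> = (e / 2 * (b - a)) * (L / (L + 1))" by (simp add: \<epsilon>_def)
        also have "\<dots> \<le> (e / 2 * (b - a)) * 1" using e ab L by (intro mult_left_mono) auto
        finally show ?thesis by simp
      qed
      finally show "norm ((\<Sum>(x, k)\<in>p. measure lborel k *\<^sub>R f' x) - (F b - F a)) \<le> e * measure lborel {a..b}"
        using ab by simp
    qed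
  qed
  moreover have "\<And>x. x \<in> {a..b} - N \<Longrightarrow> f x = f' x" by (simp add: f'_def)
  ultimately show ?thesis by (rule has_integral_spike[OF N, rotated])
qed

lemma arc_length_param_null:
  assumes "arc_length_param I \<gamma>"
  obtains N where "negligible N"
    "\<And>t. t \<in> I - N \<Longrightarrow> (\<gamma> has_vector_derivative vector_derivative \<gamma> (at t)) (at t)"
    "\<And>t. t \<in> I - N \<Longrightarrow> cmod (vector_derivative \<gamma> (at t)) = 1"
proof -
  have "AE t in lborel. t \<in> I \<longrightarrow> (\<exists>v. cmod v = 1 \<and> (\<gamma> has_vector_derivative v) (at t))"
    using assms by (simp add: arc_length_param_def)
  then obtain N where N: "N \<in> null_sets lborel"
    "{t. \<not> (t \<in> I \<longrightarrow> (\<exists>v. cmod v = 1 \<and> (\<gamma> has_vector_derivative v) (at t)))} \<subseteq> N"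
    by (auto simp: eventually_ae_filter)
  have "negligible N" using N(1) by (simp add: negligible_iff_null_sets null_sets_completionI)
  moreover have "(\<gamma> has_vector_derivative vector_derivative \<gamma> (at t)) (at t) \<and> cmod (vector_derivative \<gamma> (at t)) = 1"
    if t: "t \<in> I - N" for t
  proof -
    obtain v where v: "cmod v = 1" "(\<gamma> has_vector_derivative v) (at t)" using N(2) t by blast
    then show ?thesis using vector_derivative_at[OF v(2)] by simp
  qed
  ultimately show ?thesis using that by blast
qed

lemma arc_length_param_continuous:
  assumes "arc_length_param I \<gamma>"
  shows "continuous_on I \<gamma>"
  unfolding continuous_on_iff
proof (intro ballI allI impI)
  fix x and e :: real assume "x \<in> I" "e > 0"
  then show "\<exists>d>0. \<forall>x'\<in>I. dist x' x < d \<longrightarrow> dist (\<gamma> x') (\<gamma> x) < e"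
    using assms by (intro exI[of _ e]) (force simp: arc_length_param_def dist_norm)
qed

text \<open>\<open>G \<circ> \<gamma>\<close> satisfies a local Lipschitz bound and has the derivative \<open>\<gamma>' g(\<gamma>)\<close> almost everywhere.\<close>

lemma arc_length_param_integral:
  assumes \<gamma>: "arc_length_param I \<gamma>" and pq: "p \<le> q" "{p..q} \<subseteq> I"
    and D: "\<gamma> ` {p..q} \<subseteq> D" and g: "continuous_on D g"
    and G: "\<And>z. z \<in> D \<Longrightarrow> (G has_field_derivative g z) (at z)"
  shows "((\<lambda>t. vector_derivative \<gamma> (at t) * g (\<gamma> t)) has_integral G (\<gamma> q) - G (\<gamma> p)) {p..q}"
proof -
  obtain N where N: "negligible N"
    "\<And>t. t \<in> I - N \<Longrightarrow> (\<gamma> has_vector_derivative vector_derivative \<gamma> (at t)) (at t)"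
    using arc_length_param_null[OF \<gamma>] by metis
  have cont: "continuous_on {p..q} \<gamma>"
    by (rule continuous_on_subset[OF arc_length_param_continuous[OF \<gamma>] pq(2)])
  have "compact ((g \<circ> \<gamma>) ` {p..q})"
    by (intro compact_continuous_image continuous_on_compose cont continuous_on_subset[OF g D]) simp
  then obtain M where M: "M > 0" "\<And>t. t \<in> {p..q} \<Longrightarrow> cmod (g (\<gamma> t)) \<le> M"
    using compact_imp_bounded bounded_pos by (metis comp_apply imageI)
  show ?thesis
  proof (rule fundamental_theorem_of_calculus_ae[OF pq(1) N(1), of "M + 1" "\<lambda>t. G (\<gamma> t)"])
    show "M + 1 \<ge> 0" using M by simp
    fix t assume t: "t \<in> {p..q}"
    have "(G has_derivative (*) (g (\<gamma> t))) (at (\<gamma> t))"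
      using G[of "\<gamma> t"] D t by (auto simp: has_field_derivative_def image_subset_iff)
    then obtain d where d: "d > 0"
      "\<And>z. norm (z - \<gamma> t) < d \<Longrightarrow> norm (G z - G (\<gamma> t) - g (\<gamma> t) * (z - \<gamma> t)) \<le> 1 * norm (z - \<gamma> t)"
      unfolding has_derivative_at_alt by (metis zero_less_one)
    have lipd: "norm (G (\<gamma> s) - G (\<gamma> t)) \<le> (M + 1) * \<bar>s - t\<bar>" if s: "s \<in> {p..q}" "\<bar>s - t\<bar> < d" for s
    proof -
      have dist: "norm (\<gamma> s - \<gamma> t) \<le> \<bar>s - t\<bar>"
        using \<gamma> pq s t by (auto simp: arc_length_param_def subset_eq)
      then have "norm (G (\<gamma> s) - G (\<gamma> t) - g (\<gamma> t) * (\<gamma> s - \<gamma> t)) \<le> 1 * norm (\<gamma> s - \<gamma> t)"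
        using s by (intro d) auto
      then have "norm (G (\<gamma> s) - G (\<gamma> t)) \<le> norm (g (\<gamma> t) * (\<gamma> s - \<gamma> t)) + norm (\<gamma> s - \<gamma> t)"
        using norm_triangle_ineq2[of "G (\<gamma> s) - G (\<gamma> t)" "g (\<gamma> t) * (\<gamma> s - \<gamma> t)"] by simp
      also have "\<dots> \<le> M * norm (\<gamma> s - \<gamma> t) + norm (\<gamma> s - \<gamma> t)"
        unfolding norm_mult by (intro add_right_mono mult_right_mono M t) simp
      also have "\<dots> = (M + 1) * norm (\<gamma> s - \<gamma> t)" by (simp add: algebra_simps)
      also have "\<dots> \<le> (M + 1) * \<bar>s - t\<bar>" using M by (intro mult_left_mono dist) simp
      finally show ?thesis .
    qed
    show "\<exists>d>0. \<forall>s\<in>{p..q}. \<bar>s - t\<bar> < d \<longrightarrow> norm (G (\<gamma> s) - G (\<gamma> t)) \<le> (M + 1) * \<bar>s - t\<bar>"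
    proof (rule exI[of _ d], rule conjI)
      show "d > 0" by (rule d(1))
      show "\<forall>s\<in>{p..q}. \<bar>s - t\<bar> < d \<longrightarrow> norm (G (\<gamma> s) - G (\<gamma> t)) \<le> (M + 1) * \<bar>s - t\<bar>"
        using lipd by blast
    qed
  next
    fix t assume t: "t \<in> {p..q} - N"
    then have 1: "(\<gamma> has_vector_derivative vector_derivative \<gamma> (at t)) (at t within {p..q})"
      using N(2)[of t] subsetD[OF pq(2), of t] by (auto intro: has_vector_derivative_at_within)
    have 2: "(G has_field_derivative g (\<gamma> t)) (at (\<gamma> t) within \<gamma> ` {p..q})"
      by (rule has_field_derivative_at_within, rule G) (use D t in auto)
    from field_vector_diff_chain_within[OF 1 2]
    show "((\<lambda>t. G (\<gamma> t)) has_vector_derivative vector_derivative \<gamma> (at t) * g (\<gamma> t)) (at t within {p..q})"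
      by (simp add: o_def)
  qed
qed

section \<open>The region swept by a deformation\<close>

text \<open>
  Apply Brouwer's theorem to the map \<open>(x, y) \<mapsto> (x - f(x, y), y - g(x, y))\<close> followed by the retraction onto
  the square: at a fixed point a non-zero value of \<open>f\<close> or \<open>g\<close> would have the wrong sign on the side it pushes to.
\<close>

lemma Poincare_Miranda:
  fixes f g :: "real \<times> real \<Rightarrow> real"
  assumes f: "continuous_on ({0..1} \<times> {0..1}) f" and g: "continuous_on ({0..1} \<times> {0..1}) g"
    and f0: "\<And>y. y \<in> {0..1} \<Longrightarrow> f (0, y) \<le> 0" and f1: "\<And>y. y \<in> {0..1} \<Longrightarrow> f (1, y) \<ge> 0"
    and g0: "\<And>x. x \<in> {0..1} \<Longrightarrow> g (x, 0) \<le> 0" and g1: "\<And>x. x \<in> {0..1} \<Longrightarrow> g (x, 1) \<ge> 0"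
  obtains x y where "x \<in> {0..1}" "y \<in> {0..1}" "f (x, y) = 0" "g (x, y) = 0"
proof -
  let ?S = "{0..1} \<times> {0..1} :: (real \<times> real) set"
  define c :: "real \<Rightarrow> real" where "c t = max 0 (min 1 t)" for t
  define F where "F p = (c (fst p - f p), c (snd p - g p))" for p
  have contF: "continuous_on ?S F"
    unfolding F_def c_def by (intro continuous_intros f g)
  have FS: "F \<in> ?S \<rightarrow> ?S" by (auto simp: F_def c_def)
  have S: "compact ?S" "convex ?S" "?S \<noteq> {}"
    by (auto intro: compact_Times convex_Times)
  obtain p where p: "p \<in> ?S" "F p = p" by (rule brouwer[OF S contF FS])
  obtain x y where xy: "p = (x, y)" by fastforce
  have x: "x \<in> {0..1}" and y: "y \<in> {0..1}" using p(1) xy by auto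
  have ex: "c (x - f (x, y)) = x" and ey: "c (y - g (x, y)) = y"
    using p(2) xy by (auto simp: F_def)
  have "f (x, y) = 0"
  proof (rule ccontr)
    assume "f (x, y) \<noteq> 0"
    then consider "f (x, y) > 0" | "f (x, y) < 0" by linarith
    then show False
    proof cases
      case 1
      then have "x = 0" using ex x by (auto simp: c_def max_def min_def split: if_splits)
      with f0[OF y] 1 show False by simp
    next
      case 2
      then have "x = 1" using ex x by (auto simp: c_def max_def min_def split: if_splits)
      with f1[OF y] 2 show False by simp
    qed
  qed
  moreover have "g (x, y) = 0"
  proof (rule ccontr)
    assume "g (x, y) \<noteq> 0"
    then consider "g (x, y) > 0" | "g (x, y) < 0" by linarith
    then show False
    proof cases
      case 1
      then have "y = 0" using ey y by (auto simp: c_def max_def min_def split: if_splits)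
      with g0[OF x] 1 show False by simp
    next
      case 2
      then have "y = 1" using ey y by (auto simp: c_def max_def min_def split: if_splits)
      with g1[OF x] 2 show False by simp
    qed
  qed
  ultimately show ?thesis using that x y by blast
qed

text \<open>
  For \<open>\<tau>, \<sigma> = \<plusminus>1\<close> the angle is measured from the direction of \<open>\<tau>\<close>, so that at either end of the interval
  the half circle starts on the interval, and \<open>\<sigma>\<close> is the sign of the half-plane that contains it.
\<close>

definition half_circle :: "real \<Rightarrow> real \<Rightarrow> real \<Rightarrow> real \<Rightarrow> real \<Rightarrow> complex" where
  "half_circle m r \<tau> \<sigma> \<theta> = Complex (m + \<tau> * (r * cos \<theta>)) (\<sigma> * (r * sin \<theta>))"

lemma Re_half_circle [simp]: "Re (half_circle m r \<tau> \<sigma> \<theta>) = m + \<tau> * (r * cos \<theta>)"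
  and Im_half_circle [simp]: "Im (half_circle m r \<tau> \<sigma> \<theta>) = \<sigma> * (r * sin \<theta>)"
  by (simp_all add: half_circle_def)

lemma continuous_half_circle: "continuous_on S (half_circle m r \<tau> \<sigma>)"
  unfolding half_circle_def Complex_eq by (intro continuous_intros)

lemma norm_half_circle:
  assumes "\<bar>\<tau>\<bar> = 1" "\<bar>\<sigma>\<bar> = 1" "r > 0"
  shows "cmod (half_circle m r \<tau> \<sigma> \<theta> - complex_of_real m) = r"
proof -
  have "\<tau>\<^sup>2 = 1" "\<sigma>\<^sup>2 = 1" using assms(1,2) by (metis power2_abs one_power2)+
  then have "(\<tau> * (r * cos \<theta>))\<^sup>2 + (\<sigma> * (r * sin \<theta>))\<^sup>2 = r\<^sup>2 * ((cos \<theta>)\<^sup>2 + (sin \<theta>)\<^sup>2)"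
    by (simp only: power_mult_distrib distrib_left mult_1)
  then have "(\<tau> * (r * cos \<theta>))\<^sup>2 + (\<sigma> * (r * sin \<theta>))\<^sup>2 = r\<^sup>2" by (simp add: add.commute)
  then show ?thesis using assms by (simp add: cmod_def)
qed

lemma on_half_circle:
  assumes \<tau>: "\<bar>\<tau>\<bar> = 1" and \<sigma>: "\<bar>\<sigma>\<bar> = 1" and r: "r > 0"
    and z: "cmod (z - complex_of_real m) = r" "\<sigma> * Im z \<ge> 0"
  shows "\<exists>\<theta>\<in>{0..pi}. z = half_circle m r \<tau> \<sigma> \<theta>"
proof -
  define u where "u = \<tau> * (Re z - m) / r"
  have sq: "\<tau>\<^sup>2 = 1" "\<sigma>\<^sup>2 = 1" using \<tau> \<sigma> by (metis power2_abs one_power2)+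
  have circ: "(Re z - m)\<^sup>2 + (Im z)\<^sup>2 = r\<^sup>2"
    using cmod_power2[of "z - complex_of_real m"] z(1) by simp
  have "r * u = \<tau> * (Re z - m)" using r by (simp add: u_def)
  then have "(r * u)\<^sup>2 = (Re z - m)\<^sup>2" by (simp add: power_mult_distrib sq)
  then have ru: "(r * u)\<^sup>2 + (Im z)\<^sup>2 = r\<^sup>2" using circ by linarith
  then have "(r * u)\<^sup>2 \<le> r\<^sup>2" using zero_le_power2[of "Im z"] by linarith
  then have "\<bar>r * u\<bar> \<le> \<bar>r\<bar>" by (simp add: abs_le_square_iff)
  then have u: "- 1 \<le> u" "u \<le> 1" using r by (auto simp: abs_mult abs_le_iff)
  define \<theta> where "\<theta> = arccos u"
  have cos: "cos \<theta> = u" using u by (simp add: \<theta>_def cos_arccos)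
  have \<theta>: "\<theta> \<in> {0..pi}" using u by (simp add: \<theta>_def arccos_lbound arccos_ubound)
  have "sin \<theta> \<ge> 0" using \<theta> by (simp add: sin_ge_zero)
  have "(r * sin \<theta>)\<^sup>2 + (r * cos \<theta>)\<^sup>2 = r\<^sup>2 * ((sin \<theta>)\<^sup>2 + (cos \<theta>)\<^sup>2)"
    by (simp only: power_mult_distrib distrib_left)
  then have "(r * sin \<theta>)\<^sup>2 = (Im z)\<^sup>2" using ru unfolding cos[symmetric] by simp
  also have "\<dots> = (\<sigma> * Im z)\<^sup>2" by (simp add: power_mult_distrib sq)
  finally have "r * sin \<theta> = \<sigma> * Im z"
    using \<open>sin \<theta> \<ge> 0\<close> r z(2) by (simp add: power2_eq_iff_nonneg)
  then have "\<sigma> * (r * sin \<theta>) = Im z" using sq by (simp add: power2_eq_square mult.assoc[symmetric])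
  moreover have "m + \<tau> * (r * cos \<theta>) = Re z"
    using r sq by (simp add: cos u_def power2_eq_square mult.assoc[symmetric])
  ultimately have "z = half_circle m r \<tau> \<sigma> \<theta>" by (simp add: complex_eq_iff)
  then show ?thesis using \<theta> by blast
qed

lemma half_circle_inj:
  assumes "\<bar>\<tau>\<bar> = 1" "r > 0" "\<theta> \<in> {0..pi}" "\<theta>' \<in> {0..pi}"
    "half_circle m r \<tau> \<sigma> \<theta> = half_circle m r \<tau> \<sigma> \<theta>'"
  shows "\<theta> = \<theta>'"
proof -
  have "cos \<theta> = cos \<theta>'" using assms(1,2,5) by (auto simp: complex_eq_iff)
  then show ?thesis using assms(3,4) cos_inj_pi by auto
qed

text \<open>
  The map \<open>h\<close> deforms a piece of the real axis, at \<open>p = 0\<close>, into a curve, at \<open>p = 1\<close>.  Apply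
  Poincare--Miranda to \<open>\<bar>h - m\<bar> - r\<close> and to the difference of the distances of \<open>h\<close> from two closed sets:
  the piece of the real axis together with the half circle up to \<open>\<theta>\<^sub>0\<close>, and the curve together with the half
  circle from \<open>\<theta>\<^sub>0\<close> on.  On the half circle these sets have only the point at \<open>\<theta>\<^sub>0\<close> in common.
\<close>

lemma arc_in_image:
  fixes h :: "real \<times> real \<Rightarrow> complex"
  assumes h: "continuous_on ({0..1} \<times> {0..1}) h"
    and \<tau>: "\<bar>\<tau>\<bar> = 1" and \<sigma>: "\<bar>\<sigma>\<bar> = 1" and r: "r > 0"
    and bottom: "\<And>q. q \<in> {0..1} \<Longrightarrow> Im (h (0, q)) = 0 \<and> \<tau> * (Re (h (0, q)) - m) > 0"
    and above: "\<And>p q. p \<in> {0..1} \<Longrightarrow> q \<in> {0..1} \<Longrightarrow> \<sigma> * Im (h (p, q)) \<ge> 0"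
    and inside: "\<And>p. p \<in> {0..1} \<Longrightarrow> cmod (h (p, 0) - complex_of_real m) \<le> r"
    and outside: "\<And>p. p \<in> {0..1} \<Longrightarrow> cmod (h (p, 1) - complex_of_real m) \<ge> r"
    and \<theta>0: "\<theta>0 \<in> {0<..pi}"
    and miss: "\<And>\<theta> q. \<theta> \<in> {0..\<theta>0} \<Longrightarrow> q \<in> {0..1} \<Longrightarrow> half_circle m r \<tau> \<sigma> \<theta> \<noteq> h (1, q)"
  shows "\<exists>p\<in>{0..1}. \<exists>q\<in>{0..1}. h (p, q) = half_circle m r \<tau> \<sigma> \<theta>0"
proof -
  let ?w = "half_circle m r \<tau> \<sigma>"
  define S0 where "S0 = (\<lambda>q. h (0, q)) ` {0..1} \<union> ?w ` {0..\<theta>0}"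
  define S1 where "S1 = (\<lambda>q. h (1, q)) ` {0..1} \<union> ?w ` {\<theta>0..pi}"
  have side: "compact ((\<lambda>q. h (c, q)) ` {0..1})" if "c \<in> {0..1}" for c
  proof (rule compact_continuous_image)
    show "continuous_on {0..1} (\<lambda>q. h (c, q))"
      by (rule continuous_on_compose2[OF h]) (use that in \<open>auto intro!: continuous_intros\<close>)
  qed simp
  have comp: "compact S0" "compact S1"
    unfolding S0_def S1_def
    by (intro compact_Un side compact_continuous_image continuous_half_circle; simp)+
  have ne: "S0 \<noteq> {}" "S1 \<noteq> {}" using \<theta>0 by (auto simp: S0_def S1_def)
  define f where "f p = infdist (h p) S0 - infdist (h p) S1" for p
  define g where "g p = cmod (h p - complex_of_real m) - r" for p
  obtain p q where pq: "p \<in> {0..1}" "q \<in> {0..1}" "f (p, q) = 0" "g (p, q) = 0"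
  proof (rule Poincare_Miranda[of f g])
    show "continuous_on ({0..1} \<times> {0..1}) f" "continuous_on ({0..1} \<times> {0..1}) g"
      unfolding f_def g_def by (intro continuous_intros h)+
    show "f (0, y) \<le> 0" if "y \<in> {0..1}" for y
    proof -
      have "h (0, y) \<in> S0" using that by (simp add: S0_def)
      then show ?thesis by (simp add: f_def infdist_nonneg)
    qed
    show "f (1, y) \<ge> 0" if "y \<in> {0..1}" for y
    proof -
      have "h (1, y) \<in> S1" using that by (simp add: S1_def)
      then show ?thesis by (simp add: f_def infdist_nonneg)
    qed
  qed (use inside outside in \<open>auto simp: g_def\<close>)
  define z where "z = h (p, q)"
  have "cmod (z - complex_of_real m) = r" "\<sigma> * Im z \<ge> 0"
    using pq above[of p q] by (simp_all add: g_def z_def)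
  then obtain \<theta> where \<theta>: "\<theta> \<in> {0..pi}" "z = ?w \<theta>" using on_half_circle[OF \<tau> \<sigma> r] by blast
  have inj: "?w \<alpha> = ?w \<beta> \<Longrightarrow> \<alpha> = \<beta>" if "\<alpha> \<in> {0..pi}" "\<beta> \<in> {0..pi}" for \<alpha> \<beta>
    using half_circle_inj[OF \<tau> r that] by blast
  have eq: "infdist z S0 = infdist z S1" using pq(3) by (simp add: f_def z_def)
  have mem: "z \<in> S \<longleftrightarrow> infdist z S = 0" if "S = S0 \<or> S = S1" for S
    using that comp ne by (metis compact_imp_closed in_closed_iff_infdist_zero)
  have "\<theta> = \<theta>0"
  proof (rule ccontr)
    assume "\<theta> \<noteq> \<theta>0"
    then consider "\<theta> < \<theta>0" | "\<theta> > \<theta>0" by linarith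
    then show False
    proof cases
      case 1
      then have "z \<in> S0" using \<theta> by (auto simp: S0_def)
      then have "z \<in> S1" using mem eq by simp
      then consider q where "q \<in> {0..1}" "?w \<theta> = h (1, q)" | \<theta>' where "\<theta>' \<in> {\<theta>0..pi}" "?w \<theta> = ?w \<theta>'"
        using \<theta>(2) by (auto simp: S1_def)
      then show False
      proof cases
        case (1 q)
        then show False using miss[of \<theta> q] \<theta>(1) \<open>\<theta> < \<theta>0\<close> by auto
      next
        case (2 \<theta>')
        then show False using inj[of \<theta> \<theta>'] \<theta>(1) \<theta>0 \<open>\<theta> < \<theta>0\<close> by auto
      qed
    next
      case 2
      then have "z \<in> S1" using \<theta> by (auto simp: S1_def)
      then have "z \<in> S0" using mem eq by simp
      then consider q where "q \<in> {0..1}" "?w \<theta> = h (0, q)" | \<theta>' where "\<theta>' \<in> {0..\<theta>0}" "?w \<theta> = ?w \<theta>'"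
        using \<theta>(2) by (auto simp: S0_def)
      then show False
      proof cases
        case (1 q)
        have b: "Im (?w \<theta>) = 0" "\<tau> * (Re (?w \<theta>) - m) > 0" using bottom[OF 1(1)] 1(2) by simp_all
        have "sin \<theta> = 0" using b(1) \<sigma> r by auto
        then have "\<theta> = pi" using \<theta>(1) \<theta>0 \<open>\<theta>0 < \<theta>\<close> sin_gt_zero[of \<theta>] by force
        moreover have "\<tau> * \<tau> = 1" using \<tau> by (metis abs_mult_self_eq mult_1)
        ultimately have "\<tau> * (Re (?w \<theta>) - m) = - r" by (simp add: mult.assoc[symmetric])
        with b(2) r show False by simp
      next
        case (2 \<theta>')
        then show False using inj[of \<theta> \<theta>'] \<theta>(1) \<theta>0 \<open>\<theta>0 < \<theta>\<close> by auto
      qed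
    qed
  qed
  then show ?thesis using pq(1,2) \<theta>(2) unfolding z_def by blast
qed

text \<open>
  Let \<open>\<theta>\<close> be the first angle at which the half circle meets the curve.  There is one, since otherwise the
  preceding lemma with \<open>\<theta>\<^sub>0 = \<pi>\<close> would make \<open>m - \<tau> r\<close> a value of \<open>h\<close>; and for smaller angles that lemma
  places the half circle inside \<open>D\<close>.
\<close>

lemma crosscut:
  fixes h :: "real \<times> real \<Rightarrow> complex"
  assumes h: "continuous_on ({0..1} \<times> {0..1}) h"
    and \<tau>: "\<bar>\<tau>\<bar> = 1" and \<sigma>: "\<bar>\<sigma>\<bar> = 1" and r: "r > 0"
    and bottom: "\<And>q. q \<in> {0..1} \<Longrightarrow> Im (h (0, q)) = 0 \<and> \<tau> * (Re (h (0, q)) - m) > 0"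
    and hD: "\<And>p q. p \<in> {0<..1} \<Longrightarrow> q \<in> {0..1} \<Longrightarrow> h (p, q) \<in> D"
    and D: "\<And>z. z \<in> D \<Longrightarrow> \<sigma> * Im z > 0"
    and inside: "\<And>p. p \<in> {0..1} \<Longrightarrow> cmod (h (p, 0) - complex_of_real m) \<le> r"
    and outside: "\<And>p. p \<in> {0..1} \<Longrightarrow> cmod (h (p, 1) - complex_of_real m) \<ge> r"
  obtains \<theta> q where "\<theta> \<in> {0<..<pi}" "q \<in> {0..1}" "half_circle m r \<tau> \<sigma> \<theta> = h (1, q)"
    "half_circle m r \<tau> \<sigma> ` {0<..\<theta>} \<subseteq> D"
proof -
  let ?w = "half_circle m r \<tau> \<sigma>"
  have above: "\<sigma> * Im (h (p, q)) \<ge> 0" if "p \<in> {0..1}" "q \<in> {0..1}" for p q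
    using bottom[of q] D[OF hD[of p q]] that by (cases "p = 0") auto
  note image = arc_in_image[OF h \<tau> \<sigma> r bottom above inside outside]
  have off_axis: "p \<noteq> 0 \<and> h (p, q) \<in> D"
    if "h (p, q) = ?w \<theta>" "\<theta> \<in> {0<..<pi}" "p \<in> {0..1}" "q \<in> {0..1}" for p q \<theta>
  proof -
    have "Im (?w \<theta>) \<noteq> 0" using \<sigma> r sin_gt_zero[of \<theta>] that(2) by auto
    then have "p \<noteq> 0" using bottom[OF that(4)] that(1) by metis
    then show ?thesis using hD[of p q] that(3,4) by simp
  qed
  let ?\<Gamma> = "(\<lambda>q. h (1, q)) ` {0..1}"
  define T where "T = {\<theta> \<in> {0..pi}. ?w \<theta> \<in> ?\<Gamma>}"
  have "compact ?\<Gamma>"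
  proof (rule compact_continuous_image)
    show "continuous_on {0..1} (\<lambda>q. h (1, q))"
      by (rule continuous_on_compose2[OF h]) (auto intro!: continuous_intros)
  qed simp
  then have "closed ({0..pi} \<inter> ?w -` ?\<Gamma>)"
    by (intro continuous_closed_preimage continuous_half_circle compact_imp_closed) auto
  then have "compact ({0..pi} \<inter> ({0..pi} \<inter> ?w -` ?\<Gamma>))" by (rule compact_Int_closed[OF compact_Icc])
  moreover have "{0..pi} \<inter> ({0..pi} \<inter> ?w -` ?\<Gamma>) = T" by (auto simp: T_def)
  ultimately have Tc: "compact T" by (simp only:)
  have "T \<noteq> {}"
  proof
    assume "T = {}"
    then obtain p q where pq: "p \<in> {0..1}" "q \<in> {0..1}" "h (p, q) = ?w pi"
      using image[of pi] by (force simp: T_def)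
    then have "Im (h (p, q)) = 0" by simp
    then have "p = 0" using D[OF hD[of p q]] pq by force
    then have "\<tau> * (Re (?w pi) - m) > 0" using bottom[OF pq(2)] pq(3) by simp
    moreover have "\<tau> * \<tau> = 1" using \<tau> by (metis abs_mult_self_eq mult_1)
    ultimately show False using r by (simp add: mult.assoc[symmetric])
  qed
  then obtain \<theta> where \<theta>: "\<theta> \<in> T" "\<And>\<theta>'. \<theta>' \<in> T \<Longrightarrow> \<theta> \<le> \<theta>'"
    using compact_attains_inf[OF Tc] by blast
  then obtain q where q: "q \<in> {0..1}" "?w \<theta> = h (1, q)" by (auto simp: T_def)
  have "h (1, q) \<in> D" using hD[of 1 q] q(1) by simp
  then have "\<sigma> * Im (?w \<theta>) > 0" using D q(2) by simp
  then have "sin \<theta> \<noteq> 0" by auto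
  then have "\<theta> \<noteq> 0" "\<theta> \<noteq> pi" by auto
  then have \<theta>': "\<theta> \<in> {0<..<pi}" using \<theta>(1) by (auto simp: T_def)
  have "?w \<alpha> \<in> D" if \<alpha>: "\<alpha> \<in> {0<..\<theta>}" for \<alpha>
  proof (cases "\<alpha> = \<theta>")
    case True
    then show ?thesis using q \<open>h (1, q) \<in> D\<close> by simp
  next
    case False
    have "?w \<beta> \<noteq> h (1, q)" if "\<beta> \<in> {0..\<alpha>}" "q \<in> {0..1}" for \<beta> q
    proof
      assume "?w \<beta> = h (1, q)"
      then have "\<beta> \<in> T" using that \<alpha> \<theta>' by (auto simp: T_def)
      then show False using \<theta>(2)[of \<beta>] that \<alpha> False by auto
    qed
    then obtain p q where pq: "p \<in> {0..1}" "q \<in> {0..1}" "h (p, q) = ?w \<alpha>"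
      using image[of \<alpha>] \<alpha> \<theta>' by force
    then show ?thesis using off_axis[OF pq(3) _ pq(1,2)] \<alpha> \<theta>' by auto
  qed
  then have "?w ` {0<..\<theta>} \<subseteq> D" by (rule image_subsetI)
  then show ?thesis by (rule that[OF \<theta>' q])
qed

section \<open>Following a deformation\<close>

lemma arc_length_param_integral_bound:
  assumes \<gamma>: "arc_length_param I \<gamma>" and pq: "p \<le> q" "{p..q} \<subseteq> I"
    and D: "\<gamma> ` {p..q} \<subseteq> D" and g: "continuous_on D g" and k: "continuous_on D k"
    and le: "\<And>z. z \<in> D \<Longrightarrow> cmod (g z) \<le> k z"
    and G: "\<And>z. z \<in> D \<Longrightarrow> (G has_field_derivative g z) (at z)"
  shows "cmod (G (\<gamma> q) - G (\<gamma> p)) \<le> integral {p..q} (\<lambda>t. k (\<gamma> t))"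
proof -
  obtain N where N: "negligible N" "\<And>t. t \<in> I - N \<Longrightarrow> cmod (vector_derivative \<gamma> (at t)) = 1"
    using arc_length_param_null[OF \<gamma>] by metis
  define f where "f t = (if t \<in> N then 0 else vector_derivative \<gamma> (at t) * g (\<gamma> t))" for t
  have f: "(f has_integral G (\<gamma> q) - G (\<gamma> p)) {p..q}"
    by (rule has_integral_spike[OF N(1) _ arc_length_param_integral[OF \<gamma> pq D g G]]) (simp_all add: f_def)
  have kD: "continuous_on {p..q} (\<lambda>t. k (\<gamma> t))"
    by (rule continuous_on_compose2[OF k continuous_on_subset[OF arc_length_param_continuous[OF \<gamma>] pq(2)] D])
  have bound: "norm (f t) \<le> k (\<gamma> t)" if "t \<in> {p..q}" for t
  proof -
    have D': "\<gamma> t \<in> D" and I: "t \<in> I" using D pq(2) that by auto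
    then have "0 \<le> k (\<gamma> t)" using le[OF D'] norm_ge_zero order_trans by blast
    then show ?thesis using N(2)[of t] le[OF D'] I by (simp add: f_def norm_mult)
  qed
  have "norm (integral {p..q} f) \<le> integral {p..q} (\<lambda>t. k (\<gamma> t))"
    by (rule integral_norm_bound_integral[OF has_integral_integrable[OF f]
          integrable_continuous_real[OF kD] bound])
  then show ?thesis using integral_unique[OF f] by simp
qed

lemma V0_integral_le:
  assumes c: "continuous_on {p..q} (\<lambda>t. K' (c t))" and sub: "{p..q} \<subseteq> I"
    and lt: "V0 K' I c < ennreal e" and e: "e > 0"
  shows "integral {p..q} (\<lambda>t. norm (K' (c t))) \<le> e"
proof -
  have int: "(\<lambda>t. norm (K' (c t))) integrable_on {p..q}"
    by (intro integrable_continuous_real continuous_on_norm c)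
  have "ennreal (integral {p..q} (\<lambda>t. norm (K' (c t)))) = (\<integral>\<^sup>+t\<in>{p..q}. ennreal (norm (K' (c t))) \<partial>lborel)"
    by (rule nn_integral_has_integral_lebesgue'[OF _ integrable_integral[OF int], symmetric]) simp
  also have "\<dots> \<le> V0 K' I c"
    unfolding V0_def using sub by (intro nn_integral_mono mult_left_mono) (auto split: split_indicator)
  finally have "ennreal (integral {p..q} (\<lambda>t. norm (K' (c t)))) \<le> ennreal e" using lt by order
  then show ?thesis using e by (simp add: ennreal_le_iff)
qed

text \<open>Parametrised by arc length, the arc up to the angle \<open>\<theta>\<close> has length \<open>r \<theta> \<le> \<pi> r\<close>.\<close>

lemma link_half_circle:
  fixes K' :: "complex \<Rightarrow> ('b::chilbert \<Rightarrow>\<^sub>L 'b)"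
  assumes \<tau>: "\<bar>\<tau>\<bar> = 1" and \<sigma>: "\<bar>\<sigma>\<bar> = 1" and r: "r > 0" and \<theta>: "\<theta> \<in> {0<..<pi}"
    and D: "half_circle m r \<tau> \<sigma> ` {0<..\<theta>} \<subseteq> D"
    and M: "\<And>z. z \<in> D \<Longrightarrow> cmod (z - complex_of_real m) = r \<Longrightarrow> norm (K' z) \<le> M"
    and M0: "M \<ge> 0" and e: "M * (r * pi) < e"
  shows "link D K' (complex_of_real (m + \<tau> * r)) (half_circle m r \<tau> \<sigma> \<theta>) e"
proof -
  let ?w = "half_circle m r \<tau> \<sigma>"
  define c where "c s = ?w (s / r)" for s
  define v where "v s = complex_of_real (- (\<tau> * sin (s / r))) + \<i> * complex_of_real (\<sigma> * cos (s / r))" for s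
  have c_eq: "c s = complex_of_real (m + \<tau> * (r * cos (s / r))) + \<i> * complex_of_real (\<sigma> * (r * sin (s / r)))" for s
    by (simp add: c_def half_circle_def Complex_eq)
  have c': "(c has_vector_derivative v s) (at s)" for s
  proof -
    have "((\<lambda>s. m + \<tau> * (r * cos (s / r))) has_real_derivative - (\<tau> * sin (s / r))) (at s)"
      using r by (auto intro!: derivative_eq_intros)
    moreover have "((\<lambda>s. \<sigma> * (r * sin (s / r))) has_real_derivative \<sigma> * cos (s / r)) (at s)"
      using r by (auto intro!: derivative_eq_intros)
    ultimately have "((\<lambda>s. complex_of_real (m + \<tau> * (r * cos (s / r))) + \<i> * complex_of_real (\<sigma> * (r * sin (s / r))))
        has_vector_derivative v s) (at s)"
      unfolding v_def
      by (intro has_vector_derivative_add has_vector_derivative_mult_right has_vector_derivative_of_real)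
    then show ?thesis by (simp add: c_eq[abs_def])
  qed
  have sq: "\<tau>\<^sup>2 = 1" "\<sigma>\<^sup>2 = 1" using \<tau> \<sigma> by (metis power2_abs one_power2)+
  have v: "cmod (v s) = 1" for s
    by (simp add: v_def cmod_def power_mult_distrib sq)
  have lip: "cmod (c s - c t) \<le> \<bar>s - t\<bar>" for s t
  proof -
    have "norm (c s - c t) \<le> 1 * norm (s - t)"
    proof (rule differentiable_bound[where S = UNIV])
      show "(c has_derivative (\<lambda>h. h *\<^sub>R v x)) (at x within UNIV)" for x
        using c'[of x] by (simp add: has_vector_derivative_def)
      show "onorm (\<lambda>h. h *\<^sub>R v x) \<le> 1" for x
        by (intro onorm_le) (simp add: v)
    qed auto
    then show ?thesis by simp
  qed
  define L where "L = r * \<theta>"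
  have L: "L > 0" using r \<theta> by (simp add: L_def)
  have arc: "arc_length_param {0..L} c"
    unfolding arc_length_param_def using lip c' v by blast
  have cD: "c s \<in> D" if "s \<in> {0<..L}" for s
  proof -
    have "s / r \<in> {0<..\<theta>}" using that r by (auto simp: L_def field_simps)
    then show ?thesis using D unfolding c_def by blast
  qed
  have "V0 K' {0..L} c \<le> (\<integral>\<^sup>+t. ennreal M * indicator {0..L} t \<partial>lborel)"
    unfolding V0_def
  proof (rule nn_integral_mono_AE)
    have "norm (K' (c t)) \<le> M" if "t \<noteq> 0" "t \<in> {0..L}" for t
      using that cD[of t] norm_half_circle[OF \<tau> \<sigma> r] by (intro M) (auto simp: c_def)
    then have "ennreal (norm (K' (c t))) * indicator {0..L} t \<le> ennreal M * indicator {0..L} t" if "t \<noteq> 0" for t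
      using that by (auto split: split_indicator intro!: ennreal_leI)
    then show "AE t in lborel. ennreal (norm (K' (c t))) * indicator {0..L} t \<le> ennreal M * indicator {0..L} t"
      using AE_lborel_singleton[of "0::real"] by (rule eventually_mono[rotated]) auto
  qed
  also have "\<dots> = ennreal (M * L)"
    using L M0 by (simp add: nn_integral_cmult_indicator ennreal_mult)
  also have "\<dots> < ennreal e"
  proof (rule ennreal_lessI)
    have "M * L \<le> M * (r * pi)" unfolding L_def using M0 r \<theta> by (intro mult_left_mono) auto
    then show "M * L < e" using e by linarith
    have "0 \<le> M * (r * pi)" using M0 r by simp
    then show "0 < e" using e by linarith
  qed
  finally have "V0 K' {0..L} c < ennreal e" .
  moreover have "c 0 = complex_of_real (m + \<tau> * r)" by (simp add: c_eq)
  moreover have "c L = ?w \<theta>" using r by (simp add: c_def L_def)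
  moreover have "c ` {0<..L} \<subseteq> D" using cD by (rule image_subsetI)
  ultimately show ?thesis unfolding link_def using L arc by blast
qed

text \<open>
  The sign \<open>\<sigma>\<close> covers the domains in both half-planes at once; \<open>\<phi>\<close> runs through the interval at time zero of
  the deformation.
\<close>

locale contour_deformation =
  fixes D :: "complex set" and m1 m2 a b :: ereal and \<gamma> :: "real \<Rightarrow> complex"
    and h :: "real \<times> real \<Rightarrow> complex" and \<phi> :: "real \<Rightarrow> real" and \<sigma> :: real
  assumes sign: "\<bar>\<sigma>\<bar> = 1" and side: "\<And>z. z \<in> D \<Longrightarrow> \<sigma> * Im z > 0" and open_D: "open D"
    and m1_less: "m1 < m2" and a_less: "a < b"
    and h_cont: "continuous_on ({0..1} \<times> einterval a b) h"
    and \<phi>_mono: "strict_mono_on (einterval a b) \<phi>"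
    and \<phi>_image: "\<phi> ` einterval a b = einterval m1 m2"
    and h0: "\<And>t. t \<in> einterval a b \<Longrightarrow> h (0, t) = complex_of_real (\<phi> t)"
    and h1: "\<And>t. t \<in> einterval a b \<Longrightarrow> h (1, t) = \<gamma> t"
    and hD: "\<And>s t. s \<in> {0<..1} \<Longrightarrow> t \<in> einterval a b \<Longrightarrow> h (s, t) \<in> D"
    and lower: "filterlim h (end_filter m1) (principal {0..1} \<times>\<^sub>F at_lower a)"
    and upper: "filterlim h (end_filter m2) (principal {0..1} \<times>\<^sub>F at_upper b)"
begin

lemma \<gamma>_D: "t \<in> einterval a b \<Longrightarrow> \<gamma> t \<in> D"
  using hD[of 1 t] h1[of t] by simp

lemma sign_sq: "\<sigma> * \<sigma> = 1"
  using sign by (metis abs_mult_self_eq mult_1)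

text \<open>
  A rescaled piece of \<open>h\<close> on the unit square.  The side \<open>q = 0\<close> belongs to \<open>t1\<close>, which may lie on either side of
  \<open>t2\<close>, so that one statement serves both ends.
\<close>

lemma h_square:
  assumes "t1 \<in> einterval a b" "t2 \<in> einterval a b" "s0 \<in> {0..1}"
  shows "continuous_on ({0..1} \<times> {0..1}) (\<lambda>p. h (s0 * fst p, t1 + snd p * (t2 - t1)))"
    and "q \<in> {0..1} \<Longrightarrow> t1 + q * (t2 - t1) \<in> einterval a b"
    and "q \<in> {0..1} \<Longrightarrow> min t1 t2 \<le> t1 + q * (t2 - t1) \<and> t1 + q * (t2 - t1) \<le> max t1 t2"
proof -
  have between: "min t1 t2 \<le> t1 + q * (t2 - t1) \<and> t1 + q * (t2 - t1) \<le> max t1 t2" if "q \<in> {0..1}" for q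
  proof (cases "t1 \<le> t2")
    case True
    then have "0 \<le> q * (t2 - t1)" "q * (t2 - t1) \<le> t2 - t1"
      using that by (auto intro!: mult_left_le_one_le)
    moreover have "min t1 t2 = t1" "max t1 t2 = t2" using True by auto
    ultimately show ?thesis by linarith
  next
    case False
    then have "0 \<le> q * (t1 - t2)" "q * (t1 - t2) \<le> t1 - t2"
      using that by (auto intro!: mult_left_le_one_le)
    moreover have "q * (t2 - t1) = - (q * (t1 - t2))" by (simp add: algebra_simps)
    moreover have "min t1 t2 = t2" "max t1 t2 = t1" using False by auto
    ultimately show ?thesis by linarith
  qed
  then show "min t1 t2 \<le> t1 + q * (t2 - t1) \<and> t1 + q * (t2 - t1) \<le> max t1 t2" if "q \<in> {0..1}"
    using that by blast
  have ein: "t1 + q * (t2 - t1) \<in> einterval a b" if "q \<in> {0..1}" for q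
  proof -
    have "min t1 t2 \<in> einterval a b" "max t1 t2 \<in> einterval a b"
      using assms(1,2) by (auto simp: min_def max_def)
    from einterval_subinterval[OF this] show ?thesis using between[OF that] by auto
  qed
  then show "t1 + q * (t2 - t1) \<in> einterval a b" if "q \<in> {0..1}" using that by blast
  have "s0 * p \<in> {0..1}" if "p \<in> {0..1}" for p
    using assms(3) that by (auto intro: mult_le_one)
  then show "continuous_on ({0..1} \<times> {0..1}) (\<lambda>p. h (s0 * fst p, t1 + snd p * (t2 - t1)))"
    using ein by (intro continuous_on_compose2[OF h_cont] continuous_intros) auto
qed

text \<open>
  Follow the deformation of a slightly larger interval for a short time \<open>s\<^sub>0\<close>, during which its ends stay to
  the left of \<open>\<alpha>\<close> and to the right of \<open>\<beta>\<close>.  At the time \<open>s\<^sub>0\<close> the whole interval has moved into the half-plane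
  by at least some \<open>\<eta> > 0\<close>, so that Poincare--Miranda for the real and imaginary parts of \<open>h\<close> finds every
  point in between among the values of \<open>h\<close>.
\<close>

lemma half_neighbourhood:
  assumes \<alpha>: "\<alpha> \<in> einterval m1 m2" and \<beta>: "\<beta> \<in> einterval m1 m2" and "\<alpha> \<le> \<beta>"
  shows "\<exists>\<eta>>0. \<forall>x\<in>{\<alpha>..\<beta>}. \<forall>y\<in>{0<..\<eta>}. Complex x (\<sigma> * y) \<in> D"
proof -
  obtain \<alpha>' where \<alpha>': "m1 < ereal \<alpha>'" "\<alpha>' < \<alpha>"
    using ereal_dense2[of m1 "ereal \<alpha>"] \<alpha> by (auto simp: einterval_def)
  obtain \<beta>' where \<beta>': "ereal \<beta>' < m2" "\<beta> < \<beta>'"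
    using ereal_dense2[of "ereal \<beta>" m2] \<beta> by (auto simp: einterval_def)
  have "ereal \<alpha>' < ereal \<alpha>" "ereal \<beta> < ereal \<beta>'" using \<alpha>' \<beta>' by auto
  then have "\<alpha>' \<in> einterval m1 m2" "\<beta>' \<in> einterval m1 m2"
    using \<alpha> \<beta> \<alpha>' \<beta>' less_trans[of "ereal \<alpha>'" "ereal \<alpha>" m2] less_trans[of m1 "ereal \<beta>" "ereal \<beta>'"]
    by (auto simp: einterval_def)
  then obtain t1 t2 where t: "t1 \<in> einterval a b" "\<phi> t1 = \<alpha>'" "t2 \<in> einterval a b" "\<phi> t2 = \<beta>'"
    using \<phi>_image by (metis imageE)
  have near: "\<exists>d>0. \<forall>s\<in>{0..1}. s < d \<longrightarrow> cmod (h (s, t) - h (0, t)) < \<epsilon>"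
    if te: "t \<in> einterval a b" "\<epsilon> > 0" for t \<epsilon>
  proof -
    have "continuous_on {0..1} (\<lambda>s. h (s, t))"
      by (rule continuous_on_compose2[OF h_cont]) (use te(1) in \<open>auto intro!: continuous_intros\<close>)
    then obtain d where "d > 0" "\<And>s. s \<in> {0..1} \<Longrightarrow> dist s 0 < d \<Longrightarrow> dist (h (s, t)) (h (0, t)) < \<epsilon>"
      unfolding continuous_on_iff using te(2) by (metis atLeastAtMost_iff order_refl zero_le_one)
    then show ?thesis by (auto simp: dist_norm intro!: exI[of _ d])
  qed
  obtain d1 where d1: "d1 > 0" "\<And>s. s \<in> {0..1} \<Longrightarrow> s < d1 \<Longrightarrow> cmod (h (s, t1) - h (0, t1)) < \<alpha> - \<alpha>'"
    using near[OF t(1), of "\<alpha> - \<alpha>'"] \<alpha>'(2) by auto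
  obtain d2 where d2: "d2 > 0" "\<And>s. s \<in> {0..1} \<Longrightarrow> s < d2 \<Longrightarrow> cmod (h (s, t2) - h (0, t2)) < \<beta>' - \<beta>"
    using near[OF t(3), of "\<beta>' - \<beta>"] \<beta>'(2) by auto
  define s0 where "s0 = min 1 (min d1 d2 / 2)"
  have s0: "0 < s0" "s0 \<le> 1" "s0 < d1" "s0 < d2" using d1(1) d2(1) by (auto simp: s0_def min_def)
  then have s0': "s0 \<in> {0..1}" by simp
  define k where "k p = h (s0 * fst p, t1 + snd p * (t2 - t1))" for p
  have k: "continuous_on ({0..1} \<times> {0..1}) k"
    unfolding k_def by (rule h_square(1)[OF t(1,3) s0'])
  have "continuous_on {0..1} (\<lambda>q. \<sigma> * Im (k (1, q)))"
    by (intro continuous_intros continuous_on_compose2[OF k]) auto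
  then obtain q0 where q0: "q0 \<in> {0..1}" "\<And>q. q \<in> {0..1} \<Longrightarrow> \<sigma> * Im (k (1, q0)) \<le> \<sigma> * Im (k (1, q))"
    using continuous_attains_inf[of "{0..1::real}" "\<lambda>q. \<sigma> * Im (k (1, q))"] by auto
  define \<eta> where "\<eta> = \<sigma> * Im (k (1, q0))"
  have \<eta>: "\<eta> > 0"
    unfolding \<eta>_def k_def using s0 by (intro side hD) (auto intro: h_square(2)[OF t(1,3) s0' q0(1)])
  have "Complex x (\<sigma> * y) \<in> D" if x: "x \<in> {\<alpha>..\<beta>}" and y: "y \<in> {0<..\<eta>}" for x y
  proof -
    have small: "s0 * p \<in> {0..1} \<and> s0 * p < d1 \<and> s0 * p < d2" if "p \<in> {0..1}" for p
    proof -
      have "0 \<le> s0 * p" "s0 * p \<le> s0" using that s0 by (auto intro: mult_right_le_one_le)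
      then show ?thesis using s0 unfolding atLeastAtMost_iff by linarith
    qed
    obtain p q where pq: "p \<in> {0..1}" "q \<in> {0..1}" "\<sigma> * Im (k (p, q)) - y = 0" "Re (k (p, q)) - x = 0"
    proof (rule Poincare_Miranda[of "\<lambda>p. \<sigma> * Im (k p) - y" "\<lambda>p. Re (k p) - x"])
      show "continuous_on ({0..1} \<times> {0..1}) (\<lambda>p. \<sigma> * Im (k p) - y)"
        "continuous_on ({0..1} \<times> {0..1}) (\<lambda>p. Re (k p) - x)"
        by (intro continuous_intros k)+
      show "\<sigma> * Im (k (0, q)) - y \<le> 0" if "q \<in> {0..1}" for q
        using h0[OF h_square(2)[OF t(1,3) s0' that]] y by (simp add: k_def)
      show "\<sigma> * Im (k (1, q)) - y \<ge> 0" if "q \<in> {0..1}" for q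
        using q0(2)[OF that] y by (simp add: \<eta>_def)
      show "Re (k (p, 0)) - x \<le> 0" if "p \<in> {0..1}" for p
      proof -
        have "cmod (k (p, 0) - complex_of_real \<alpha>') < \<alpha> - \<alpha>'"
          using d1(2)[of "s0 * p"] small[OF that] h0[OF t(1)] t(2) by (simp add: k_def)
        then have "\<bar>Re (k (p, 0)) - \<alpha>'\<bar> < \<alpha> - \<alpha>'"
          using abs_Re_le_cmod[of "k (p, 0) - complex_of_real \<alpha>'"] by simp
        then show ?thesis using x by auto
      qed
      show "Re (k (p, 1)) - x \<ge> 0" if "p \<in> {0..1}" for p
      proof -
        have "cmod (k (p, 1) - complex_of_real \<beta>') < \<beta>' - \<beta>"
          using d2(2)[of "s0 * p"] small[OF that] h0[OF t(3)] t(4) by (simp add: k_def)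
        then have "\<bar>Re (k (p, 1)) - \<beta>'\<bar> < \<beta>' - \<beta>"
          using abs_Re_le_cmod[of "k (p, 1) - complex_of_real \<beta>'"] by simp
        then show ?thesis using x by auto
      qed
    qed
    have Im: "\<sigma> * Im (k (p, q)) = y" "Re (k (p, q)) = x" using pq by auto
    then have "Im (k (p, q)) = \<sigma> * y" using sign_sq by (metis mult.assoc mult_1)
    then have kz: "k (p, q) = Complex x (\<sigma> * y)" using Im by (simp add: complex_eq_iff)
    have ein: "t1 + q * (t2 - t1) \<in> einterval a b" by (rule h_square(2)[OF t(1,3) s0' pq(2)])
    have "p \<noteq> 0"
    proof
      assume "p = 0"
      then have "Im (k (p, q)) = 0" using h0[OF ein] by (simp add: k_def)
      then show False using Im y by simp
    qed
    then have "s0 * p \<in> {0<..1}" using small[OF pq(1)] s0 pq(1) by auto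
    then have "k (p, q) \<in> D" unfolding k_def using hD[OF _ ein] by simp
    then show ?thesis using kz by simp
  qed
  then show ?thesis using \<eta> by blast
qed

section \<open>Cauchy's theorem up to the boundary\<close>

lemma interval_islimpt:
  assumes x: "x \<in> einterval m1 m2"
  shows "complex_of_real x islimpt D"
  unfolding islimpt_approachable
proof (intro allI impI)
  fix e :: real assume e: "e > 0"
  obtain \<eta> where \<eta>: "\<eta> > 0" "\<And>y. y \<in> {0<..\<eta>} \<Longrightarrow> Complex x (\<sigma> * y) \<in> D"
    using half_neighbourhood[OF x x] by auto
  define y where "y = min \<eta> (e / 2)"
  have y: "y \<in> {0<..\<eta>}" "y < e" using \<eta>(1) e by (auto simp: y_def)
  have "Complex x (\<sigma> * y) - complex_of_real x = \<i> * complex_of_real (\<sigma> * y)"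
    by (simp add: complex_eq_iff)
  then have "dist (Complex x (\<sigma> * y)) (complex_of_real x) = y"
    using y(1) sign by (simp add: dist_norm norm_mult abs_mult)
  then show "\<exists>z\<in>D. z \<noteq> complex_of_real x \<and> dist z (complex_of_real x) < e"
    using \<eta>(2)[OF y(1)] y by (intro bexI[of _ "Complex x (\<sigma> * y)"]) auto
qed

text \<open>
  Cauchy's theorem for triangles holds for functions that are holomorphic inside and continuous up to the
  boundary.  On a closed rectangle with one side on the interval, \<open>g\<close> therefore has a primitive up to
  the boundary, which differs from \<open>G\<close> by a constant.
\<close>

lemma primitive_near_interval:
  assumes g: "g holomorphic_on D" "continuous_on (D \<union> complex_of_real ` einterval m1 m2) g"
    and G: "\<And>z. z \<in> D \<Longrightarrow> (G has_field_derivative g z) (at z)"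
    and \<alpha>: "\<alpha> \<in> einterval m1 m2" and \<beta>: "\<beta> \<in> einterval m1 m2" and le: "\<alpha> < \<beta>"
  obtains Q where
    "\<And>x. x \<in> {\<alpha><..<\<beta>} \<Longrightarrow> (G \<longlongrightarrow> Q x) (at (complex_of_real x) within D)"
    "\<And>s t. \<alpha> \<le> s \<Longrightarrow> s \<le> t \<Longrightarrow> t \<le> \<beta> \<Longrightarrow> ((\<lambda>x. g (complex_of_real x)) has_integral Q t - Q s) {s..t}"
proof -
  obtain \<eta> where \<eta>: "\<eta> > 0" "\<And>x y. x \<in> {\<alpha>..\<beta>} \<Longrightarrow> y \<in> {0<..\<eta>} \<Longrightarrow> Complex x (\<sigma> * y) \<in> D"
    using half_neighbourhood[OF \<alpha> \<beta>] le by auto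
  define S where "S = {z. \<alpha> \<le> Re z \<and> Re z \<le> \<beta> \<and> 0 \<le> \<sigma> * Im z \<and> \<sigma> * Im z \<le> \<eta>}"
  define T where "T = {z. \<alpha> \<le> Re z \<and> Re z \<le> \<beta> \<and> 0 < \<sigma> * Im z \<and> \<sigma> * Im z \<le> \<eta>}"
  have TD: "T \<subseteq> D"
  proof
    fix z assume z: "z \<in> T"
    have "\<sigma> * (\<sigma> * Im z) = Im z" using sign_sq by (simp add: mult.assoc[symmetric])
    then have "z = Complex (Re z) (\<sigma> * (\<sigma> * Im z))" by (simp add: complex_eq_iff)
    then show "z \<in> D" using \<eta>(2)[of "Re z" "\<sigma> * Im z"] z by (auto simp: T_def)
  qed
  have convS: "convex S" "convex T"
  proof -
    have lin: "linear (\<lambda>z. \<sigma> * Im z)" "linear Re"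
      by (intro linearI; simp add: algebra_simps)+
    have S_eq: "S = Re -` {\<alpha>..\<beta>} \<inter> (\<lambda>z. \<sigma> * Im z) -` {0..\<eta>}" by (auto simp: S_def)
    have T_eq: "T = Re -` {\<alpha>..\<beta>} \<inter> (\<lambda>z. \<sigma> * Im z) -` {0<..\<eta>}" by (auto simp: T_def)
    show "convex S" unfolding S_eq by (intro convex_Int convex_linear_vimage lin) auto
    show "convex T" unfolding T_eq by (intro convex_Int convex_linear_vimage lin) auto
  qed
  have sub: "{\<alpha>..\<beta>} \<subseteq> einterval m1 m2" by (rule einterval_subinterval[OF \<alpha> \<beta>])
  have SD: "S \<subseteq> D \<union> complex_of_real ` einterval m1 m2"
  proof
    fix z assume z: "z \<in> S"
    show "z \<in> D \<union> complex_of_real ` einterval m1 m2"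
    proof (cases "\<sigma> * Im z = 0")
      case True
      then have "Im z = 0" using sign by auto
      then have "z = complex_of_real (Re z)" by (simp add: complex_eq_iff)
      moreover have "Re z \<in> einterval m1 m2" using sub z by (auto simp: S_def)
      ultimately show ?thesis by blast
    next
      case False
      then have "z \<in> T" using z by (simp add: S_def T_def less_le)
      then show ?thesis using TD by blast
    qed
  qed
  have contS: "continuous_on S g" by (rule continuous_on_subset[OF g(2) SD])
  have int: "interior S \<subseteq> D"
  proof
    fix z assume z: "z \<in> interior S"
    then obtain e where e: "e > 0" "ball z e \<subseteq> S" using mem_interior by blast
    let ?z = "z - \<i> * complex_of_real (\<sigma> * (e / 2))"
    have "cmod (\<i> * complex_of_real (\<sigma> * (e / 2))) = e / 2" using e(1) sign by (simp add: norm_mult abs_mult)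
    then have "?z \<in> ball z e" using e(1) by (simp add: dist_norm)
    then have "?z \<in> S" using e(2) by blast
    then have "0 \<le> \<sigma> * Im ?z" unfolding S_def by blast
    also have "\<sigma> * Im ?z = \<sigma> * Im z - (\<sigma> * \<sigma>) * (e / 2)" by (simp add: algebra_simps)
    finally have "0 \<le> \<sigma> * Im z - e / 2" by (simp add: sign_sq)
    then have "0 < \<sigma> * Im z" using e(1) by linarith
    moreover have "z \<in> S" using z interior_subset by blast
    ultimately show "z \<in> D" using TD by (auto simp: S_def T_def)
  qed
  have diff: "g field_differentiable at z" if "z \<in> interior S - {}" for z
    using that int g(1) open_D by (auto simp: holomorphic_on_open field_differentiable_def)
  obtain P where P: "\<And>z. z \<in> S \<Longrightarrow> (P has_field_derivative g z) (at z within S)"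
    using holomorphic_convex_primitive[OF convS(1) finite.emptyI contS diff] by blast
  have "\<exists>c. \<forall>z\<in>T. P z - G z = c"
  proof (rule has_field_derivative_zero_constant[OF convS(2)])
    fix z assume z: "z \<in> T"
    have "T \<subseteq> S" by (auto simp: S_def T_def)
    then have "(P has_field_derivative g z) (at z within T)"
      using P[of z] z by (meson has_field_derivative_subset subsetD)
    moreover have "(G has_field_derivative g z) (at z within T)"
      using G[of z] z TD by (meson has_field_derivative_at_within subsetD)
    ultimately show "((\<lambda>z. P z - G z) has_field_derivative 0) (at z within T)"
      using DERIV_diff by fastforce
  qed
  then obtain c where c: "\<And>z. z \<in> T \<Longrightarrow> G z = P z - c" by (metis diff_eq_eq add.commute eq_diff_eq)
  define Q where "Q x = P (complex_of_real x) - c" for x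
  have xS: "complex_of_real x \<in> S" if "x \<in> {\<alpha>..\<beta>}" for x using that \<eta>(1) by (simp add: S_def)
  show ?thesis
  proof
    fix x assume x: "x \<in> {\<alpha><..<\<beta>}"
    let ?F = "at (complex_of_real x) within D"
    have Re: "(Re \<longlongrightarrow> x) ?F" using tendsto_Re[OF tendsto_ident_at, of "complex_of_real x" D] by simp
    have Im: "((\<lambda>z. \<sigma> * Im z) \<longlongrightarrow> 0) ?F"
      using tendsto_mult[OF tendsto_const[of \<sigma>] tendsto_Im[OF tendsto_ident_at, of "complex_of_real x" D]] by simp
    have inD: "\<forall>\<^sub>F z in ?F. z \<in> D" by (simp add: eventually_at_filter)
    have "\<alpha> < x" "x < \<beta>" using x by auto
    from order_tendstoD(1)[OF Re this(1)] order_tendstoD(2)[OF Re this(2)] order_tendstoD(2)[OF Im \<eta>(1)] inD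
    have inT: "\<forall>\<^sub>F z in ?F. z \<in> T"
      by eventually_elim (simp add: T_def side)
    have "(P \<longlongrightarrow> P (complex_of_real x)) (at (complex_of_real x) within S)"
      using DERIV_continuous[OF P[OF xS]] x by (simp add: continuous_within)
    then have "(P \<longlongrightarrow> P (complex_of_real x)) (at (complex_of_real x) within T)"
      by (rule tendsto_within_subset) (auto simp: S_def T_def)
    then have PT: "((\<lambda>z. P z - c) \<longlongrightarrow> Q x) (at (complex_of_real x) within T)"
      unfolding Q_def by (intro tendsto_intros)
    have "?F \<le> at (complex_of_real x) within T"
    proof (rule filter_leI)
      fix A assume "\<forall>\<^sub>F z in at (complex_of_real x) within T. A z"
      then have "\<forall>\<^sub>F z in nhds (complex_of_real x). z \<noteq> complex_of_real x \<longrightarrow> z \<in> T \<longrightarrow> A z"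
        by (simp add: eventually_at_filter)
      moreover have "\<forall>\<^sub>F z in nhds (complex_of_real x). z \<noteq> complex_of_real x \<longrightarrow> z \<in> D \<longrightarrow> z \<in> T"
        using inT by (simp add: eventually_at_filter)
      ultimately show "\<forall>\<^sub>F z in ?F. A z"
        unfolding eventually_at_filter by eventually_elim blast
    qed
    then have "((\<lambda>z. P z - c) \<longlongrightarrow> Q x) ?F" using PT by (rule tendsto_mono)
    moreover have "\<forall>\<^sub>F z in ?F. G z = P z - c" using inT by eventually_elim (rule c)
    ultimately show "(G \<longlongrightarrow> Q x) ?F" by (simp add: tendsto_cong)
  next
    fix s t assume st: "\<alpha> \<le> s" "s \<le> t" "t \<le> \<beta>"
    show "((\<lambda>x. g (complex_of_real x)) has_integral Q t - Q s) {s..t}"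
    proof (rule fundamental_theorem_of_calculus[OF st(2)])
      fix x assume x: "x \<in> {s..t}"
      have "complex_of_real ` {s..t} \<subseteq> S" using xS st by auto
      then have 2: "((\<lambda>z. P z - c) has_field_derivative g (complex_of_real x)) (at (complex_of_real x) within complex_of_real ` {s..t})"
        using DERIV_diff[OF P[OF xS[of x]] DERIV_const[of c]] x st
        by (auto intro: has_field_derivative_subset)
      have 1: "(complex_of_real has_vector_derivative 1) (at x within {s..t})"
        using has_vector_derivative_of_real[OF DERIV_ident] by (simp add: has_vector_derivative_at_within)
      from field_vector_diff_chain_within[OF 1 2]
      show "(Q has_vector_derivative g (complex_of_real x)) (at x within {s..t})"
        by (simp add: o_def Q_def[abs_def])
    qed
  qed
qed

lemma primitive_up_to_interval:
  assumes D: "simply_connected D"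
    and g: "g holomorphic_on D" "continuous_on (D \<union> complex_of_real ` einterval m1 m2) g"
  obtains G where "\<And>z. z \<in> D \<Longrightarrow> (G has_field_derivative g z) (at z)"
    "\<And>x. x \<in> einterval m1 m2 \<Longrightarrow>
       (G \<longlongrightarrow> G (complex_of_real x)) (at (complex_of_real x) within D)"
    "\<And>s t. s \<in> einterval m1 m2 \<Longrightarrow> t \<in> einterval m1 m2 \<Longrightarrow> s \<le> t \<Longrightarrow>
       ((\<lambda>x. g (complex_of_real x)) has_integral G (complex_of_real t) - G (complex_of_real s)) {s..t}"
proof -
  obtain G0 where G0: "\<And>z. z \<in> D \<Longrightarrow> (G0 has_field_derivative g z) (at z)"
    using simply_connected_eq_global_primitive[OF open_D] D g(1) by blast
  define l where "l x = Lim (at (complex_of_real x) within D) G0" for x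
  define G where "G z = (if z \<in> D then G0 z else l (Re z))" for z
  have real_notin: "complex_of_real x \<notin> D" for x using side[of "complex_of_real x"] by auto
  have nontriv: "\<not> trivial_limit (at (complex_of_real x) within D)" if "x \<in> einterval m1 m2" for x
    using interval_islimpt[OF that] by (simp add: trivial_limit_within)
  have l: "l x = y" if "x \<in> einterval m1 m2" "(G0 \<longlongrightarrow> y) (at (complex_of_real x) within D)" for x y
    unfolding l_def by (rule tendsto_Lim[OF nontriv[OF that(1)] that(2)])
  have enlarge: "\<exists>\<alpha> \<beta>. \<alpha> \<in> einterval m1 m2 \<and> \<beta> \<in> einterval m1 m2 \<and> \<alpha> < s \<and> t < \<beta>"
    if st: "s \<in> einterval m1 m2" "t \<in> einterval m1 m2" for s t
  proof -
    have "m1 < ereal s" "ereal t < m2" using st by (auto simp: einterval_def)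
    then obtain \<alpha> \<beta> where *: "m1 < ereal \<alpha>" "ereal \<alpha> < ereal s" "ereal t < ereal \<beta>" "ereal \<beta> < m2"
      using ereal_dense2 by meson
    then have "\<alpha> \<in> einterval m1 m2" "\<beta> \<in> einterval m1 m2"
      using st less_trans[of "ereal \<alpha>" "ereal s" m2] less_trans[of m1 "ereal t" "ereal \<beta>"]
      by (auto simp: einterval_def)
    then show ?thesis using * by auto
  qed
  show ?thesis
  proof
    fix z assume z: "z \<in> D"
    have "\<forall>\<^sub>F w in nhds z. G w = G0 w"
      using eventually_nhds_in_open[OF open_D z] by eventually_elim (simp add: G_def)
    then show "(G has_field_derivative g z) (at z)"
      using G0[OF z] DERIV_cong_ev[OF refl _ refl] by blast
  next
    fix x assume x: "x \<in> einterval m1 m2"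
    obtain \<alpha> \<beta> where ab: "\<alpha> \<in> einterval m1 m2" "\<beta> \<in> einterval m1 m2" "\<alpha> < x" "x < \<beta>"
      using enlarge[OF x x] by blast
    then have "\<alpha> < \<beta>" by simp
    from primitive_near_interval[OF g G0 ab(1,2) this] obtain Q where Q:
      "\<And>x. x \<in> {\<alpha><..<\<beta>} \<Longrightarrow> (G0 \<longlongrightarrow> Q x) (at (complex_of_real x) within D)" by metis
    have lim: "(G0 \<longlongrightarrow> Q x) (at (complex_of_real x) within D)" using Q ab by simp
    have "G (complex_of_real x) = Q x" using l[OF x lim] real_notin by (simp add: G_def)
    moreover have "\<forall>\<^sub>F z in at (complex_of_real x) within D. G z = G0 z"
      by (simp add: eventually_at_filter G_def)
    ultimately show "(G \<longlongrightarrow> G (complex_of_real x)) (at (complex_of_real x) within D)"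
      using lim by (simp add: tendsto_cong)
  next
    fix s t assume st: "s \<in> einterval m1 m2" "t \<in> einterval m1 m2" "s \<le> t"
    obtain \<alpha> \<beta> where ab: "\<alpha> \<in> einterval m1 m2" "\<beta> \<in> einterval m1 m2" "\<alpha> < s" "t < \<beta>"
      using enlarge[OF st(1,2)] by blast
    then have "\<alpha> < \<beta>" using st(3) by simp
    from primitive_near_interval[OF g G0 ab(1,2) this] obtain Q where Q:
      "\<And>x. x \<in> {\<alpha><..<\<beta>} \<Longrightarrow> (G0 \<longlongrightarrow> Q x) (at (complex_of_real x) within D)"
      "\<And>s t. \<alpha> \<le> s \<Longrightarrow> s \<le> t \<Longrightarrow> t \<le> \<beta> \<Longrightarrow> ((\<lambda>x. g (complex_of_real x)) has_integral Q t - Q s) {s..t}"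
      by metis
    have "G (complex_of_real x) = Q x" if "x \<in> {s, t}" for x
    proof -
      have "x \<in> einterval m1 m2" "x \<in> {\<alpha><..<\<beta>}" using that st ab by auto
      then show ?thesis using l Q(1) real_notin by (simp add: G_def)
    qed
    then show "((\<lambda>x. g (complex_of_real x)) has_integral G (complex_of_real t) - G (complex_of_real s)) {s..t}"
      using Q(2)[of s t] ab st(3) by simp
  qed
qed

text \<open>
  Only the starting point of a link lies outside \<open>D\<close>: integrate \<open>g\<close> over the part after the parameter \<open>s\<close> and
  let \<open>s\<close> tend to zero.
\<close>

lemma link_estimate:
  fixes K' :: "complex \<Rightarrow> ('b::chilbert \<Rightarrow>\<^sub>L 'b)"
  assumes g: "continuous_on D g" and K': "continuous_on D K'"
    and le: "\<And>z. z \<in> D \<Longrightarrow> cmod (g z) \<le> C * norm (K' z)" and C: "C \<ge> 0"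
    and G: "\<And>z. z \<in> D \<Longrightarrow> (G has_field_derivative g z) (at z)"
    and lim: "(G \<longlongrightarrow> G (complex_of_real x)) (at (complex_of_real x) within D)"
    and link: "link D K' (complex_of_real x) w e" and e: "e > 0"
  shows "cmod (G w - G (complex_of_real x)) \<le> C * e"
proof -
  obtain L c where L: "L > 0" and c: "arc_length_param {0..L} c" "c 0 = complex_of_real x" "c L = w"
    "c ` {0<..L} \<subseteq> D" "V0 K' {0..L} c < ennreal e"
    using link unfolding link_def by blast
  have bound: "cmod (G w - G (c s)) \<le> C * e" if s: "s \<in> {0<..L}" for s
  proof -
    have img: "c ` {s..L} \<subseteq> D" using c(4) s by auto
    have cont: "continuous_on {s..L} (\<lambda>t. K' (c t))"
      using s by (intro continuous_on_compose2[OF K' continuous_on_subset[OF arc_length_param_continuous[OF c(1)]] img]) auto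
    have "cmod (G (c L) - G (c s)) \<le> integral {s..L} (\<lambda>t. C * norm (K' (c t)))"
      by (rule arc_length_param_integral_bound[OF c(1) _ _ img g _ le G])
        (use s in \<open>auto intro!: continuous_intros K'\<close>)
    also have "\<dots> = C * integral {s..L} (\<lambda>t. norm (K' (c t)))" by simp
    also have "\<dots> \<le> C * e"
      using s by (intro mult_left_mono[OF V0_integral_le[OF cont _ c(5) e] C]) auto
    finally show ?thesis by (simp add: c(3))
  qed
  have "(c \<longlongrightarrow> complex_of_real x) (at_right 0)"
  proof -
    have "(c \<longlongrightarrow> c 0) (at 0 within {0..L})"
      using arc_length_param_continuous[OF c(1)] L by (simp add: continuous_on_def)
    then show ?thesis using L by (simp add: at_within_Icc_at_right c(2))
  qed
  moreover have ev: "\<forall>\<^sub>F s in at_right 0. s \<in> {0<..L}"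
    using eventually_at_right_real[OF L] by eventually_elim auto
  moreover have "\<forall>\<^sub>F s in at_right 0. c s \<in> D \<and> c s \<noteq> complex_of_real x"
    using ev
  proof eventually_elim
    case (elim s)
    then have "c s \<in> D" using c(4) by blast
    then show ?case using side[of "c s"] by auto
  qed
  ultimately have "filterlim c (at (complex_of_real x) within D) (at_right 0)"
    by (simp add: filterlim_at)
  from filterlim_compose[OF lim this] have "((\<lambda>s. G (c s)) \<longlongrightarrow> G (complex_of_real x)) (at_right 0)" .
  then have "((\<lambda>s. cmod (G w - G (c s))) \<longlongrightarrow> cmod (G w - G (complex_of_real x))) (at_right 0)"
    by (intro tendsto_intros)
  then show ?thesis
    by (rule tendsto_upperbound) (use ev bound in \<open>auto elim!: eventually_mono\<close>)
qed

section \<open>Links at the end points\<close>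

lemma crosscut_link:
  fixes K' :: "complex \<Rightarrow> ('b::chilbert \<Rightarrow>\<^sub>L 'b)"
  assumes \<tau>: "\<bar>\<tau>\<bar> = 1" and r: "r > 0"
    and tn: "tn \<in> einterval a b" and tf: "tf \<in> einterval a b"
    and one_side: "\<And>t. t \<in> einterval a b \<Longrightarrow> \<tau> * (\<phi> t - m) > 0"
    and inside: "\<And>s. s \<in> {0..1} \<Longrightarrow> cmod (h (s, tn) - complex_of_real m) \<le> r"
    and outside: "\<And>s. s \<in> {0..1} \<Longrightarrow> cmod (h (s, tf) - complex_of_real m) \<ge> r"
    and M: "\<And>z. z \<in> D \<Longrightarrow> cmod (z - complex_of_real m) = r \<Longrightarrow> norm (K' z) \<le> M"
    and M0: "M \<ge> 0" and e: "M * (r * pi) < e"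
  shows "\<exists>t. min tn tf \<le> t \<and> t \<le> max tn tf \<and> link D K' (complex_of_real (m + \<tau> * r)) (\<gamma> t) e"
proof -
  define k where "k p = h (1 * fst p, tn + snd p * (tf - tn))" for p
  have one: "1 \<in> {0..1::real}" by simp
  have k: "continuous_on ({0..1} \<times> {0..1}) k" unfolding k_def by (rule h_square(1)[OF tn tf one])
  have ein: "tn + q * (tf - tn) \<in> einterval a b" if "q \<in> {0..1}" for q
    by (rule h_square(2)[OF tn tf one that])
  obtain \<theta> q where \<theta>: "\<theta> \<in> {0<..<pi}" "q \<in> {0..1}" "half_circle m r \<tau> \<sigma> \<theta> = k (1, q)"
    "half_circle m r \<tau> \<sigma> ` {0<..\<theta>} \<subseteq> D"
  proof (rule crosscut[OF k \<tau> sign r, where D = D])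
    show "Im (k (0, q)) = 0 \<and> \<tau> * (Re (k (0, q)) - m) > 0" if "q \<in> {0..1}" for q
      using h0[OF ein[OF that]] one_side[OF ein[OF that]] by (simp add: k_def)
    show "k (p, q) \<in> D" if "p \<in> {0<..1}" "q \<in> {0..1}" for p q
      using hD[OF that(1) ein[OF that(2)]] by (simp add: k_def)
    show "cmod (k (p, 0) - complex_of_real m) \<le> r" if "p \<in> {0..1}" for p
      using inside[OF that] by (simp add: k_def)
    show "cmod (k (p, 1) - complex_of_real m) \<ge> r" if "p \<in> {0..1}" for p
      using outside[OF that] by (simp add: k_def)
  qed (auto intro: side)
  define t where "t = tn + q * (tf - tn)"
  have "half_circle m r \<tau> \<sigma> \<theta> = \<gamma> t" using \<theta>(3) h1[OF ein[OF \<theta>(2)]] by (simp add: k_def t_def)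
  then have "link D K' (complex_of_real (m + \<tau> * r)) (\<gamma> t) e"
    using link_half_circle[OF \<tau> sign r \<theta>(1,4) M M0 e] by simp
  moreover have "min tn tf \<le> t \<and> t \<le> max tn tf" unfolding t_def by (rule h_square(3)[OF tn tf one \<theta>(2)])
  ultimately show ?thesis by blast
qed

text \<open>
  Along the arcs of the circle of radius \<open>r\<close> the integral of \<open>\<parallel>K'\<parallel>\<close> is at most \<open>C r\<^sup>\<kappa> \<cdot> \<pi> r\<close>, which tends to
  zero with \<open>r\<close> because \<open>\<kappa> > -1\<close>.
\<close>

lemma finite_end_link:
  fixes K' :: "complex \<Rightarrow> ('b::chilbert \<Rightarrow>\<^sub>L 'b)"
  assumes \<tau>: "\<bar>\<tau>\<bar> = 1" and tf: "tf \<in> einterval a b"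
    and one_side: "\<And>t. t \<in> einterval a b \<Longrightarrow> \<tau> * (\<phi> t - m) > 0"
    and near: "\<And>r. r > 0 \<Longrightarrow> \<exists>tn\<in>einterval a b. T tn \<and> (\<forall>s\<in>{0..1}. cmod (h (s, tn) - complex_of_real m) \<le> r)"
    and K': "\<forall>\<^sub>F z in at (complex_of_real m) within D.
        norm (K' z) \<le> C * cmod (z - complex_of_real m) powr \<kappa>" and C: "C > 0" and \<kappa>: "\<kappa> > -1"
    and e: "e > 0" and \<delta>: "\<delta> > 0"
  shows "\<exists>tn\<in>einterval a b. T tn \<and> (\<exists>r\<in>{0<..<\<delta>}. \<exists>t. min tn tf \<le> t \<and> t \<le> max tn tf \<and>
      link D K' (complex_of_real (m + \<tau> * r)) (\<gamma> t) e)"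
proof -
  obtain \<rho> where \<rho>: "\<rho> > 0" "\<And>z. z \<in> D \<Longrightarrow> z \<noteq> complex_of_real m \<Longrightarrow> dist z (complex_of_real m) < \<rho> \<Longrightarrow>
      norm (K' z) \<le> C * cmod (z - complex_of_real m) powr \<kappa>"
    using K' unfolding eventually_at by blast
  have hm: "h (s, tf) \<noteq> complex_of_real m" if "s \<in> {0..1}" for s
  proof (cases "s = 0")
    case True
    then show ?thesis using h0[OF tf] one_side[OF tf] by auto
  next
    case False
    then have "h (s, tf) \<in> D" using that tf by (intro hD) auto
    then show ?thesis using side[of "h (s, tf)"] by auto
  qed
  have "continuous_on {0..1} (\<lambda>s. cmod (h (s, tf) - complex_of_real m))"
    using tf by (intro continuous_intros continuous_on_compose2[OF h_cont]) auto
  then obtain s0 where s0: "s0 \<in> {0..1}"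
    "\<And>s. s \<in> {0..1} \<Longrightarrow> cmod (h (s0, tf) - complex_of_real m) \<le> cmod (h (s, tf) - complex_of_real m)"
    using continuous_attains_inf[of "{0..1::real}" "\<lambda>s. cmod (h (s, tf) - complex_of_real m)"] by auto
  define d where "d = cmod (h (s0, tf) - complex_of_real m)"
  have d: "d > 0" using hm[OF s0(1)] by (simp add: d_def)
  have "((\<lambda>r. (C * pi) * r powr (\<kappa> + 1)) \<longlongrightarrow> (C * pi) * 0) (at_right 0)"
    by (intro tendsto_intros tendsto_zero_powrI[where b = "\<kappa> + 1"])
      (use \<kappa> in \<open>auto simp: eventually_at_filter\<close>)
  then have "\<forall>\<^sub>F r in at_right 0. (C * pi) * r powr (\<kappa> + 1) < e"
    using e by (intro order_tendstoD(2)) auto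
  moreover have "\<forall>\<^sub>F r in at_right 0. r \<in> {0<..<min (min d \<rho>) \<delta>}"
    using d \<rho>(1) \<delta> by (intro eventually_at_right_real) auto
  ultimately have "\<forall>\<^sub>F r in at_right 0. (C * pi) * r powr (\<kappa> + 1) < e \<and> r \<in> {0<..<min (min d \<rho>) \<delta>}"
    by (rule eventually_conj)
  then obtain r where r: "(C * pi) * r powr (\<kappa> + 1) < e" "r \<in> {0<..<min (min d \<rho>) \<delta>}"
    using eventually_happens'[OF trivial_limit_at_right_real] by blast
  have r0: "r > 0" using r by simp
  obtain tn where tn: "tn \<in> einterval a b" "T tn"
    "\<And>s. s \<in> {0..1} \<Longrightarrow> cmod (h (s, tn) - complex_of_real m) \<le> r"
    using near[OF r0] by blast
  have out: "cmod (h (s, tf) - complex_of_real m) \<ge> r" if "s \<in> {0..1}" for s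
    using s0(2)[OF that] r(2) by (simp add: d_def)
  have M: "norm (K' z) \<le> C * r powr \<kappa>" if "z \<in> D" "cmod (z - complex_of_real m) = r" for z
    using \<rho>(2)[of z] that r by (auto simp: dist_norm)
  have M0: "C * r powr \<kappa> \<ge> 0" using C by simp
  have small: "C * r powr \<kappa> * (r * pi) < e" using r(1) r0 by (simp add: powr_add mult_ac)
  have "\<exists>t. min tn tf \<le> t \<and> t \<le> max tn tf \<and> link D K' (complex_of_real (m + \<tau> * r)) (\<gamma> t) e"
    by (rule crosscut_link[OF \<tau> r0 tn(1) tf one_side tn(3) out M M0 small])
  moreover have "r \<in> {0<..<\<delta>}" using r(2) by simp
  ultimately show ?thesis using tn(1,2) by blast
qed

lemma lower_link:
  fixes K' :: "complex \<Rightarrow> ('b::chilbert \<Rightarrow>\<^sub>L 'b)"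
  assumes bound: "\<bar>m1\<bar> \<noteq> \<infinity> \<Longrightarrow> \<exists>C>0. \<exists>\<kappa>>-1. \<forall>\<^sub>F z in at (complex_of_real (real_of_ereal m1)) within D.
        norm (K' z) \<le> C * cmod (z - complex_of_real (real_of_ereal m1)) powr \<kappa>"
    and inf: "m1 = - \<infinity> \<Longrightarrow> \<exists>\<^sub>F (x, t) in at_bot \<times>\<^sub>F at_bot. link D K' (complex_of_real x) (\<gamma> t) e"
    and ends: "m1 = - \<infinity> \<Longrightarrow> a = - \<infinity>" and e: "e > 0"
    and x0: "x0 \<in> einterval m1 m2" and t0: "t0 \<in> einterval a b"
  shows "\<exists>x t. x \<in> einterval m1 m2 \<and> x \<le> x0 \<and> t \<in> einterval a b \<and> t \<le> t0 \<and>
      link D K' (complex_of_real x) (\<gamma> t) e"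
proof (cases "m1 = - \<infinity>")
  case True
  have "\<forall>\<^sub>F p in at_bot \<times>\<^sub>F at_bot. fst p < x0 \<and> snd p < t0"
    by (rule eventually_prodI) (simp_all add: eventually_gt_at_bot eventually_at_bot_dense)
  with inf[OF True] have "\<exists>\<^sub>F p in at_bot \<times>\<^sub>F at_bot. (case p of (x, t) \<Rightarrow> link D K' (complex_of_real x) (\<gamma> t) e) \<and>
      fst p < x0 \<and> snd p < t0"
    by (rule frequently_eventually_frequently)
  then obtain p where "(case p of (x, t) \<Rightarrow> link D K' (complex_of_real x) (\<gamma> t) e) \<and> fst p < x0 \<and> snd p < t0"
    using frequently_ex by blast
  then have p: "link D K' (complex_of_real (fst p)) (\<gamma> (snd p)) e" "fst p < x0" "snd p < t0"
    by (auto simp: case_prod_unfold)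
  have "fst p \<in> einterval m1 m2" "snd p \<in> einterval a b"
    using p(2,3) x0 t0 True ends less_trans[of "ereal (fst p)" "ereal x0" m2] less_trans[of "ereal (snd p)" "ereal t0" b]
    by (auto simp: einterval_def)
  then show ?thesis using p by (intro exI[of _ "fst p"] exI[of _ "snd p"]) auto
next
  case False
  then obtain m where m: "m1 = ereal m" using m1_less by (cases m1) auto
  then obtain C \<kappa> where K': "C > 0" "\<kappa> > -1" "\<forall>\<^sub>F z in at (complex_of_real m) within D.
        norm (K' z) \<le> C * cmod (z - complex_of_real m) powr \<kappa>"
    using bound by auto
  have one_side: "1 * (\<phi> t - m) > 0" if "t \<in> einterval a b" for t
    using \<phi>_image that m by (auto simp: einterval_def)
  have at: "a < ereal t0" using t0 by (simp add: einterval_def)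
  have near: "\<exists>tn\<in>einterval a b. tn < t0 \<and> (\<forall>s\<in>{0..1}. cmod (h (s, tn) - complex_of_real m) \<le> r)"
    if r: "r > 0" for r
  proof -
    have "(h \<longlongrightarrow> complex_of_real m) (principal {0..1} \<times>\<^sub>F at_lower a)"
      using lower by (simp add: m end_filter_def)
    from tendstoD[OF this r] obtain Pf Pg where PQ: "\<forall>\<^sub>F s in principal {0..1}. Pf s" "\<forall>\<^sub>F t in at_lower a. Pg t"
      "\<And>s t. Pf s \<Longrightarrow> Pg t \<Longrightarrow> dist (h (s, t)) (complex_of_real m) < r"
      unfolding eventually_prod_filter by blast
    have "\<forall>\<^sub>F t in at_lower a. Pg t \<and> (a < ereal t \<and> t < t0)"
      by (rule eventually_conj[OF PQ(2) eventually_at_lower[OF at]])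
    then obtain tn where tn: "Pg tn" "a < ereal tn" "tn < t0"
      using eventually_happens'[OF at_lower_nontrivial] by blast
    then have "tn \<in> einterval a b"
      using t0 less_trans[of "ereal tn" "ereal t0" b] by (auto simp: einterval_def)
    moreover have "cmod (h (s, tn) - complex_of_real m) \<le> r" if "s \<in> {0..1}" for s
      using PQ(3)[OF _ tn(1), of s] PQ(1) that by (auto simp: eventually_principal dist_norm)
    ultimately show ?thesis using tn(3) by blast
  qed
  have \<delta>: "x0 - m > 0" using x0 m by (simp add: einterval_def)
  obtain tn r t where *: "tn \<in> einterval a b" "tn < t0" "r \<in> {0<..<x0 - m}"
      "min tn t0 \<le> t" "t \<le> max tn t0" "link D K' (complex_of_real (m + 1 * r)) (\<gamma> t) e"
    using finite_end_link[OF _ t0 one_side near K'(3,1,2) e \<delta>] by auto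
  have t: "tn \<le> t" "t \<le> t0" using *(2,4,5) by (auto simp: min_def max_def split: if_splits)
  then have "t \<in> einterval a b" using einterval_subinterval[OF *(1) t0] by auto
  moreover have "m + r \<in> einterval m1 m2"
    using x0 *(3) m less_trans[of "ereal (m + r)" "ereal x0" m2] by (auto simp: einterval_def)
  ultimately show ?thesis using *(3,6) t(2) by (intro exI[of _ "m + r"] exI[of _ t]) auto
qed

lemma upper_link:
  fixes K' :: "complex \<Rightarrow> ('b::chilbert \<Rightarrow>\<^sub>L 'b)"
  assumes bound: "\<bar>m2\<bar> \<noteq> \<infinity> \<Longrightarrow> \<exists>C>0. \<exists>\<kappa>>-1. \<forall>\<^sub>F z in at (complex_of_real (real_of_ereal m2)) within D.
        norm (K' z) \<le> C * cmod (z - complex_of_real (real_of_ereal m2)) powr \<kappa>"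
    and inf: "m2 = \<infinity> \<Longrightarrow> \<exists>\<^sub>F (x, t) in at_top \<times>\<^sub>F at_top. link D K' (complex_of_real x) (\<gamma> t) e"
    and ends: "m2 = \<infinity> \<Longrightarrow> b = \<infinity>" and e: "e > 0"
    and x0: "x0 \<in> einterval m1 m2" and t0: "t0 \<in> einterval a b"
  shows "\<exists>x t. x \<in> einterval m1 m2 \<and> x0 \<le> x \<and> t \<in> einterval a b \<and> t0 \<le> t \<and>
      link D K' (complex_of_real x) (\<gamma> t) e"
proof (cases "m2 = \<infinity>")
  case True
  have "\<forall>\<^sub>F p in at_top \<times>\<^sub>F at_top. x0 < fst p \<and> t0 < snd p"
    by (rule eventually_prodI) (simp_all add: eventually_gt_at_top)
  with inf[OF True] have "\<exists>\<^sub>F p in at_top \<times>\<^sub>F at_top. (case p of (x, t) \<Rightarrow> link D K' (complex_of_real x) (\<gamma> t) e) \<and>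
      x0 < fst p \<and> t0 < snd p"
    by (rule frequently_eventually_frequently)
  then obtain p where "(case p of (x, t) \<Rightarrow> link D K' (complex_of_real x) (\<gamma> t) e) \<and> x0 < fst p \<and> t0 < snd p"
    using frequently_ex by blast
  then have p: "link D K' (complex_of_real (fst p)) (\<gamma> (snd p)) e" "x0 < fst p" "t0 < snd p"
    by (auto simp: case_prod_unfold)
  have "fst p \<in> einterval m1 m2" "snd p \<in> einterval a b"
    using p(2,3) x0 t0 True ends less_trans[of m1 "ereal x0" "ereal (fst p)"] less_trans[of a "ereal t0" "ereal (snd p)"]
    by (auto simp: einterval_def)
  then show ?thesis using p by (intro exI[of _ "fst p"] exI[of _ "snd p"]) auto
next
  case False
  then obtain m where m: "m2 = ereal m" using m1_less by (cases m2) auto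
  then obtain C \<kappa> where K': "C > 0" "\<kappa> > -1" "\<forall>\<^sub>F z in at (complex_of_real m) within D.
        norm (K' z) \<le> C * cmod (z - complex_of_real m) powr \<kappa>"
    using bound by auto
  have one_side: "(- 1) * (\<phi> t - m) > 0" if "t \<in> einterval a b" for t
    using \<phi>_image that m by (auto simp: einterval_def)
  have tb: "ereal t0 < b" using t0 by (simp add: einterval_def)
  have near: "\<exists>tn\<in>einterval a b. t0 < tn \<and> (\<forall>s\<in>{0..1}. cmod (h (s, tn) - complex_of_real m) \<le> r)"
    if r: "r > 0" for r
  proof -
    have "(h \<longlongrightarrow> complex_of_real m) (principal {0..1} \<times>\<^sub>F at_upper b)"
      using upper by (simp add: m end_filter_def)
    from tendstoD[OF this r] obtain Pf Pg where PQ: "\<forall>\<^sub>F s in principal {0..1}. Pf s" "\<forall>\<^sub>F t in at_upper b. Pg t"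
      "\<And>s t. Pf s \<Longrightarrow> Pg t \<Longrightarrow> dist (h (s, t)) (complex_of_real m) < r"
      unfolding eventually_prod_filter by blast
    have "\<forall>\<^sub>F t in at_upper b. Pg t \<and> (t0 < t \<and> ereal t < b)"
      by (rule eventually_conj[OF PQ(2) eventually_at_upper[OF tb]])
    then obtain tn where tn: "Pg tn" "t0 < tn" "ereal tn < b"
      using eventually_happens'[OF at_upper_nontrivial] by blast
    then have "tn \<in> einterval a b"
      using t0 less_trans[of a "ereal t0" "ereal tn"] by (auto simp: einterval_def)
    moreover have "cmod (h (s, tn) - complex_of_real m) \<le> r" if "s \<in> {0..1}" for s
      using PQ(3)[OF _ tn(1), of s] PQ(1) that by (auto simp: eventually_principal dist_norm)
    ultimately show ?thesis using tn(2) by blast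
  qed
  have \<delta>: "m - x0 > 0" using x0 m by (simp add: einterval_def)
  obtain tn r t where *: "tn \<in> einterval a b" "t0 < tn" "r \<in> {0<..<m - x0}"
      "min tn t0 \<le> t" "t \<le> max tn t0" "link D K' (complex_of_real (m + (- 1) * r)) (\<gamma> t) e"
    using finite_end_link[OF _ t0 one_side near K'(3,1,2) e \<delta>] by auto
  have t: "t0 \<le> t" "t \<le> tn" using *(2,4,5) by (auto simp: min_def max_def split: if_splits)
  then have "t \<in> einterval a b" using einterval_subinterval[OF t0 *(1)] by auto
  moreover have "m - r \<in> einterval m1 m2"
    using x0 *(3) m less_trans[of m1 "ereal x0" "ereal (m - r)"] by (auto simp: einterval_def)
  ultimately show ?thesis using *(3,6) t(1) by (intro exI[of _ "m - r"] exI[of _ t]) auto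
qed

section \<open>Deforming the contour into the interval\<close>

text \<open>
  A primitive \<open>G\<close> turns the integrals over compact parts of the interval and of the contour into
  differences of values of \<open>G\<close>.  Choose the compact parts such that their end points are joined by links
  with bounds \<open>\<epsilon>\<^sub>n \<rightarrow> 0\<close>; over the parts of the contour the integrals converge by dominated convergence.
\<close>

theorem contour_integral_eq_limit:
  fixes K' :: "complex \<Rightarrow> ('b::chilbert \<Rightarrow>\<^sub>L 'b)"
  assumes sc: "simply_connected D" and arc: "arc_length_param (einterval a b) \<gamma>"
    and g: "g holomorphic_on D" "continuous_on (D \<union> complex_of_real ` einterval m1 m2) g"
    and K': "continuous_on D K'" and V0: "V0 K' (einterval a b) \<gamma> < \<infinity>"
    and le: "\<And>z. z \<in> D \<Longrightarrow> cmod (g z) \<le> C * norm (K' z)" and C: "C \<ge> 0"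
    and lower: "\<And>x0 t0 e. x0 \<in> einterval m1 m2 \<Longrightarrow> t0 \<in> einterval a b \<Longrightarrow> e > 0 \<Longrightarrow>
      \<exists>x t. x \<in> einterval m1 m2 \<and> x \<le> x0 \<and> t \<in> einterval a b \<and> t \<le> t0 \<and> link D K' (complex_of_real x) (\<gamma> t) e"
    and upper: "\<And>x0 t0 e. x0 \<in> einterval m1 m2 \<Longrightarrow> t0 \<in> einterval a b \<Longrightarrow> e > 0 \<Longrightarrow>
      \<exists>x t. x \<in> einterval m1 m2 \<and> x0 \<le> x \<and> t \<in> einterval a b \<and> t0 \<le> t \<and> link D K' (complex_of_real x) (\<gamma> t) e"
    and W: "((\<lambda>t. vector_derivative \<gamma> (at t) * g (\<gamma> t)) has_integral W) (einterval a b)"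
    and V: "((\<lambda>(s, t). integral {s..t} (\<lambda>x. g (complex_of_real x))) \<longlongrightarrow> V) (at_lower m1 \<times>\<^sub>F at_upper m2)"
  shows "V = W"
proof -
  let ?S = "einterval a b"
  obtain G where G: "\<And>z. z \<in> D \<Longrightarrow> (G has_field_derivative g z) (at z)"
    "\<And>x. x \<in> einterval m1 m2 \<Longrightarrow> (G \<longlongrightarrow> G (complex_of_real x)) (at (complex_of_real x) within D)"
    "\<And>s t. s \<in> einterval m1 m2 \<Longrightarrow> t \<in> einterval m1 m2 \<Longrightarrow> s \<le> t \<Longrightarrow>
       ((\<lambda>x. g (complex_of_real x)) has_integral G (complex_of_real t) - G (complex_of_real s)) {s..t}"
    using primitive_up_to_interval[OF sc g] by metis
  have gD: "continuous_on D g" by (rule continuous_on_subset[OF g(2)]) simp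
  have \<gamma>D: "\<gamma> ` ?S \<subseteq> D" using \<gamma>_D by blast
  have \<gamma>c: "continuous_on ?S \<gamma>" by (rule arc_length_param_continuous[OF arc])
  have seq: "\<exists>l u :: nat \<Rightarrow> real. (\<forall>n. l n \<in> einterval p q \<and> u n \<in> einterval p q \<and> l n \<le> u n) \<and>
      (\<forall>x\<in>einterval p q. \<forall>\<^sub>F n in sequentially. l n < x \<and> x < u n)" if pq: "p < q" for p q :: ereal
  proof (rule einterval_Icc_approximation[OF pq])
    fix u l :: "nat \<Rightarrow> real"
    assume ul: "\<And>i. l i < u i" "\<And>i. p < ereal (l i)" "\<And>i. ereal (u i) < q"
      "(\<lambda>n. ereal (l n)) \<longlonglongrightarrow> p" "(\<lambda>n. ereal (u n)) \<longlonglongrightarrow> q"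
    have "l n \<in> einterval p q \<and> u n \<in> einterval p q \<and> l n \<le> u n" for n
    proof -
      have lt: "ereal (l n) < ereal (u n)" using ul(1) by simp
      show ?thesis
        using less_trans[OF lt ul(3)] less_trans[OF ul(2) lt] ul(2,3) lt by (simp add: einterval_def)
    qed
    moreover have "\<forall>\<^sub>F n in sequentially. l n < x \<and> x < u n" if "x \<in> einterval p q" for x
    proof -
      have "p < ereal x" "ereal x < q" using that by (auto simp: einterval_def)
      from order_tendstoD(2)[OF ul(4) this(1)] order_tendstoD(1)[OF ul(5) this(2)]
      show ?thesis by eventually_elim simp
    qed
    ultimately show ?thesis by blast
  qed
  obtain l u where lu: "\<And>n. l n \<in> einterval m1 m2 \<and> u n \<in> einterval m1 m2 \<and> l n \<le> u n"
    "\<And>x. x \<in> einterval m1 m2 \<Longrightarrow> \<forall>\<^sub>F n in sequentially. l n < x \<and> x < u n"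
    using seq[OF m1_less] by blast
  obtain l' u' where lu': "\<And>n. l' n \<in> ?S \<and> u' n \<in> ?S \<and> l' n \<le> u' n"
    "\<And>x. x \<in> ?S \<Longrightarrow> \<forall>\<^sub>F n in sequentially. l' n < x \<and> x < u' n"
    using seq[OF a_less] by blast
  define \<epsilon> :: "nat \<Rightarrow> real" where "\<epsilon> n = inverse (real (Suc n))" for n
  have \<epsilon>: "\<epsilon> n > 0" for n by (simp add: \<epsilon>_def)
  have "\<forall>n. \<exists>x t. x \<in> einterval m1 m2 \<and> x \<le> l n \<and> t \<in> ?S \<and> t \<le> l' n \<and> link D K' (complex_of_real x) (\<gamma> t) (\<epsilon> n)"
    using lower lu(1) lu'(1) \<epsilon> by blast
  then obtain x t where xt: "\<And>n. x n \<in> einterval m1 m2" "\<And>n. x n \<le> l n" "\<And>n. t n \<in> ?S" "\<And>n. t n \<le> l' n"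
    "\<And>n. link D K' (complex_of_real (x n)) (\<gamma> (t n)) (\<epsilon> n)" by metis
  have "\<forall>n. \<exists>x t. x \<in> einterval m1 m2 \<and> u n \<le> x \<and> t \<in> ?S \<and> u' n \<le> t \<and> link D K' (complex_of_real x) (\<gamma> t) (\<epsilon> n)"
    using upper lu(1) lu'(1) \<epsilon> by blast
  then obtain y s where ys: "\<And>n. y n \<in> einterval m1 m2" "\<And>n. u n \<le> y n" "\<And>n. s n \<in> ?S" "\<And>n. u' n \<le> s n"
    "\<And>n. link D K' (complex_of_real (y n)) (\<gamma> (s n)) (\<epsilon> n)" by metis
  have xy: "x n \<le> y n" and ts: "t n \<le> s n" for n
    using xt(2,4)[of n] ys(2,4)[of n] lu(1)[of n] lu'(1)[of n] by auto
  have "filterlim x (at_lower m1) sequentially"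
  proof (rule filterlim_at_lower[OF m1_less xt(1)])
    show "\<forall>\<^sub>F n in sequentially. x n < c" if "c \<in> einterval m1 m2" for c
      using lu(2)[OF that]
    proof eventually_elim
      case (elim n) then show ?case using xt(2)[of n] by simp
    qed
  qed
  moreover have "filterlim y (at_upper m2) sequentially"
  proof (rule filterlim_at_upper[OF m1_less ys(1)])
    show "\<forall>\<^sub>F n in sequentially. c < y n" if "c \<in> einterval m1 m2" for c
      using lu(2)[OF that]
    proof eventually_elim
      case (elim n) then show ?case using ys(2)[of n] by simp
    qed
  qed
  ultimately have "filterlim (\<lambda>n. (x n, y n)) (at_lower m1 \<times>\<^sub>F at_upper m2) sequentially"
    by (rule filterlim_Pair)
  from filterlim_compose[OF V this]
  have lim_V: "(\<lambda>n. integral {x n..y n} (\<lambda>x. g (complex_of_real x))) \<longlonglongrightarrow> V" by simp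
  \<comment> \<open>\<open>vector_derivative\<close> has an arbitrary value where \<open>\<gamma>\<close> is not differentiable: put zero there\<close>
  obtain N where N: "negligible N" "\<And>t. t \<in> ?S - N \<Longrightarrow> cmod (vector_derivative \<gamma> (at t)) = 1"
    using arc_length_param_null[OF arc] by metis
  define f where "f r = (if r \<in> N then 0 else vector_derivative \<gamma> (at r) * g (\<gamma> r))" for r
  have fW: "(f has_integral W) ?S"
    by (rule has_integral_spike[OF N(1) _ W]) (simp add: f_def)
  have sub: "{t n..s n} \<subseteq> ?S" for n by (rule einterval_subinterval[OF xt(3) ys(3)])
  have f_int: "(f has_integral G (\<gamma> (s n)) - G (\<gamma> (t n))) {t n..s n}" for n
  proof -
    have "\<gamma> ` {t n..s n} \<subseteq> D" using sub \<gamma>D by blast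
    from has_integral_spike[OF N(1) _ arc_length_param_integral[OF arc ts sub this gD G(1)]]
    show ?thesis by (simp add: f_def)
  qed
  define k where "k r = norm (K' (\<gamma> r))" for r
  have k_int: "k integrable_on ?S"
  proof -
    have "continuous_on ?S k"
      unfolding k_def by (intro continuous_on_norm continuous_on_compose2[OF K' \<gamma>c \<gamma>D])
    then have "(\<lambda>r. indicator ?S r *\<^sub>R k r) \<in> borel_measurable borel"
      by (intro borel_measurable_continuous_on_indicator) auto
    moreover have "(\<integral>\<^sup>+r. ennreal (indicator ?S r *\<^sub>R k r) \<partial>lborel) = V0 K' ?S \<gamma>"
      unfolding V0_def by (intro nn_integral_cong) (auto simp: k_def split: split_indicator)
    ultimately have "(\<lambda>r. indicator ?S r *\<^sub>R k r) integrable_on UNIV"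
      using V0 by (intro nn_integral_integrable_on) (auto simp: k_def)
    moreover have "(\<lambda>r. indicator ?S r *\<^sub>R k r) = (\<lambda>r. if r \<in> ?S then k r else 0)"
      by (auto split: split_indicator)
    ultimately show ?thesis by (simp add: integrable_restrict_UNIV)
  qed
  have fk: "norm (f r) \<le> C * k r" if "r \<in> ?S" for r
  proof -
    have "cmod (g (\<gamma> r)) \<le> C * k r" using le[OF \<gamma>_D[OF that]] by (simp add: k_def)
    then show ?thesis using N(2)[of r] that C by (simp add: f_def norm_mult k_def)
  qed
  define F where "F n r = (if r \<in> {t n..s n} then f r else 0)" for n r
  have F_int: "(F n has_integral G (\<gamma> (s n)) - G (\<gamma> (t n))) ?S" for n
    unfolding F_def by (rule has_integral_on_superset[OF _ _ sub])
      (use has_integral_eq[OF _ f_int, of _ "\<lambda>r. if r \<in> {t n..s n} then f r else 0"] in auto)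
  have "(\<lambda>n. integral ?S (F n)) \<longlonglongrightarrow> integral ?S f"
  proof (rule dominated_convergence(2))
    show "F n integrable_on ?S" for n using F_int by blast
    show "(\<lambda>r. C * k r) integrable_on ?S" using k_int by (rule integrable_on_mult_right)
    show "norm (F n r) \<le> C * k r" if "r \<in> ?S" for n r
      using fk[OF that] C by (simp add: F_def k_def)
    show "(\<lambda>n. F n r) \<longlonglongrightarrow> f r" if "r \<in> ?S" for r
    proof (rule tendsto_eventually)
      show "\<forall>\<^sub>F n in sequentially. F n r = f r"
        using lu'(2)[OF that]
      proof eventually_elim
        case (elim n) then show ?case using xt(4)[of n] ys(4)[of n] by (simp add: F_def)
      qed
    qed
  qed
  then have lim_W: "(\<lambda>n. G (\<gamma> (s n)) - G (\<gamma> (t n))) \<longlonglongrightarrow> W"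
    using integral_unique[OF F_int] integral_unique[OF fW] by simp
  have close: "cmod (integral {x n..y n} (\<lambda>x. g (complex_of_real x)) - (G (\<gamma> (s n)) - G (\<gamma> (t n)))) \<le> 2 * C * \<epsilon> n" for n
  proof -
    have "integral {x n..y n} (\<lambda>x. g (complex_of_real x)) = G (complex_of_real (y n)) - G (complex_of_real (x n))"
      by (rule integral_unique[OF G(3)[OF xt(1) ys(1) xy]])
    then have "integral {x n..y n} (\<lambda>x. g (complex_of_real x)) - (G (\<gamma> (s n)) - G (\<gamma> (t n)))
        = (G (\<gamma> (t n)) - G (complex_of_real (x n))) - (G (\<gamma> (s n)) - G (complex_of_real (y n)))" by simp
    also have "cmod \<dots> \<le> cmod (G (\<gamma> (t n)) - G (complex_of_real (x n))) + cmod (G (\<gamma> (s n)) - G (complex_of_real (y n)))"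
      by (rule norm_triangle_ineq4)
    also have "\<dots> \<le> C * \<epsilon> n + C * \<epsilon> n"
      by (intro add_mono link_estimate[OF gD K' le C G(1) G(2)[OF xt(1)] xt(5) \<epsilon>]
          link_estimate[OF gD K' le C G(1) G(2)[OF ys(1)] ys(5) \<epsilon>])
    finally show ?thesis by simp
  qed
  have "\<epsilon> \<longlonglongrightarrow> 0" unfolding \<epsilon>_def by (rule LIMSEQ_inverse_real_of_nat)
  then have "(\<lambda>n. 2 * C * \<epsilon> n) \<longlonglongrightarrow> 0" by (rule tendsto_mult_right_zero)
  then have "(\<lambda>n. integral {x n..y n} (\<lambda>x. g (complex_of_real x)) - (G (\<gamma> (s n)) - G (\<gamma> (t n)))) \<longlonglongrightarrow> 0"
    by (rule Lim_null_comparison[OF always_eventually[OF allI[OF close]]])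
  moreover have "(\<lambda>n. integral {x n..y n} (\<lambda>x. g (complex_of_real x)) - (G (\<gamma> (s n)) - G (\<gamma> (t n)))) \<longlonglongrightarrow> V - W"
    by (rule tendsto_diff[OF lim_V lim_W])
  ultimately have "0 = V - W" by (rule LIMSEQ_unique)
  then show ?thesis by simp
qed

end

section \<open>The weak form of the contour integrals\<close>

lemma holomorphic_resolvent_form:
  fixes K' :: "complex \<Rightarrow> ('b::chilbert \<Rightarrow>\<^sub>L 'b)"
  assumes K': "op_holomorphic_on K' U" and U: "open U" and lin: "\<And>z. z \<in> U \<Longrightarrow> clinear_op (K' z)"
    and D: "open D" "D \<subseteq> U" "D \<inter> spec UNIV (blinfun_apply Z) = {}"
  shows "(\<lambda>z. cinner y (K' z (resolvent Z z x))) holomorphic_on D"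
  unfolding holomorphic_on_open[OF D(1)]
proof
  fix z assume z: "z \<in> D"
  let ?R = "resolvent Z"
  have zU: "z \<in> U" using z D by auto
  obtain F' where F': "(K' has_derivative (\<lambda>h. h *\<^sub>O F')) (at z within U)"
    using K' zU unfolding op_holomorphic_on_def by blast
  then have dK: "(K' has_derivative (\<lambda>h. h *\<^sub>O F')) (at z)"
    by (simp only: at_within_open[OF zU U])
  have "(?R has_derivative (\<lambda>h. h *\<^sub>O (?R z o\<^sub>L ?R z))) (at z within D)"
    by (rule has_derivative_subset[OF has_derivative_resolvent]) (use z D in auto)
  then have "(?R has_derivative (\<lambda>h. h *\<^sub>O (?R z o\<^sub>L ?R z))) (at z)"
    by (simp only: at_within_open[OF z D(1)])
  from bounded_linear.has_derivative[OF bounded_linear_apply_blinfun[of x] this]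
  have "((\<lambda>z. ?R z x) has_derivative (\<lambda>h. (h *\<^sub>O (?R z o\<^sub>L ?R z)) x)) (at z)" .
  from bounded_linear.has_derivative[OF bounded_linear_cinner_right[of y]
      bounded_bilinear.FDERIV[OF bounded_bilinear_blinfun_apply dK this]]
  have "((\<lambda>z. cinner y (K' z (?R z x))) has_derivative
      (\<lambda>h. cinner y (K' z ((h *\<^sub>O (?R z o\<^sub>L ?R z)) x) + (h *\<^sub>O F') (?R z x)))) (at z)" .
  moreover have "(\<lambda>h. cinner y (K' z ((h *\<^sub>O (?R z o\<^sub>L ?R z)) x) + (h *\<^sub>O F') (?R z x)))
      = (*) (cinner y (K' z (?R z (?R z x))) + cinner y (F' (?R z x)))"
    using lin[OF zU] by (auto simp: clinear_op_def cinner_add_right cinner_scaleC_right algebra_simps)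
  ultimately show "\<exists>g'. ((\<lambda>z. cinner y (K' z (?R z x))) has_field_derivative g') (at z)"
    unfolding has_field_derivative_def by auto
qed

lemma continuous_resolvent_form:
  fixes K' :: "complex \<Rightarrow> ('b::chilbert \<Rightarrow>\<^sub>L 'b)"
  assumes K': "continuous_on S K'" and S: "S \<inter> spec UNIV (blinfun_apply Z) = {}"
  shows "continuous_on S (\<lambda>z. cinner y (K' z (resolvent Z z x)))"
proof -
  have R: "continuous_on S (resolvent Z)"
    by (rule continuous_on_subset[OF continuous_on_resolvent]) (use S in auto)
  have "continuous_on S (\<lambda>z. resolvent Z z x)"
    by (rule bounded_linear.continuous_on[OF bounded_linear_apply_blinfun R])
  then have "continuous_on S (\<lambda>z. K' z (resolvent Z z x))"
    by (rule bounded_bilinear.continuous_on[OF bounded_bilinear_blinfun_apply K'])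
  then show ?thesis by (rule bounded_linear.continuous_on[OF bounded_linear_cinner_right])
qed

lemma norm_resolvent_form_le:
  fixes K Z :: "'b::chilbert \<Rightarrow>\<^sub>L 'b"
  assumes "norm (resolvent Z z) \<le> C"
  shows "cmod (cinner y (K (resolvent Z z x))) \<le> (norm y * (C * norm x)) * norm K"
proof -
  have "cmod (cinner y (K (resolvent Z z x))) \<le> norm y * norm (K (resolvent Z z x))"
    by (rule norm_cinner_le)
  also have "\<dots> \<le> norm y * (norm K * (norm (resolvent Z z) * norm x))"
    by (intro mult_left_mono order_trans[OF norm_blinfun] norm_blinfun) auto
  also have "\<dots> \<le> norm y * (norm K * (C * norm x))"
    by (intro mult_left_mono mult_right_mono assms) auto
  finally show ?thesis by (simp add: mult_ac)
qed

section \<open>The solution of the Riccati equation\<close>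

lemma in_closure_einterval:
  assumes "m1 < m2" "m1 \<le> ereal \<mu>" "ereal \<mu> \<le> m2"
  shows "\<mu> \<in> closure (einterval m1 m2)"
proof (cases "\<mu> \<in> einterval m1 m2")
  case True
  then show ?thesis using closure_subset by blast
next
  case False
  then have at_end: "m1 = ereal \<mu> \<or> m2 = ereal \<mu>" using assms by (auto simp: einterval_def)
  show ?thesis
    unfolding closure_approachable
  proof (intro allI impI)
    fix e :: real assume e: "e > 0"
    have "\<exists>p. m1 < ereal p \<and> ereal p < m2 \<and> \<bar>p - \<mu>\<bar> < e"
      using at_end
    proof
      assume m: "m1 = ereal \<mu>"
      then have "m1 < min m2 (ereal (\<mu> + e))" using assms e by simp
      then obtain p where "m1 < ereal p" "ereal p < min m2 (ereal (\<mu> + e))" using ereal_dense2 by blast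
      then show ?thesis using m by (intro exI[of _ p]) auto
    next
      assume m: "m2 = ereal \<mu>"
      then have "max m1 (ereal (\<mu> - e)) < m2" using assms e by simp
      then obtain p where "max m1 (ereal (\<mu> - e)) < ereal p" "ereal p < m2" using ereal_dense2 by blast
      then show ?thesis using m by (intro exI[of _ p]) auto
    qed
    then show "\<exists>p\<in>einterval m1 m2. dist p \<mu> < e" by (auto simp: einterval_def dist_real_def)
  qed
qed

lemma Dl_domain:
  assumes K': "continued_derivative E B m1 m2 Dm K'" and l: "l \<in> {1, -1}"
  shows "open (Dl Dm l)" "simply_connected (Dl Dm l)"
    "z \<in> Dl Dm l \<Longrightarrow> real_of_int l * Im z > 0"
    "complex_of_real ` closure (einterval m1 m2) \<subseteq> closure (Dl Dm l)"
    "Dl Dm l \<subseteq> Dm \<union> cnj ` Dm" "open (Dm \<union> cnj ` Dm)"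
proof -
  have Dm: "open Dm" "simply_connected Dm" "Dm \<subseteq> {z. Im z < 0}"
    "complex_of_real ` einterval m1 m2 \<subseteq> frontier Dm"
    using K' by (auto simp: continued_derivative_def)
  have vim: "cnj ` Dm = cnj -` Dm"
    by (auto intro!: image_eqI[where x = "cnj _"])
  have open_cnj: "open (cnj ` Dm)"
    unfolding vim by (intro open_vimage Dm continuous_intros)
  have hom: "homeomorphism Dm (cnj ` Dm) cnj cnj"
    by (rule homeomorphismI) (auto intro!: continuous_intros)
  show "open (Dl Dm l)" using Dm open_cnj by (simp add: Dl_def)
  show "open (Dm \<union> cnj ` Dm)" using Dm open_cnj by auto
  show "Dl Dm l \<subseteq> Dm \<union> cnj ` Dm" by (auto simp: Dl_def)
  have "Dm homeomorphic cnj ` Dm" unfolding homeomorphic_def using hom by blast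
  then have "simply_connected (cnj ` Dm)" using Dm(2) by (rule homeomorphic_simply_connected)
  then show "simply_connected (Dl Dm l)" using Dm by (simp add: Dl_def)
  show "real_of_int l * Im z > 0" if "z \<in> Dl Dm l"
    using that l Dm(3) by (auto simp: Dl_def split: if_splits)
  have cl: "complex_of_real ` closure (einterval m1 m2) \<subseteq> closure Dm"
  proof -
    have "complex_of_real ` closure (einterval m1 m2) \<subseteq> closure (complex_of_real ` einterval m1 m2)"
      by (intro closure_bounded_linear_image_subset bounded_linear_of_real)
    also have "\<dots> \<subseteq> closure (closure Dm)"
      using Dm(4) by (intro closure_mono) (auto simp: frontier_def)
    finally show ?thesis by simp
  qed
  moreover have "complex_of_real ` closure (einterval m1 m2) \<subseteq> closure (cnj ` Dm)"
  proof -
    have "complex_of_real ` closure (einterval m1 m2) = cnj ` complex_of_real ` closure (einterval m1 m2)"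
      by (simp add: image_image)
    also have "\<dots> \<subseteq> cnj ` closure Dm" using cl by (rule image_mono)
    also have "\<dots> \<subseteq> closure (cnj ` Dm)"
      by (intro closure_bounded_linear_image_subset bounded_linear_cnj)
    finally show ?thesis .
  qed
  ultimately show "complex_of_real ` closure (einterval m1 m2) \<subseteq> closure (Dl Dm l)"
    by (simp add: Dl_def)
qed

lemma endpoint_bound_within:
  assumes "endpoint_bound Dm K' m" "\<bar>m\<bar> \<noteq> \<infinity>" "D \<subseteq> Dm \<union> cnj ` Dm"
  shows "\<exists>C>0. \<exists>\<kappa>>-1. \<forall>\<^sub>F z in at (complex_of_real (real_of_ereal m)) within D.
        norm (K' z) \<le> C * cmod (z - complex_of_real (real_of_ereal m)) powr \<kappa>"
proof -
  obtain C \<kappa> where "C > 0" "\<kappa> \<in> {-1<..0}"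
    and ev: "\<forall>\<^sub>F z in at (complex_of_real (real_of_ereal m)) within (Dm \<union> cnj ` Dm).
        norm (K' z) \<le> C * cmod (z - complex_of_real (real_of_ereal m)) powr \<kappa>"
    using assms(1,2) unfolding endpoint_bound_def by blast
  moreover have "\<forall>\<^sub>F z in at (complex_of_real (real_of_ereal m)) within D.
        norm (K' z) \<le> C * cmod (z - complex_of_real (real_of_ereal m)) powr \<kappa>"
    by (rule filter_leD[OF at_le[OF assms(3)] ev])
  ultimately show ?thesis by auto
qed

theorem lemma4p3:
  fixes A0 :: "'a::chilbert \<Rightarrow> 'a" and D0 :: "'a set"
    and E0 :: "real set \<Rightarrow> ('a \<Rightarrow>\<^sub>L 'a)"
    and A1 X :: "'b::chilbert \<Rightarrow>\<^sub>L 'b"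
    and B :: "'b \<Rightarrow>\<^sub>L 'a"
    and m1 m2 a b :: ereal
    and Dm :: "complex set" and K' :: "complex \<Rightarrow> ('b \<Rightarrow>\<^sub>L 'b)"
    and l :: int and \<gamma> :: "real \<Rightarrow> complex"
  assumes A0: "selfadjoint D0 A0"
    and A1: "selfadjoint UNIV A1"
    and B: "clinear_op B"
    and E0: "spectral_measure_of D0 A0 E0"
    and ac: "abs_cont_spectrum E0"
    and m: "m1 < m2"
    and spec0: "spec D0 A0 = complex_of_real ` closure (einterval m1 m2)"
    and spec1: "spec UNIV A1 \<subseteq> complex_of_real ` einterval m1 m2"
    and K': "continued_derivative E0 B m1 m2 Dm K'"
    and bound1: "endpoint_bound Dm K' m1"
    and bound2: "endpoint_bound Dm K' m2"
    and l: "l \<in> {1, -1}"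
    and adm: "admissible (Dl Dm l) K' m1 m2 a b \<gamma>"
    and small: "V0 K' (einterval a b) \<gamma> < ennreal ((contour_dist A1 a b \<gamma>)\<^sup>2 / 4)"
    and X: "basic_solution K' a b \<gamma> A1 X"
    and away: "setdist (spec UNIV (A1 + X)) (Dl Dm l) > 0"
  shows "\<exists>Y :: 'b \<Rightarrow>\<^sub>L 'a. clinear_op Y \<and>
     (\<forall>x. has_improper_stieltjes E0
        (\<lambda>\<mu>. B (resolvent (A1 + X) (complex_of_real \<mu>) x)) m1 m2 (Y x)) \<and>
     (let I = (\<integral>\<^sup>+\<mu>\<in>einterval m1 m2. ennreal (norm (K' (complex_of_real \<mu>)) *
                (norm (resolvent (A1 + X) (complex_of_real \<mu>)))\<^sup>2) \<partial>lborel)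
      in I < \<infinity> \<longrightarrow> norm Y \<le> sqrt (enn2real I)) \<and>
     strong_solution D0 A0 UNIV A1 B Y"
proof -
  let ?D = "Dl Dm l" and ?Z = "A1 + X" and ?I = "einterval m1 m2" and ?S = "einterval a b"
  let ?\<sigma> = "real_of_int l"
  note D = Dl_domain[OF K' l]
  interpret spectral_operator D0 A0 E0 by unfold_locales (rule A0, rule E0)
  have full: "E0 ?I x = x" for x by (rule E_full_interval[OF ac spec0])
  have lin: "\<And>z. z \<in> Dm \<union> cnj ` Dm \<Longrightarrow> clinear_op (K' z)"
    and hol: "op_holomorphic_on K' (Dm \<union> cnj ` Dm)"
    and contK: "continuous_on (Dm \<union> cnj ` Dm \<union> complex_of_real ` ?I) K'"
    and derivK: "\<And>\<mu>. \<mu> \<in> ?I \<Longrightarrow> (K_B E0 B has_vector_derivative K' (complex_of_real \<mu>)) (at \<mu>)"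
    using K' unfolding continued_derivative_def by blast+
  have disj: "closure ?D \<inter> spec UNIV (blinfun_apply ?Z) = {}"
  proof (rule ccontr)
    assume "closure ?D \<inter> spec UNIV (blinfun_apply ?Z) \<noteq> {}"
    then obtain z where z: "z \<in> closure ?D" "z \<in> spec UNIV (blinfun_apply ?Z)" by blast
    have "setdist (spec UNIV (blinfun_apply ?Z)) (closure ?D) \<le> dist z z"
      by (rule setdist_le_dist[OF z(2,1)])
    then show False using away by (simp add: setdist_closure_2)
  qed
  have real_cl: "complex_of_real \<mu> \<in> closure ?D" if "m1 \<le> ereal \<mu>" "ereal \<mu> \<le> m2" for \<mu>
    using in_closure_einterval[OF m that] D(4) by blast
  interpret riccati D0 A0 E0 B ?Z m1 m2 "\<lambda>\<mu>. K' (complex_of_real \<mu>)"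
  proof unfold_locales
    show "continuous_on ?I (\<lambda>\<mu>. K' (complex_of_real \<mu>))"
      by (rule continuous_on_compose2[OF contK]) (auto intro!: continuous_intros)
    show "complex_of_real \<mu> \<notin> spec UNIV (blinfun_apply ?Z)" if "m1 \<le> ereal \<mu>" "ereal \<mu> \<le> m2" for \<mu>
      using real_cl[OF that] disj by blast
  qed (fact B m full derivK)+
  obtain Y :: "'b \<Rightarrow>\<^sub>L 'a" where Y: "clinear_op Y"
    "\<And>x. has_improper_stieltjes E0 (\<lambda>\<mu>. B (resolvent ?Z (complex_of_real \<mu>) x)) m1 m2 (Y x)"
    "(\<integral>\<^sup>+\<mu>\<in>?I. ennreal (norm (K' (complex_of_real \<mu>)) * (norm (resolvent ?Z (complex_of_real \<mu>)))\<^sup>2) \<partial>lborel) < \<infinity> \<Longrightarrow>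
      norm Y \<le> sqrt (enn2real (\<integral>\<^sup>+\<mu>\<in>?I. ennreal (norm (K' (complex_of_real \<mu>)) *
        (norm (resolvent ?Z (complex_of_real \<mu>)))\<^sup>2) \<partial>lborel))"
    "\<And>x. Y x \<in> D0" "\<And>x. A0 (Y x) = Y (?Z x) - B x"
    "\<And>x y. ((\<lambda>(s, t). integral {s..t} (\<lambda>\<mu>. cinner y (K' (complex_of_real \<mu>) (resolvent ?Z (complex_of_real \<mu>) x))))
      \<longlongrightarrow> cinner y (adj B (Y x))) (at_lower m1 \<times>\<^sub>F at_upper m2)"
    using solution by blast
  have adm': "contour ?D m1 m2 a b \<gamma>" "fixes_infinite_ends ?D K' m1 m2 \<gamma>" "V0 K' ?S \<gamma> < \<infinity>"
    using adm unfolding admissible_def by blast+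
  have ct: "a < b" "a = - \<infinity> \<longleftrightarrow> m1 = - \<infinity>" "b = \<infinity> \<longleftrightarrow> m2 = \<infinity>" "arc_length_param ?S \<gamma>"
    using adm'(1) unfolding contour_def by blast+
  obtain h where h: "deformation ?D m1 m2 a b \<gamma> h" using adm'(1) unfolding contour_def by blast
  note h = h[unfolded deformation_def]
  note h' = h[THEN conjunct2, THEN conjunct2]
  obtain \<phi> where \<phi>: "strict_mono_on ?S \<phi> \<and> \<phi> ` ?S = ?I \<and> (\<forall>t\<in>?S. h (0, t) = complex_of_real (\<phi> t))"
    using h[THEN conjunct2, THEN conjunct1] by (rule exE)
  interpret contour_deformation ?D m1 m2 a b \<gamma> h \<phi> ?\<sigma>
  proof unfold_locales
    show "\<bar>?\<sigma>\<bar> = 1" using l by auto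
    show "?\<sigma> * Im z > 0" if "z \<in> ?D" for z by (rule D(3)[OF that])
    show "h (s, t) \<in> ?D" if "s \<in> {0<..1}" "t \<in> ?S" for s t
      using subsetD[OF h'[THEN conjunct2, THEN conjunct1]] imageI[of "(s, t)" "{0<..1} \<times> ?S" h] that by simp
    show "h (0, t) = complex_of_real (\<phi> t)" if "t \<in> ?S" for t using \<phi> that by simp
    show "h (1, t) = \<gamma> t" if "t \<in> ?S" for t using h'[THEN conjunct1] that by simp
    show "strict_mono_on ?S \<phi>" "\<phi> ` ?S = ?I" using \<phi> by simp_all
    show "continuous_on ({0..1} \<times> ?S) h" using h[THEN conjunct1] .
    show "filterlim h (end_filter m1) (principal {0..1} \<times>\<^sub>F at_lower a)"
      "filterlim h (end_filter m2) (principal {0..1} \<times>\<^sub>F at_upper b)"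
      using h'[THEN conjunct2, THEN conjunct2] by simp_all
  qed (fact D(1) m ct(1))+
  obtain C where C: "C > 0" "\<And>z. z \<in> closure ?D \<Longrightarrow> norm (resolvent ?Z z) \<le> C"
    using bounded_resolvent[OF closed_closure disj] by blast
  have DK: "continuous_on ?D K'" by (rule continuous_on_subset[OF contK]) (use D(5) in auto)
  \<comment> \<open>\<open>B\<^sup>* Y x\<close> is the integral of \<open>K' R x\<close> over the interval, \<open>- X x\<close> the one over the contour\<close>
  have X_eq: "adj B (Y x) = - X x" for x
  proof -
    have "cinner y (adj B (Y x)) = cinner y ((- X) x)" for y
    proof (rule contour_integral_eq_limit[where K' = K' and C = "norm y * (C * norm x)"
          and g = "\<lambda>z. cinner y (K' z (resolvent ?Z z x))"])
      show "(\<lambda>z. cinner y (K' z (resolvent ?Z z x))) holomorphic_on ?D"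
        by (rule holomorphic_resolvent_form[OF hol D(6) lin D(1) D(5)]) (use disj closure_subset in blast)+
      show "continuous_on (?D \<union> complex_of_real ` ?I) (\<lambda>z. cinner y (K' z (resolvent ?Z z x)))"
      proof (rule continuous_resolvent_form)
        show "continuous_on (?D \<union> complex_of_real ` ?I) K'"
          by (rule continuous_on_subset[OF contK]) (use D(5) in auto)
        have "?D \<union> complex_of_real ` ?I \<subseteq> closure ?D"
          using closure_subset[of ?D] real_cl by (auto simp: einterval_def)
        then show "(?D \<union> complex_of_real ` ?I) \<inter> spec UNIV (blinfun_apply ?Z) = {}" using disj by blast
      qed
      show "cmod (cinner y (K' z (resolvent ?Z z x))) \<le> norm y * (C * norm x) * norm (K' z)"
        if "z \<in> ?D" for z
        by (rule norm_resolvent_form_le[OF C(2)]) (use that closure_subset in blast)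
      show "\<exists>x t. x \<in> ?I \<and> x \<le> x0 \<and> t \<in> ?S \<and> t \<le> t0 \<and> link ?D K' (complex_of_real x) (\<gamma> t) e"
        if "x0 \<in> ?I" "t0 \<in> ?S" "e > 0" for x0 t0 e
        by (rule lower_link[OF _ _ _ that(3,1,2)])
          (use endpoint_bound_within[OF bound1 _ D(5)] adm'(2) ct(2) that(3) in
            \<open>auto simp: fixes_infinite_ends_def\<close>)
      show "\<exists>x t. x \<in> ?I \<and> x0 \<le> x \<and> t \<in> ?S \<and> t0 \<le> t \<and> link ?D K' (complex_of_real x) (\<gamma> t) e"
        if "x0 \<in> ?I" "t0 \<in> ?S" "e > 0" for x0 t0 e
        by (rule upper_link[OF _ _ _ that(3,1,2)])
          (use endpoint_bound_within[OF bound2 _ D(5)] adm'(2) ct(3) that(3) in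
            \<open>auto simp: fixes_infinite_ends_def\<close>)
      have "((\<lambda>t. vector_derivative \<gamma> (at t) *\<^sub>O (K' (\<gamma> t) o\<^sub>L resolvent ?Z (\<gamma> t))) has_integral - X) ?S"
        using X unfolding basic_solution_def has_W1_def by blast
      from has_integral_linear[OF this bounded_linear_compose[OF bounded_linear_cinner_right[of y]
            bounded_linear_apply_blinfun[of x]]]
      show "((\<lambda>t. vector_derivative \<gamma> (at t) * cinner y (K' (\<gamma> t) (resolvent ?Z (\<gamma> t) x)))
          has_integral cinner y ((- X) x)) ?S"
        by (simp add: o_def cinner_scaleC_right)
      show "norm y * (C * norm x) \<ge> 0" using C(1) by simp
    qed (fact D(2) ct(4) DK adm'(3) Y(6))+
    then have "adj B (Y x) = (- X) x" using cinner_eq_iff by blast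
    then show ?thesis by (simp add: blinfun.minus_left)
  qed
  have "strong_solution D0 A0 UNIV A1 B Y"
    unfolding strong_solution_def
    by (simp add: Y(1,4,5) X_eq blinfun.add_left blinfun.add_right blinfun.minus_right)
  then show ?thesis
    unfolding Let_def using Y(1,2,3) by blast
qed

end
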